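(* Let $C_4 = \{[X:Y:Z]\in\mathbb{P}^2 \mid X^4+Y^4+Z^4=0\}$, a smooth plane quartic over $\mathbb{Q}$, let $\zeta_8=\exp(2\pi\sqrt{-1}/8)$, and let $E$ be the divisor on $C_4$ over $\mathbb{Q}(\zeta_8)$ given by $$E=2[1:0:\zeta_8^3]-2[1:0:\zeta_8^7].$$ (1) The divisor class $[E]\in\mathrm{Jac}(C_4)(\mathbb{Q}(\zeta_8))$ is invariant under the action of $\mathrm{Gal}(\mathbb{Q}(\zeta_8)/\mathbb{Q})$. (2) The divisor $E$ is not linearly equivalent to a divisor defined over $\mathbb{Q}$. In other words, the image of $[E]$ in the relative Brauer group $\mathrm{Br}(C_4/\mathbb{Q})$ is non-trivial.
   Context: $\mathrm{Jac}(C_4)=\mathrm{Pic}^0_{C_4/\mathbb{Q}}$ is the Jacobian variety of $C_4$, and $[D]$ is the linear equivalence class of a divisor $D$. By (1), $[E]$ is an element of $\mathrm{Jac}(C_4)(\mathbb{Q})$. The relative Brauer group is $\mathrm{Br}(C_4/\mathbb{Q})=\mathrm{Ker}(\mathrm{Br}(\mathbb{Q})\to\mathrm{Br}(C_4))$. There is an exact sequence $$0\to\mathrm{Pic}^0(C_4)\to\mathrm{Jac}(C_4)(\mathbb{Q})\xrightarrow{\ \mathrm{Br}\ }\mathrm{Br}(C_4/\mathbb{Q}),$$ where $\mathrm{Pic}^0(C_4)$ is the group of degree $0$ divisors defined over $\mathbb{Q}$ modulo linear equivalence. It comes from the standard low-degree exact sequence $0\to\mathrm{Pic}(C_4)\to\mathrm{Pic}(C_4\otimes\overline{\mathbb{Q}})^{\mathrm{Gal}(\overline{\mathbb{Q}}/\mathbb{Q})}\to\mathrm{Br}(\mathbb{Q})\to\mathrm{Br}(C_4)$.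 The image of $[E]$ in $\mathrm{Br}(C_4/\mathbb{Q})$ is its image under the map $\mathrm{Br}$. *)

theory Defs
  imports "HOL-Analysis.Analysis" "HOL-Computational_Algebra.Computational_Algebra"
    "HOL-Computational_Algebra.Field_as_Ring" "HOL-Algebra.Finite_Extensions" "HOL-Algebra.Product_Groups"
begin

section \<open>Algebraic complex numbers form a field\<close>

definition complex_ring :: "complex ring"
  where "complex_ring = \<lparr>carrier = UNIV, monoid.mult = (*), one = 1, ring.zero = 0, add = (+)\<rparr>"

lemma complex_ring_field: "field complex_ring"
proof -
  have "\<exists>y. x + y = 0" for x :: complex
    using add.right_inverse by blast
  moreover have "x \<noteq> 0 \<Longrightarrow> \<exists>y. x * y = 1" for x :: complex
    by (rule exI[of _ "inverse x"]) auto
  ultimately show ?thesis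
    unfolding complex_ring_def using add.right_inverse
    by unfold_locales (auto simp: algebra_simps Units_def)
qed

lemma subfield_algebraic: "subfield {x. Polynomial.algebraic x} complex_ring"
proof -
  interpret CC: field complex_ring by (rule complex_ring_field)
  have sel: "carrier complex_ring = UNIV" "\<And>x y. x \<otimes>\<^bsub>complex_ring\<^esub> y = x * y"
    "\<And>x y. x \<oplus>\<^bsub>complex_ring\<^esub> y = x + y" "\<one>\<^bsub>complex_ring\<^esub> = 1" "\<zero>\<^bsub>complex_ring\<^esub> = 0"
    by (simp_all add: complex_ring_def)
  have neg: "\<ominus>\<^bsub>complex_ring\<^esub> x = - x" for x
    using CC.minus_equality[of "-x" x] by (simp add: sel)
  have inv: "inv\<^bsub>complex_ring\<^esub> x = inverse x" if "x \<noteq> 0" for x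
    by (rule CC.comm_inv_char) (simp_all add: sel that)
  have pow: "x [^]\<^bsub>complex_ring\<^esub> n = x ^ n" for x and n :: nat
    by (induction n) (simp_all add: sel mult.commute)
  have sub: "subfield \<rat> complex_ring"
    by (rule CC.subfieldI'[OF CC.subringI]) (auto simp: sel neg inv)
  have eval: "CC.eval p x = poly (Poly (rev p)) x" for p x
    by (induction p) (simp_all add: sel pow Poly_append poly_monom)
  have "(CC.algebraic over \<rat>) x \<longleftrightarrow> Polynomial.algebraic x" for x
  proof
    assume "(CC.algebraic over \<rat>) x"
    then obtain p where p: "p \<in> carrier (\<rat>[X]\<^bsub>complex_ring\<^esub>)" "p \<noteq> []"
        "CC.eval p x = \<zero>\<^bsub>complex_ring\<^esub>"
      using CC.algebraicE[OF subfieldE(1)[OF sub]] by (auto simp: sel)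
    have r: "set p \<subseteq> \<rat>" and l: "hd p \<noteq> 0"
      using p(1,2) by (auto simp: univ_poly_def polynomial_def sel)
    show "Polynomial.algebraic x"
    proof (rule Polynomial.algebraicI')
      show "poly (Poly (rev p)) x = 0" using p(3) by (simp add: eval sel)
      show "Polynomial.coeff (Poly (rev p)) i \<in> \<rat>" for i
        by (auto simp: nth_default_def rev_nth intro!: subsetD[OF r])
      show "Poly (rev p) \<noteq> 0"
      proof
        assume "Poly (rev p) = 0"
        then obtain n where n: "rev p = replicate n 0" by (auto simp: Poly_eq_0)
        then have "p = replicate n 0" by (metis rev_replicate rev_rev_ident)
        with p(2) l show False by (cases n) auto
      qed
    qed
  next
    assume "Polynomial.algebraic x"
    then obtain q where q: "\<And>i. Polynomial.coeff q i \<in> \<int>" "q \<noteq> 0" "poly q x = 0"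
      using Polynomial.algebraicE by blast
    let ?p = "rev (coeffs q)"
    have "set (coeffs q) \<subseteq> \<rat>"
      using q(1) by (auto simp: coeffs_def intro: subsetD[OF Ints_subset_Rats])
    then have "?p \<in> carrier (\<rat>[X]\<^bsub>complex_ring\<^esub>)"
      using q(2) by (auto simp: univ_poly_def polynomial_def sel hd_rev last_coeffs_eq_coeff_degree)
    moreover have "?p \<noteq> []" using q(2) by simp
    moreover have "CC.eval ?p x = \<zero>\<^bsub>complex_ring\<^esub>" using q(3) by (simp add: eval sel)
    ultimately show "(CC.algebraic over \<rat>) x"
      using CC.algebraicI by blast
  qed
  then show ?thesis
    using CC.subfield_of_algebraics[OF sub] by (simp add: sel)
qed

lemma algebraic_add: "Polynomial.algebraic x \<Longrightarrow> Polynomial.algebraic y \<Longrightarrow> Polynomial.algebraic (x + y :: complex)"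
  and algebraic_mult: "Polynomial.algebraic x \<Longrightarrow> Polynomial.algebraic y \<Longrightarrow> Polynomial.algebraic (x * y :: complex)"
  using subringE(6,7)[OF subfieldE(1)[OF subfield_algebraic]] by (auto simp: complex_ring_def)

section \<open>The field of algebraic numbers inside the complex numbers\<close>

typedef qbar = "{z::complex. Polynomial.algebraic z}" morphisms of_qbar Abs_qbar
  by (rule exI[of _ 0]) simp

setup_lifting type_definition_qbar

instantiation qbar :: Fields.field
begin
lift_definition zero_qbar :: qbar is 0 by simp
lift_definition one_qbar :: qbar is 1 by simp
lift_definition plus_qbar :: "qbar \<Rightarrow> qbar \<Rightarrow> qbar" is "(+)" by (rule algebraic_add)
lift_definition times_qbar :: "qbar \<Rightarrow> qbar \<Rightarrow> qbar" is "(*)" by (rule algebraic_mult)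
lift_definition uminus_qbar :: "qbar \<Rightarrow> qbar" is uminus by (rule algebraic_minus)
lift_definition minus_qbar :: "qbar \<Rightarrow> qbar \<Rightarrow> qbar" is "(-)"
  by (metis algebraic_add algebraic_minus diff_conv_add_uminus)
lift_definition inverse_qbar :: "qbar \<Rightarrow> qbar" is inverse by (rule algebraic_inverse)
lift_definition divide_qbar :: "qbar \<Rightarrow> qbar \<Rightarrow> qbar" is "(/)"
  by (metis algebraic_mult algebraic_inverse divide_inverse)
instance
  by standard (transfer; simp add: algebra_simps divide_inverse)+
end

lemma of_qbar_of_nat: "of_qbar (of_nat n) = of_nat n"
  by (induction n) (simp_all add: zero_qbar.rep_eq one_qbar.rep_eq plus_qbar.rep_eq)

instance qbar :: field_char_0
proof
  show "inj (of_nat :: nat \<Rightarrow> qbar)"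
    by (rule injI) (metis of_qbar_of_nat of_nat_eq_iff)
qed

instantiation qbar :: "{unique_euclidean_ring, normalization_euclidean_semiring, normalization_semidom_multiplicative}"
begin
definition [simp]: "normalize_qbar = (normalize_field :: qbar \<Rightarrow> _)"
definition [simp]: "unit_factor_qbar = (unit_factor_field :: qbar \<Rightarrow> _)"
definition [simp]: "modulo_qbar = (mod_field :: qbar \<Rightarrow> _)"
definition [simp]: "euclidean_size_qbar = (euclidean_size_field :: qbar \<Rightarrow> _)"
definition [simp]: "division_segment (x :: qbar) = 1"
instance
  by standard (simp_all add: dvd_field_iff field_split_simps split: if_splits)
end

instantiation qbar :: euclidean_ring_gcd
begin
definition gcd_qbar :: "qbar \<Rightarrow> qbar \<Rightarrow> qbar" where "gcd_qbar = Euclidean_Algorithm.gcd"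
definition lcm_qbar :: "qbar \<Rightarrow> qbar \<Rightarrow> qbar" where "lcm_qbar = Euclidean_Algorithm.lcm"
definition Gcd_qbar :: "qbar set \<Rightarrow> qbar" where "Gcd_qbar = Euclidean_Algorithm.Gcd"
definition Lcm_qbar :: "qbar set \<Rightarrow> qbar" where "Lcm_qbar = Euclidean_Algorithm.Lcm"
instance by standard (simp_all add: gcd_qbar_def lcm_qbar_def Gcd_qbar_def Lcm_qbar_def)
end

instance qbar :: field_gcd ..

lemma algebraic_exp_zeta8: "Polynomial.algebraic (exp (2 * of_real pi * \<i> / 8))"
proof (rule Polynomial.algebraicI)
  show "poly (Polynomial.monom 1 8 - 1 :: complex poly) (exp (2 * of_real pi * \<i> / 8)) = 0"
    using exp_two_pi_i by (simp add: poly_monom exp_of_nat_mult[symmetric] ac_simps)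
  show "Polynomial.coeff (Polynomial.monom 1 8 - 1 :: complex poly) i \<in> \<int>" for i by simp
  show "(Polynomial.monom 1 8 - 1 :: complex poly) \<noteq> 0"
  proof
    assume "(Polynomial.monom 1 8 - 1 :: complex poly) = 0"
    then have "poly (Polynomial.monom 1 8 - 1 :: complex poly) 0 = 0" by simp
    then show False by (simp add: poly_monom)
  qed
qed

lift_definition zeta8 :: qbar is "exp (2 * of_real pi * \<i> / 8)"
  by (rule algebraic_exp_zeta8)

section \<open>The Fermat quartic and its function field\<close>

text \<open>\<open>qbar[X, Y, Z]\<close> as iterated univariate polynomials; \<open>X\<close> is the innermost variable and
  \<open>Z\<close> the outermost one.\<close>

type_synonym poly3 = "qbar poly poly poly"

definition varX :: poly3 where "varX = [:[:[:0, 1:]:]:]"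
definition varY :: poly3 where "varY = [:[:0, 1:]:]"
definition varZ :: poly3 where "varZ = [:0, 1:]"

definition fermat_quartic :: poly3
  where "fermat_quartic = varX ^ 4 + varY ^ 4 + varZ ^ 4"

definition eval3 :: "poly3 \<Rightarrow> qbar \<times> qbar \<times> qbar \<Rightarrow> qbar"
  where "eval3 F = (\<lambda>(x, y, z). poly (poly (poly F [:[:z:]:]) [:y:]) x)"

definition homogeneous :: "nat \<Rightarrow> poly3 \<Rightarrow> bool"
  where "homogeneous d F \<longleftrightarrow>
    (\<forall>i j k. Polynomial.coeff (Polynomial.coeff (Polynomial.coeff F k) j) i \<noteq> 0 \<longrightarrow> i + j + k = d)"

lemma fermat_quartic_eq: "fermat_quartic = [:[:[:0, 1:]:] ^ 4 + [:0, 1:] ^ 4, 0, 0, 0, 1:]"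
proof -
  have "[:c:] ^ n = [:c ^ n:]" for c :: "qbar poly poly" and n
    by (induction n) (simp_all add: one_pCons)
  moreover have "[:0, 1::qbar poly poly:] ^ 4 = [:0, 0, 0, 0, 1:]"
    by (simp add: eval_nat_numeral)
  ultimately show ?thesis
    by (simp add: fermat_quartic_def varX_def varY_def varZ_def)
qed

lemma zeta8_pow4: "zeta8 ^ 4 = -1"
proof -
  have "of_qbar (x ^ n) = of_qbar x ^ n" for x n
    by (induction n) (simp_all add: one_qbar.rep_eq times_qbar.rep_eq)
  then have "of_qbar (zeta8 ^ 4) = exp (2 * of_real pi * \<i> / 8) ^ 4"
    by (simp add: zeta8.rep_eq)
  also have "\<dots> = exp (of_real pi * \<i>)"
    by (simp add: exp_of_nat_mult[symmetric])
  also have "\<dots> = of_qbar (-1)"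
    by (simp add: exp_pi_i uminus_qbar.rep_eq one_qbar.rep_eq)
  finally show ?thesis by (simp add: of_qbar_inject)
qed

text \<open>Eisenstein's criterion for \<open>Z ^ 4 + (X ^ 4 + Y ^ 4)\<close> at the prime \<open>Y - \<zeta> X\<close>.\<close>

lemma irreducible_fermat_quartic: "Factorial_Ring.irreducible fermat_quartic"
proof (rule Factorial_Ring.irreducibleI)
  define u :: "qbar poly poly" where "u = [:[:0, 1:]:] ^ 4 + [:0, 1:] ^ 4"
  define r :: "qbar poly" where "r = [:0, zeta8:]"
  have F: "fermat_quartic = [:u, 0, 0, 0, 1:]"
    by (simp add: fermat_quartic_eq u_def)
  have pw: "[:0, a:] ^ 4 = [:0,0,0,0,a^4:]" for a :: qbar
    by (simp add: eval_nat_numeral)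
  have ur: "poly u r = 0"
    by (simp add: u_def r_def pw zeta8_pow4)
  have dur: "poly (pderiv u) r \<noteq> 0"
  proof -
    have "[:0, 1::qbar:] ^ 4 = [:0,0,0,0,1:]" by (simp add: pw)
    then have "[:[:0, 1::qbar:]:] ^ 4 = [:[:0, 1::qbar:] ^ 4:]"
      by (simp add: eval_nat_numeral)
    then have "pderiv u = pderiv ([:0, 1:] ^ 4)"
      by (simp add: u_def pderiv_add pderiv_pCons)
    then have "poly (pderiv u) r = 4 * r ^ 3"
      by (simp add: eval_nat_numeral pderiv_pCons algebra_simps)
    moreover have "zeta8 \<noteq> 0" using zeta8_pow4 by auto
    ultimately show ?thesis by (simp add: r_def)
  qed
  show "fermat_quartic \<noteq> 0" by (simp add: F)
  show "\<not> fermat_quartic dvd 1"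
    by (simp add: F is_unit_poly_iff)
  fix A B assume AB: "fermat_quartic = A * B"
  have A0: "A \<noteq> 0" and B0: "B \<noteq> 0" using AB \<open>fermat_quartic \<noteq> 0\<close> by auto
  have deg: "Polynomial.degree A + Polynomial.degree B = 4"
    using A0 B0 by (simp flip: degree_mult_eq AB) (simp add: F)
  have lc: "Polynomial.lead_coeff A * Polynomial.lead_coeff B = 1"
    by (simp flip: lead_coeff_mult AB) (simp add: F)
  have c0: "Polynomial.coeff A 0 * Polynomial.coeff B 0 = u"
    by (simp flip: coeff_mult_0 AB) (simp add: F)
  have low: "poly (Polynomial.coeff (A * B) i) r = 0" if "i < 4" for i
    using that by (auto simp flip: AB simp: F ur less_Suc_eq numeral_eq_Suc coeff_pCons split: nat.splits)
  have unit: "P dvd 1"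
    if PQ: "A * B = P * Q" "Polynomial.lead_coeff P * Polynomial.lead_coeff Q = 1"
       "Polynomial.degree P + Polynomial.degree Q = 4"
       "poly (Polynomial.coeff Q 0) r = 0" "poly (Polynomial.coeff P 0) r \<noteq> 0" for P Q
  proof -
    have "poly (Polynomial.lead_coeff Q) r \<noteq> 0"
      using PQ(2) by (metis mult_zero_right poly_1 poly_mult zero_neq_one)
    define i where "i = (LEAST i. poly (Polynomial.coeff Q i) r \<noteq> 0)"
    have i: "poly (Polynomial.coeff Q i) r \<noteq> 0"
      unfolding i_def by (rule LeastI[of _ "Polynomial.degree Q"]) fact
    have least: "poly (Polynomial.coeff Q j) r = 0" if "j < i" for j
      using not_less_Least that unfolding i_def by blast
    have "poly (Polynomial.coeff (P * Q) i) r =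
        (\<Sum>j\<le>i. poly (Polynomial.coeff P j) r * poly (Polynomial.coeff Q (i - j)) r)"
      by (simp add: coeff_mult poly_sum)
    also have "\<dots> = (\<Sum>j\<in>{0}. poly (Polynomial.coeff P j) r * poly (Polynomial.coeff Q (i - j)) r)"
      by (rule sum.mono_neutral_right) (auto intro: least)
    finally have "poly (Polynomial.coeff (P * Q) i) r \<noteq> 0"
      using i PQ(5) by simp
    then have "i \<ge> 4" using low PQ(1) by (metis not_less)
    moreover have "i \<le> Polynomial.degree Q"
      unfolding i_def by (rule Least_le) fact
    ultimately have "Polynomial.degree P = 0" using PQ(3) by simp
    moreover have "Polynomial.lead_coeff P dvd 1" using PQ(2) by (metis dvd_triv_left)
    ultimately show "P dvd 1"
      by (metis degree_eq_zeroE is_unit_poly_iff coeff_pCons_0)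
  qed
  have "poly (Polynomial.coeff A 0) r * poly (Polynomial.coeff B 0) r = 0"
    using c0 ur by (metis poly_mult)
  moreover have "\<not> (poly (Polynomial.coeff A 0) r = 0 \<and> poly (Polynomial.coeff B 0) r = 0)"
  proof
    assume "poly (Polynomial.coeff A 0) r = 0 \<and> poly (Polynomial.coeff B 0) r = 0"
    then have "poly (pderiv (Polynomial.coeff A 0 * Polynomial.coeff B 0)) r = 0"
      by (simp add: pderiv_mult)
    then show False using dur c0 by simp
  qed
  ultimately consider "poly (Polynomial.coeff B 0) r = 0" "poly (Polynomial.coeff A 0) r \<noteq> 0"
    | "poly (Polynomial.coeff A 0) r = 0" "poly (Polynomial.coeff B 0) r \<noteq> 0"
    by auto
  then show "A dvd 1 \<or> B dvd 1"
  proof cases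
    case 1 then show ?thesis using unit[of A B] lc deg by simp
  next
    case 2 then show ?thesis using unit[of B A] lc deg by (simp add: mult.commute add.commute)
  qed
qed

lemma prime_elem_fermat_quartic: "prime_elem fermat_quartic"
  using irreducible_fermat_quartic by (simp add: prime_elem_iff_irreducible)

lemma homogeneous_0: "homogeneous d 0"
  and homogeneous_1: "homogeneous 0 1"
  and homogeneous_uminus: "homogeneous d F \<Longrightarrow> homogeneous d (- F)"
  and homogeneous_add: "homogeneous d F \<Longrightarrow> homogeneous d G \<Longrightarrow> homogeneous d (F + G)"
  by (auto simp: homogeneous_def coeff_1 split: if_splits) force

lemma homogeneous_mult:
  assumes "homogeneous d F" "homogeneous e G" shows "homogeneous (d + e) (F * G)"
  unfolding homogeneous_def
proof (intro allI impI)
  fix i j k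
  assume "Polynomial.coeff (Polynomial.coeff (Polynomial.coeff (F * G) k) j) i \<noteq> 0"
  then have "(\<Sum>c\<le>k. \<Sum>b\<le>j. \<Sum>a\<le>i. Polynomial.coeff (Polynomial.coeff (Polynomial.coeff F c) b) a *
      Polynomial.coeff (Polynomial.coeff (Polynomial.coeff G (k - c)) (j - b)) (i - a)) \<noteq> 0"
    by (simp add: coeff_mult coeff_sum)
  then obtain c b a where "c \<le> k" "b \<le> j" "a \<le> i"
    "Polynomial.coeff (Polynomial.coeff (Polynomial.coeff F c) b) a \<noteq> 0"
    "Polynomial.coeff (Polynomial.coeff (Polynomial.coeff G (k - c)) (j - b)) (i - a) \<noteq> 0"
    by (metis (no_types, lifting) atMost_iff mult_zero_left mult_zero_right sum.not_neutral_contains_not_neutral)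
  moreover from this(4,5) have "a + b + c = d" "(i - a) + (j - b) + (k - c) = e"
    using assms unfolding homogeneous_def by blast+
  ultimately show "i + j + k = d + e" by linarith
qed

text \<open>The function field of the projective curve over \<open>qbar\<close>: fractions \<open>F / G\<close> of forms of the same
  degree with \<open>G\<close> not in the ideal \<open>(X ^ 4 + Y ^ 4 + Z ^ 4)\<close>, taken modulo that ideal.\<close>

definition form_pair :: "poly3 \<times> poly3 \<Rightarrow> bool"
  where "form_pair = (\<lambda>(F, G). (\<exists>d. homogeneous d F \<and> homogeneous d G) \<and> \<not> fermat_quartic dvd G)"

definition ratfun_rel :: "poly3 \<times> poly3 \<Rightarrow> poly3 \<times> poly3 \<Rightarrow> bool"
  where "ratfun_rel p q \<longleftrightarrow> form_pair p \<and> form_pair q \<and>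
    fermat_quartic dvd fst p * snd q - fst q * snd p"

lemma fermat_quartic_dvd_mult:
  "fermat_quartic dvd F * G \<longleftrightarrow> fermat_quartic dvd F \<or> fermat_quartic dvd G"
  using prime_elem_fermat_quartic by (rule prime_elem_dvd_mult_iff)

lemma not_fermat_quartic_dvd_1: "\<not> fermat_quartic dvd 1"
  using prime_elem_fermat_quartic by (rule prime_elem_not_unit)

lemma ratfun_rel_trans:
  assumes "ratfun_rel p q" "ratfun_rel q r" shows "ratfun_rel p r"
proof -
  have "fermat_quartic dvd (fst p * snd q - fst q * snd p) * snd r + (fst q * snd r - fst r * snd q) * snd p"
    using assms by (intro dvd_add dvd_mult2) (auto simp: ratfun_rel_def)
  also have "\<dots> = (fst p * snd r - fst r * snd p) * snd q" by (simp add: algebra_simps)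
  finally show ?thesis
    using assms by (auto simp: ratfun_rel_def form_pair_def fermat_quartic_dvd_mult)
qed

quotient_type ratfun = "poly3 \<times> poly3" / partial: ratfun_rel
proof (rule part_equivpI)
  show "\<exists>x. ratfun_rel x x"
    by (rule exI[of _ "(0, 1)"])
      (auto simp: ratfun_rel_def form_pair_def not_fermat_quartic_dvd_1
        intro!: exI[of _ 0] homogeneous_0 homogeneous_1)
  show "symp ratfun_rel"
    by (rule sympI) (metis (no_types, lifting) dvd_minus_iff minus_diff_eq ratfun_rel_def)
  show "transp ratfun_rel"
    by (rule transpI) (rule ratfun_rel_trans)
qed

lemma form_pair_mult:
  "form_pair p \<Longrightarrow> form_pair q \<Longrightarrow> form_pair (fst p * fst q, snd p * snd q)"
  by (auto simp: form_pair_def fermat_quartic_dvd_mult) (metis homogeneous_mult)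

lemma form_pair_add:
  "form_pair p \<Longrightarrow> form_pair q \<Longrightarrow> form_pair (fst p * snd q + fst q * snd p, snd p * snd q)"
proof -
  assume a: "form_pair p" "form_pair q"
  then obtain d e where h: "homogeneous d (fst p)" "homogeneous d (snd p)"
      "homogeneous e (fst q)" "homogeneous e (snd q)"
    by (auto simp: form_pair_def)
  then have "homogeneous (d + e) (fst p * snd q)" "homogeneous (d + e) (fst q * snd p)"
      "homogeneous (d + e) (snd p * snd q)"
    by (metis homogeneous_mult add.commute)+
  then show ?thesis
    using a by (auto simp: form_pair_def fermat_quartic_dvd_mult intro: homogeneous_add)
qed

lemma form_pair_minus: "form_pair p \<Longrightarrow> form_pair (- fst p, snd p)"
  by (auto simp: form_pair_def) (metis homogeneous_uminus)

lemma form_pair_inverse: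
  "form_pair p \<Longrightarrow> form_pair (if fermat_quartic dvd fst p then (0, 1) else (snd p, fst p))"
  by (auto simp: form_pair_def not_fermat_quartic_dvd_1) (metis homogeneous_0 homogeneous_1)

lemma form_pair_0: "form_pair (0, 1)" and form_pair_1: "form_pair (1, 1)"
  using homogeneous_0 homogeneous_1 by (auto simp: form_pair_def not_fermat_quartic_dvd_1)

lemma ratfun_relI:
  "form_pair p \<Longrightarrow> form_pair q \<Longrightarrow> fst p * snd q = fst q * snd p \<Longrightarrow> ratfun_rel p q"
  by (simp add: ratfun_rel_def)

instantiation ratfun :: Fields.field
begin

lift_definition zero_ratfun :: ratfun is "(0, 1)"
  by (simp add: ratfun_relI form_pair_0)

lift_definition one_ratfun :: ratfun is "(1, 1)"
  by (simp add: ratfun_relI form_pair_1)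

lift_definition plus_ratfun :: "ratfun \<Rightarrow> ratfun \<Rightarrow> ratfun"
  is "\<lambda>p q. (fst p * snd q + fst q * snd p, snd p * snd q)"
proof -
  fix p p' q q' assume a: "ratfun_rel p p'" "ratfun_rel q q'"
  have "fermat_quartic dvd (fst p * snd p' - fst p' * snd p) * (snd q * snd q') +
      (fst q * snd q' - fst q' * snd q) * (snd p * snd p')"
    using a by (intro dvd_add dvd_mult2) (auto simp: ratfun_rel_def)
  then show "ratfun_rel (fst p * snd q + fst q * snd p, snd p * snd q)
      (fst p' * snd q' + fst q' * snd p', snd p' * snd q')"
    using a by (auto simp: ratfun_rel_def form_pair_add algebra_simps)
qed

lift_definition times_ratfun :: "ratfun \<Rightarrow> ratfun \<Rightarrow> ratfun"
  is "\<lambda>p q. (fst p * fst q, snd p * snd q)"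
proof -
  fix p p' q q' assume a: "ratfun_rel p p'" "ratfun_rel q q'"
  have "fermat_quartic dvd (fst p * snd p' - fst p' * snd p) * (fst q * snd q') +
      (fst q * snd q' - fst q' * snd q) * (fst p' * snd p)"
    using a by (intro dvd_add dvd_mult2) (auto simp: ratfun_rel_def)
  then show "ratfun_rel (fst p * fst q, snd p * snd q) (fst p' * fst q', snd p' * snd q')"
    using a by (auto simp: ratfun_rel_def form_pair_mult algebra_simps)
qed

lift_definition uminus_ratfun :: "ratfun \<Rightarrow> ratfun" is "\<lambda>p. (- fst p, snd p)"
proof -
  fix p q assume a: "ratfun_rel p q"
  then have "fermat_quartic dvd - (fst p * snd q - fst q * snd p)"
    by (simp only: dvd_minus_iff ratfun_rel_def)
  then show "ratfun_rel (- fst p, snd p) (- fst q, snd q)"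
    using a by (simp add: ratfun_rel_def form_pair_minus algebra_simps)
qed

definition minus_ratfun :: "ratfun \<Rightarrow> ratfun \<Rightarrow> ratfun"
  where "minus_ratfun f g = f + - g"

lift_definition inverse_ratfun :: "ratfun \<Rightarrow> ratfun"
  is "\<lambda>p. if fermat_quartic dvd fst p then (0, 1) else (snd p, fst p)"
proof -
  fix p q assume a: "ratfun_rel p q"
  then have d: "fermat_quartic dvd fst p * snd q - fst q * snd p"
    and n: "\<not> fermat_quartic dvd snd p" "\<not> fermat_quartic dvd snd q"
    by (auto simp: ratfun_rel_def form_pair_def)
  have "fermat_quartic dvd fst p * snd q \<longleftrightarrow> fermat_quartic dvd fst q * snd p"
    using d by (metis dvd_add_right_iff diff_add_cancel)
  then have "fermat_quartic dvd fst p \<longleftrightarrow> fermat_quartic dvd fst q"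
    using n by (simp add: fermat_quartic_dvd_mult)
  moreover have "fermat_quartic dvd snd p * fst q - snd q * fst p"
    using d by (metis dvd_minus_iff minus_diff_eq mult.commute)
  ultimately show "ratfun_rel (if fermat_quartic dvd fst p then (0, 1) else (snd p, fst p))
      (if fermat_quartic dvd fst q then (0, 1) else (snd q, fst q))"
    using a form_pair_inverse[of p] form_pair_inverse[of q]
    by (auto simp: ratfun_rel_def)
qed

definition divide_ratfun :: "ratfun \<Rightarrow> ratfun \<Rightarrow> ratfun"
  where "divide_ratfun f g = f * inverse g"

instance
proof
  fix a b c :: ratfun
  show "a + b + c = a + (b + c)" "a + b = b + a" "0 + a = a"
    "a * b * c = a * (b * c)" "a * b = b * a" "1 * a = a" "(a + b) * c = a * c + b * c"
    by (transfer, intro ratfun_relI form_pair_add form_pair_mult form_pair_0 form_pair_1;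
        simp add: ratfun_rel_def; simp add: algebra_simps)+
  show "- a + a = 0"
    by (transfer, intro ratfun_relI form_pair_add form_pair_minus form_pair_0;
        simp add: ratfun_rel_def)
  show "a - b = a + - b" by (simp add: minus_ratfun_def)
  show "(0::ratfun) \<noteq> 1"
    by transfer (simp add: ratfun_rel_def not_fermat_quartic_dvd_1)
  show "inverse a * a = 1" if "a \<noteq> 0"
    using that
  proof transfer
    fix p assume p: "ratfun_rel p p" "\<not> ratfun_rel p (0, 1)"
    then have fp: "form_pair p" by (simp add: ratfun_rel_def)
    then have n: "\<not> fermat_quartic dvd fst p"
      using p(2) form_pair_0 by (auto simp: ratfun_rel_def)
    have "form_pair (snd p, fst p)" using form_pair_inverse[OF fp] n by simp
    from form_pair_mult[OF this fp] show "ratfun_rel (fst (if fermat_quartic dvd fst p then (0, 1) else (snd p, fst p)) * fst p,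
        snd (if fermat_quartic dvd fst p then (0, 1) else (snd p, fst p)) * snd p) (1, 1)"
      using n by (intro ratfun_relI form_pair_1) (simp_all add: mult.commute)
  qed
  show "a div b = a * inverse b" by (simp add: divide_ratfun_def)
  show "inverse (0::ratfun) = 0"
    by transfer (simp add: ratfun_relI form_pair_0)
qed

end

section \<open>Galois groups and their action on functions\<close>

definition is_subfield :: "qbar set \<Rightarrow> bool"
  where "is_subfield K \<longleftrightarrow> 0 \<in> K \<and> 1 \<in> K \<and> (\<forall>x\<in>K. \<forall>y\<in>K. x + y \<in> K \<and> x * y \<in> K) \<and>
    (\<forall>x\<in>K. - x \<in> K \<and> inverse x \<in> K)"

definition Q_zeta8 :: "qbar set"
  where "Q_zeta8 = is_subfield hull {zeta8}"

text \<open>\<open>gal L K\<close> is the group of automorphisms of the field \<open>L\<close> that fix \<open>K\<close> pointwise; values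
  outside \<open>L\<close> are \<open>undefined\<close>.\<close>

definition gal :: "qbar set \<Rightarrow> qbar set \<Rightarrow> (qbar \<Rightarrow> qbar) set"
  where "gal L K = {\<sigma> \<in> extensional L. bij_betw \<sigma> L L \<and> (\<forall>x\<in>K. \<sigma> x = x) \<and>
    (\<forall>x\<in>L. \<forall>y\<in>L. \<sigma> (x + y) = \<sigma> x + \<sigma> y \<and> \<sigma> (x * y) = \<sigma> x * \<sigma> y)}"

abbreviation G_Q :: "(qbar \<Rightarrow> qbar) set"
  where "G_Q \<equiv> gal UNIV \<rat>"

text \<open>The Krull topology is the topology of pointwise convergence for the discrete topology on
  \<open>qbar\<close>.\<close>

definition krull :: "(qbar \<Rightarrow> qbar) topology"
  where "krull = subtopology (product_topology (\<lambda>_. discrete_topology UNIV) UNIV) G_Q"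

definition const_fun :: "qbar \<Rightarrow> ratfun"
  where "const_fun c = abs_ratfun ([:[:[:c:]:]:], 1)"

definition map_poly3 :: "(qbar \<Rightarrow> qbar) \<Rightarrow> poly3 \<Rightarrow> poly3"
  where "map_poly3 \<sigma> = map_poly (map_poly (map_poly \<sigma>))"

lemma gal_hom:
  assumes "\<sigma> \<in> gal UNIV K"
  shows "\<sigma> (x + y) = \<sigma> x + \<sigma> y" "\<sigma> (x * y) = \<sigma> x * \<sigma> y" "\<sigma> 0 = 0" "\<sigma> 1 = 1" "\<sigma> (- x) = - \<sigma> x"
    "bij \<sigma>"
proof -
  show a: "\<sigma> (x + y) = \<sigma> x + \<sigma> y" "\<sigma> (x * y) = \<sigma> x * \<sigma> y" for x y
    using assms by (auto simp: gal_def)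
  show b: "bij \<sigma>" using assms by (auto simp: gal_def)
  show z: "\<sigma> 0 = 0" using a(1)[of 0 0] by simp
  have "\<sigma> 1 \<noteq> 0" using b z by (metis bij_is_inj injD zero_neq_one)
  then show "\<sigma> 1 = 1" using a(2)[of 1 1] by simp
  show "\<sigma> (- x) = - \<sigma> x" using a(1)[of x "-x"] z by (simp add: eq_neg_iff_add_eq_0 add.commute)
qed

lemma gal_inv:
  assumes "\<sigma> \<in> gal UNIV K" shows "inv_into UNIV \<sigma> \<in> gal UNIV K"
proof -
  have b: "bij \<sigma>" by (rule gal_hom(6)[OF assms])
  have "inv_into UNIV \<sigma> (x + y) = inv_into UNIV \<sigma> x + inv_into UNIV \<sigma> y" "inv_into UNIV \<sigma> (x * y) = inv_into UNIV \<sigma> x * inv_into UNIV \<sigma> y" for x y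
    using gal_hom(1,2)[OF assms, of "inv_into UNIV \<sigma> x" "inv_into UNIV \<sigma> y"] b
    by (metis bij_inv_eq_iff)+
  moreover have "inv_into UNIV \<sigma> x = x" if "x \<in> K" for x
  proof -
    have "\<sigma> x = x" using assms that by (simp add: gal_def)
    then show ?thesis using b by (metis bij_is_inj inv_f_f)
  qed
  ultimately show ?thesis using bij_imp_bij_inv[OF b] by (auto simp: gal_def)
qed

lemma map_poly_hom:
  fixes f :: "'a::comm_ring_1 \<Rightarrow> 'b::comm_ring_1"
  assumes "\<And>x y. f (x + y) = f x + f y" "\<And>x y. f (x * y) = f x * f y" "f 0 = 0" "f 1 = 1"
  shows "map_poly f (p + q) = map_poly f p + map_poly f q"
    "map_poly f (p * q) = map_poly f p * map_poly f q"
    "map_poly f 0 = 0" "map_poly f 1 = 1"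
proof -
  have s: "f (sum g A) = (\<Sum>x\<in>A. f (g x))" for g :: "nat \<Rightarrow> 'a" and A
    by (induction A rule: infinite_finite_induct) (simp_all add: assms)
  show "map_poly f (p + q) = map_poly f p + map_poly f q"
    by (rule poly_eqI) (simp add: coeff_map_poly assms)
  show "map_poly f (p * q) = map_poly f p * map_poly f q"
    by (rule poly_eqI) (simp add: coeff_map_poly coeff_mult assms s)
  show "map_poly f 0 = 0" "map_poly f 1 = 1" by (simp_all add: assms)
qed

lemma map_poly3_hom:
  assumes "\<sigma> \<in> gal UNIV K"
  shows "map_poly3 \<sigma> (p + q) = map_poly3 \<sigma> p + map_poly3 \<sigma> q"
    "map_poly3 \<sigma> (p * q) = map_poly3 \<sigma> p * map_poly3 \<sigma> q"
    "map_poly3 \<sigma> 0 = 0" "map_poly3 \<sigma> 1 = 1"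
  unfolding map_poly3_def by (intro map_poly_hom gal_hom[OF assms])+

lemma coeff_map_poly3:
  assumes "\<sigma> \<in> gal UNIV K"
  shows "Polynomial.coeff (Polynomial.coeff (Polynomial.coeff (map_poly3 \<sigma> F) k) j) i =
    \<sigma> (Polynomial.coeff (Polynomial.coeff (Polynomial.coeff F k) j) i)"
  using gal_hom(3)[OF assms] by (simp add: map_poly3_def coeff_map_poly)

lemma homogeneous_map_poly3:
  assumes "\<sigma> \<in> gal UNIV K" shows "homogeneous d F \<Longrightarrow> homogeneous d (map_poly3 \<sigma> F)"
  unfolding homogeneous_def coeff_map_poly3[OF assms] by (metis gal_hom(3)[OF assms])

lemma map_poly3_fermat_quartic:
  assumes "\<sigma> \<in> gal UNIV K" shows "map_poly3 \<sigma> fermat_quartic = fermat_quartic"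
proof -
  have "map_poly3 \<sigma> (p ^ n) = map_poly3 \<sigma> p ^ n" for p n
    by (induction n) (simp_all add: map_poly3_hom[OF assms])
  moreover have "map_poly3 \<sigma> varX = varX" "map_poly3 \<sigma> varY = varY" "map_poly3 \<sigma> varZ = varZ"
    using gal_hom(3,4)[OF assms]
    by (simp_all add: map_poly3_def varX_def varY_def varZ_def map_poly_pCons)
  ultimately show ?thesis
    by (simp add: fermat_quartic_def map_poly3_hom[OF assms])
qed

lemma map_poly3_diff:
  assumes "\<sigma> \<in> gal UNIV K"
  shows "map_poly3 \<sigma> (p - q) = map_poly3 \<sigma> p - map_poly3 \<sigma> q"
  using map_poly3_hom(1)[OF assms, of "p - q" q] by (simp add: algebra_simps)

lemma map_poly3_dvd:
  assumes "\<sigma> \<in> gal UNIV K" "fermat_quartic dvd F" shows "fermat_quartic dvd map_poly3 \<sigma> F"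
  using assms(2) map_poly3_hom(2)[OF assms(1)] map_poly3_fermat_quartic[OF assms(1)]
  by (metis dvdE dvd_triv_left)

lemma map_poly3_inv:
  assumes "\<sigma> \<in> gal UNIV K" shows "map_poly3 (inv_into UNIV \<sigma>) (map_poly3 \<sigma> F) = F"
  using gal_hom(6)[OF assms]
  by (intro poly_eqI)
    (simp add: coeff_map_poly3[OF assms] coeff_map_poly3[OF gal_inv[OF assms]] bij_is_inj inv_f_f)

lemma ratfun_rel_map_poly3:
  assumes "\<sigma> \<in> gal UNIV K" "ratfun_rel p q"
  shows "ratfun_rel (map_prod (map_poly3 \<sigma>) (map_poly3 \<sigma>) p) (map_prod (map_poly3 \<sigma>) (map_poly3 \<sigma>) q)"
proof -
  have "\<not> fermat_quartic dvd map_poly3 \<sigma> F" if "\<not> fermat_quartic dvd F" for F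
    using that map_poly3_dvd[OF gal_inv[OF assms(1)]] map_poly3_inv[OF assms(1)] by metis
  then have "form_pair (map_prod (map_poly3 \<sigma>) (map_poly3 \<sigma>) r)" if "form_pair r" for r
    using that homogeneous_map_poly3[OF assms(1)] by (auto simp: form_pair_def) blast
  moreover have "fermat_quartic dvd map_poly3 \<sigma> (fst p * snd q - fst q * snd p)"
    using assms by (auto simp: ratfun_rel_def intro: map_poly3_dvd)
  ultimately show ?thesis
    using assms(2) by (simp add: ratfun_rel_def map_poly3_diff[OF assms(1)] map_poly3_hom[OF assms(1)])
qed

lift_definition gal_fun :: "(qbar \<Rightarrow> qbar) \<Rightarrow> ratfun \<Rightarrow> ratfun"
  is "\<lambda>\<sigma> p. if \<sigma> \<in> G_Q then map_prod (map_poly3 \<sigma>) (map_poly3 \<sigma>) p else p"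
  by (auto intro: ratfun_rel_map_poly3)

section \<open>Divisors on the curve over the algebraic closure\<close>

text \<open>A point of the projective plane is the set of its homogeneous coordinate vectors.\<close>

type_synonym point = "(qbar \<times> qbar \<times> qbar) set"

definition hpt :: "qbar \<Rightarrow> qbar \<Rightarrow> qbar \<Rightarrow> point"
  where "hpt x y z = {(c * x, c * y, c * z) | c. c \<noteq> 0}"

definition C4 :: "point set"
  where "C4 = {hpt x y z | x y z. (x, y, z) \<noteq> (0, 0, 0) \<and> x ^ 4 + y ^ 4 + z ^ 4 = 0}"

definition local_ring :: "point \<Rightarrow> ratfun set"
  where "local_ring P = {abs_ratfun (F, G) | F G. form_pair (F, G) \<and> (\<forall>v\<in>P. eval3 G v \<noteq> 0)}"

definition max_ideal :: "point \<Rightarrow> ratfun set"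
  where "max_ideal P = {abs_ratfun (F, G) | F G. form_pair (F, G) \<and>
    (\<forall>v\<in>P. eval3 G v \<noteq> 0 \<and> eval3 F v = 0)}"

definition uniformizer :: "point \<Rightarrow> ratfun \<Rightarrow> bool"
  where "uniformizer P t \<longleftrightarrow> t \<noteq> 0 \<and> max_ideal P = (\<lambda>g. t * g) ` local_ring P"

text \<open>The curve is smooth, so each \<open>local_ring P\<close> is a discrete valuation ring and every
  \<open>f \<noteq> 0\<close> is a unit times a unique power of a generator of the maximal ideal.  The
  value at \<open>f = 0\<close> is junk.\<close>

definition ord_at :: "point \<Rightarrow> ratfun \<Rightarrow> int"
  where "ord_at P f = (THE n. \<exists>t u. uniformizer P t \<and> u \<in> local_ring P - max_ideal P \<and> f = u * t powi n)"

type_synonym divisor = "point \<Rightarrow> int"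

definition Div :: "divisor set"
  where "Div = {D. finite {P. D P \<noteq> 0} \<and> {P. D P \<noteq> 0} \<subseteq> C4}"

definition div_degree :: "divisor \<Rightarrow> int"
  where "div_degree D = (\<Sum>P | D P \<noteq> 0. D P)"

definition div_of :: "ratfun \<Rightarrow> divisor"
  where "div_of f = (\<lambda>P. if P \<in> C4 then ord_at P f else 0)"

definition lin_equiv :: "divisor \<Rightarrow> divisor \<Rightarrow> bool"
  where "lin_equiv D D' \<longleftrightarrow> (\<exists>f. f \<noteq> 0 \<and> (\<forall>P. D P - D' P = div_of f P))"

definition div_class :: "divisor \<Rightarrow> divisor set"
  where "div_class D = {D' \<in> Div. lin_equiv D' D}"

text \<open>The coordinatewise action of an automorphism of \<open>L\<close> on the points that have a coordinate
  vector in \<open>L\<close>, and the induced action on divisors supported in such points.  For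
  \<open>L = UNIV\<close> this is the action of the Galois group on all divisors.\<close>

definition gal_pt :: "qbar set \<Rightarrow> (qbar \<Rightarrow> qbar) \<Rightarrow> point \<Rightarrow> point"
  where "gal_pt L \<sigma> P = {(c * \<sigma> x, c * \<sigma> y, c * \<sigma> z) | c x y z.
    c \<noteq> 0 \<and> (x, y, z) \<in> P \<and> x \<in> L \<and> y \<in> L \<and> z \<in> L}"

definition gal_div :: "qbar set \<Rightarrow> (qbar \<Rightarrow> qbar) \<Rightarrow> divisor \<Rightarrow> divisor"
  where "gal_div L \<sigma> D = (\<lambda>Q. \<Sum>P | D P \<noteq> 0 \<and> gal_pt L \<sigma> P = Q. D P)"

text \<open>A divisor is defined over \<open>L\<close> if it is invariant under the absolute Galois group of \<open>L\<close>.\<close>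

definition Div_over :: "qbar set \<Rightarrow> divisor set"
  where "Div_over L = {D \<in> Div. \<forall>\<sigma>\<in>gal UNIV L. gal_div UNIV \<sigma> D = D}"

text \<open>The \<open>L\<close>-rational points of the Jacobian, \<open>L\<close> perfect: the classes of degree zero over
  \<open>qbar\<close> that are invariant under the absolute Galois group of \<open>L\<close>.  The class itself is
  invariant; it need not contain an invariant divisor.\<close>

definition Jac :: "qbar set \<Rightarrow> divisor set set"
  where "Jac L = {\<xi>. (\<exists>D\<in>Div. div_degree D = 0 \<and> \<xi> = div_class D) \<and>
    (\<forall>\<sigma>\<in>gal UNIV L. gal_div UNIV \<sigma> ` \<xi> = \<xi>)}"

definition divisor_E :: divisor
  where "divisor_E = (\<lambda>P. 2 * of_bool (P = hpt 1 0 (zeta8 ^ 3)) - 2 * of_bool (P = hpt 1 0 (zeta8 ^ 7)))"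

section \<open>Continuous cohomology of the absolute Galois group and Brauer groups\<close>

text \<open>Modules are discrete abelian groups \<open>M\<close> (as HOL-Algebra records) with an action \<open>act\<close>.\<close>

type_synonym 'm cochain2 = "(qbar \<Rightarrow> qbar) \<times> (qbar \<Rightarrow> qbar) \<Rightarrow> 'm"

definition cochains1 :: "'m monoid \<Rightarrow> ((qbar \<Rightarrow> qbar) \<Rightarrow> 'm) set"
  where "cochains1 M = {b \<in> G_Q \<rightarrow>\<^sub>E carrier M. continuous_map krull (discrete_topology (carrier M)) b}"

definition cochains2 :: "'m monoid \<Rightarrow> 'm cochain2 set"
  where "cochains2 M = {c \<in> G_Q \<times> G_Q \<rightarrow>\<^sub>E carrier M.
    continuous_map (prod_topology krull krull) (discrete_topology (carrier M)) c}"

definition coboundary :: "'m monoid \<Rightarrow> ((qbar \<Rightarrow> qbar) \<Rightarrow> 'm \<Rightarrow> 'm) \<Rightarrow> ((qbar \<Rightarrow> qbar) \<Rightarrow> 'm) \<Rightarrow> 'm cochain2"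
  where "coboundary M act b = (\<lambda>(\<sigma>, \<tau>)\<in>G_Q \<times> G_Q.
    act \<sigma> (b \<tau>) \<otimes>\<^bsub>M\<^esub> (inv\<^bsub>M\<^esub> (b (\<sigma> \<circ> \<tau>))) \<otimes>\<^bsub>M\<^esub> b \<sigma>)"

definition cocycles2 :: "'m monoid \<Rightarrow> ((qbar \<Rightarrow> qbar) \<Rightarrow> 'm \<Rightarrow> 'm) \<Rightarrow> 'm cochain2 set"
  where "cocycles2 M act = {c \<in> cochains2 M. \<forall>\<sigma>\<in>G_Q. \<forall>\<tau>\<in>G_Q. \<forall>\<rho>\<in>G_Q.
    act \<sigma> (c (\<tau>, \<rho>)) \<otimes>\<^bsub>M\<^esub> c (\<sigma>, \<tau> \<circ> \<rho>) = c (\<sigma> \<circ> \<tau>, \<rho>) \<otimes>\<^bsub>M\<^esub> c (\<sigma>, \<tau>)}"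

definition coboundaries2 :: "'m monoid \<Rightarrow> ((qbar \<Rightarrow> qbar) \<Rightarrow> 'm \<Rightarrow> 'm) \<Rightarrow> 'm cochain2 set" where
  "coboundaries2 M act = coboundary M act ` cochains1 M"

abbreviation cochain_group :: "'m monoid \<Rightarrow> 'm cochain2 monoid"
  where "cochain_group M \<equiv> product_group (G_Q \<times> G_Q) (\<lambda>_. M)"

definition H2 :: "'m monoid \<Rightarrow> ((qbar \<Rightarrow> qbar) \<Rightarrow> 'm \<Rightarrow> 'm) \<Rightarrow> 'm cochain2 set monoid" where
  "H2 M act = (cochain_group M)\<lparr>carrier := cocycles2 M act\<rparr> Mod coboundaries2 M act"

text \<open>The map induced on \<open>H2\<close> by an equivariant homomorphism \<open>f\<close> into \<open>N\<close>, as a union of equal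
  cosets.\<close>

definition H2_map :: "('m \<Rightarrow> 'n) \<Rightarrow> 'n monoid \<Rightarrow> ((qbar \<Rightarrow> qbar) \<Rightarrow> 'n \<Rightarrow> 'n) \<Rightarrow> 'm cochain2 set \<Rightarrow> 'n cochain2 set" where
  "H2_map f N act \<kappa> = (\<Union>c\<in>\<kappa>. coboundaries2 N act #>\<^bsub>cochain_group N\<^esub> (\<lambda>p\<in>G_Q \<times> G_Q. f (c p)))"

definition mult_group :: "'a::Fields.field monoid"
  where "mult_group = \<lparr>carrier = UNIV - {0}, monoid.mult = (*), one = 1\<rparr>"

definition Div_group :: "divisor monoid"
  where "Div_group = \<lparr>carrier = Div, monoid.mult = (\<lambda>D D' P. D P + D' P), one = (\<lambda>_. 0)\<rparr>"

definition Br_Q :: "qbar cochain2 set monoid" where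
  "Br_Q = H2 mult_group (\<lambda>\<sigma>. \<sigma>)"

text \<open>With \<open>K\<close> the function field over \<open>qbar\<close>, \<open>Br(C4) = Ker(H2(G_Q, K*) \<rightarrow> H2(G_Q, Div))\<close>.
  This is the etale cohomology group \<open>H2(C4, G_m)\<close> computed from the divisor sequence \<open>0 \<rightarrow> G_m \<rightarrow> j_* G_m \<rightarrow> Div \<rightarrow> 0\<close> on the
  regular curve, Tsen's theorem and Shapiro's lemma (cf. Lichtenbaum, Duality theorems for curves
  over p-adic fields).\<close>

definition Br_C4 :: "ratfun cochain2 set monoid" where
  "Br_C4 = (let H = H2 mult_group gal_fun in
     H\<lparr>carrier := kernel H (H2 Div_group (gal_div UNIV)) (H2_map div_of Div_group (gal_div UNIV))\<rparr>)"

definition Br_rel :: "qbar cochain2 set monoid" where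
  "Br_rel = Br_Q\<lparr>carrier := kernel Br_Q Br_C4 (H2_map const_fun mult_group gal_fun)\<rparr>"

text \<open>The map from the invariant classes to \<open>Br(\<rat>)\<close> in the low-degree exact sequence, as the
  composite of the connecting maps of
  \<open>0 \<rightarrow> Princ \<rightarrow> Div \<rightarrow> Pic \<rightarrow> 0\<close> and \<open>0 \<rightarrow> qbar* \<rightarrow> K* \<rightarrow> Princ \<rightarrow> 0\<close>:
  if \<open>\<sigma> D - D = div (f \<sigma>)\<close>, the class of \<open>D\<close> goes to the class of the
  coboundary of \<open>f\<close>.  The set of all cocycles arising in this way, for all choices of \<open>D\<close> and
  \<open>f\<close>, is a full coset of the coboundaries, hence an element of \<open>Br_Q\<close>.\<close>

definition Br_map :: "divisor set \<Rightarrow> qbar cochain2 set" where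
  "Br_map \<xi> = {c \<in> cocycles2 mult_group (\<lambda>\<sigma>. \<sigma>).
    \<exists>D\<in>\<xi>. \<exists>f\<in>cochains1 mult_group.
      (\<forall>\<sigma>\<in>G_Q. \<forall>P. div_of (f \<sigma>) P = gal_div UNIV \<sigma> D P - D P) \<and>
      (\<forall>p\<in>G_Q \<times> G_Q. const_fun (c p) = coboundary mult_group gal_fun f p)}"

end

theory Submission
  imports Defs
begin

text \<open>
  The tangent line \<open>Z = \<eta> X\<close> at \<open>P\<^sub>\<eta> = [1:0:\<eta>]\<close>, where \<open>\<eta>\<^sup>4 = -1\<close>, meets the curve in
  \<open>4 P\<^sub>\<eta>\<close>, and the line \<open>Y = 0\<close> meets it in the sum of the four points \<open>P\<^sub>\<eta>\<close>.  Hence \<open>\<sigma> E - E\<close> is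
  the divisor of an explicit function \<open>f\<^sub>\<sigma>\<close> which depends only on \<open>\<sigma>(\<zeta>\<^sub>8)\<close>, so the class of \<open>E\<close> is
  invariant.  Functions without zeros and poles are constant, so the coboundary \<open>c\<close> of \<open>f\<close> takes
  constant values, and its class is the image of \<open>[E]\<close> in the Brauer group.  At complex conjugation
  \<open>\<kappa>\<close> one finds \<open>c(\<kappa>, \<kappa>) = -1\<close> and \<open>c(1, 1) = 1\<close>.  If \<open>c\<close> were the coboundary of \<open>b\<close>, then \<open>b(1) = 1\<close>
  and \<open>-1 = \<kappa>(b(\<kappa>)) b(\<kappa>)\<close>, the square of an absolute value.
\<close>

section \<open>Algebraic closedness of \<open>qbar\<close>\<close>

text \<open>The sign \<open>-1\<close> has one source: the forms of the four tangent lines multiply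
  to \<open>Z ^ 4 + X ^ 4\<close>, which is \<open>- Y ^ 4\<close> on the curve. Complex conjugation
  exchanges these lines in pairs, and on the group of order 2 that it generates the question is
  whether \<open>-1\<close> is a norm from the complex to the real numbers. The coefficient 2 in
  \<open>E\<close> is what makes two tangent sections balance against twice the section
  \<open>Y = 0\<close>.

  A rational divisor in the class of \<open>E\<close> would admit the cochain \<open>1\<close>, so
  both parts of the second claim rest on one cocycle not being a coboundary.

  Most of the work lies below this. \<open>ord_at\<close> is a definite description, which says
  nothing until the local rings are known to be discrete valuation rings, and the constancy of
  functions without poles has to be proved for this curve. Both are explicit algebra in the charts
  \<open>Y \<noteq> 0\<close> and \<open>X \<noteq> 0\<close>. These cover the curve, as
  \<open>X = Y = 0\<close> forces \<open>Z = 0\<close>; and as the quartic is monic in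
  \<open>Z\<close>, every function is a polynomial of degree at most 3 in the second coordinate with
  coefficients rational in the first.\<close>

lemma algebraic_root_of_algebraic_poly:
  fixes p :: "complex poly"
  assumes "p \<noteq> 0" "\<And>i. Polynomial.algebraic (Polynomial.coeff p i)" "poly p z = 0"
  shows "Polynomial.algebraic z"
proof -
  interpret CC: field complex_ring by (rule complex_ring_field)
  have sel: "carrier complex_ring = UNIV" "\<And>x y. x \<otimes>\<^bsub>complex_ring\<^esub> y = x * y"
    "\<And>x y. x \<oplus>\<^bsub>complex_ring\<^esub> y = x + y" "\<one>\<^bsub>complex_ring\<^esub> = 1" "\<zero>\<^bsub>complex_ring\<^esub> = 0"
    by (simp_all add: complex_ring_def)
  have neg: "\<ominus>\<^bsub>complex_ring\<^esub> x = - x" for x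
    using CC.minus_equality[of "-x" x] by (simp add: sel)
  have inv: "inv\<^bsub>complex_ring\<^esub> x = inverse x" if "x \<noteq> 0" for x
    by (rule CC.comm_inv_char) (simp_all add: sel that)
  have pow: "x [^]\<^bsub>complex_ring\<^esub> n = x ^ n" for x and n :: nat
    by (induction n) (simp_all add: sel mult.commute)
  have sub: "subfield \<rat> complex_ring"
    by (rule CC.subfieldI'[OF CC.subringI]) (auto simp: sel neg inv)
  have eval: "CC.eval q x = poly (Poly (rev q)) x" for q x
    by (induction q) (simp_all add: sel pow Poly_append poly_monom)
  \<comment> \<open>HOL-Algebra lists coefficients from the leading one downwards, hence the
    reversals.\<close>
  have algI: "(CC.algebraic over K) x"
    if "subfield K complex_ring" "q \<noteq> 0" "set (coeffs q) \<subseteq> K" "poly q x = 0" for K q x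
  proof (rule CC.algebraicI)
    show "rev (coeffs q) \<in> carrier (K[X]\<^bsub>complex_ring\<^esub>)"
      using that by (auto simp: univ_poly_def polynomial_def sel hd_rev last_coeffs_eq_coeff_degree)
  qed (use that in \<open>simp_all add: eval sel\<close>)
  have algQ: "(CC.algebraic over \<rat>) x" if x: "Polynomial.algebraic x" for x
  proof -
    obtain q where q: "\<And>i. Polynomial.coeff q i \<in> \<int>" "q \<noteq> 0" "poly q x = 0"
      using algebraicE[OF x] by blast
    have "set (coeffs q) \<subseteq> \<rat>"
      using q(1) Ints_subset_Rats by (auto simp: coeffs_def)
    with q sub show ?thesis by (intro algI)
  qed
  \<comment> \<open>\<open>K\<close> is generated over the rationals by the coefficients of
    \<open>p\<close>. Both steps of the tower from the rationals through \<open>K\<close> to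
    \<open>K(z)\<close> are finite, so \<open>z\<close> lies in a finite extension of the
    rationals.\<close>
  define K where "K = CC.finite_extension \<rat> (coeffs p)"
  have alg: "(CC.algebraic over \<rat>) x" if "x \<in> set (coeffs p)" for x
    using that assms(1,2) by (auto simp: coeffs_def intro!: algQ simp del: upt_Suc)
  have sf: "subfield K complex_ring"
    unfolding K_def using alg by (intro CC.finite_extension_is_subfield[OF sub]) (auto simp: sel)
  have mem: "set (coeffs p) \<subseteq> K"
    unfolding K_def using CC.finite_extension_mem[OF subfieldE(1)[OF sub], of "coeffs p"] by (simp add: sel)
  have "(CC.algebraic over K) z"
    using sf assms(1,3) mem by (intro algI)
  then have "CC.finite_dimension K (CC.simple_extension K z)"
    using CC.finite_dimension_simple_extension[OF sf, of z] by (simp add: sel)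
  moreover have "CC.finite_dimension \<rat> K"
    unfolding K_def by (intro CC.finite_extension_finite_dimension(1)[OF sub] alg) (auto simp: sel)
  ultimately have "CC.finite_dimension \<rat> (CC.simple_extension K z)"
    using CC.telescopic_base_dim(1)[OF sub sf] by blast
  then have "CC.finite_dimension \<rat> (CC.finite_extension \<rat> (z # coeffs p))"
    by (simp add: K_def)
  then have "(CC.algebraic over \<rat>) z"
    by (intro CC.finite_extension_finite_dimension(2)[OF sub, of "z # coeffs p"]) (auto simp: sel)
  then obtain q where q: "q \<in> carrier (\<rat>[X]\<^bsub>complex_ring\<^esub>)" "q \<noteq> []"
      "CC.eval q z = \<zero>\<^bsub>complex_ring\<^esub>"
    using CC.algebraicE[OF subfieldE(1)[OF sub]] by (auto simp: sel)
  have r: "set q \<subseteq> \<rat>" and l: "hd q \<noteq> 0"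
    using q(1,2) by (auto simp: univ_poly_def polynomial_def sel)
  show ?thesis
  proof (rule algebraicI')
    show "poly (Poly (rev q)) z = 0" using q(3) by (simp add: eval sel)
    show "Polynomial.coeff (Poly (rev q)) i \<in> \<rat>" for i
      by (auto simp: nth_default_def rev_nth intro!: subsetD[OF r])
    have "coeffs (Poly (rev q)) = rev q"
      using q(2) l by (cases q) (simp_all add: coeffs_Poly strip_while_def)
    then show "Poly (rev q) \<noteq> 0" using q(2) by (metis coeffs_eq_Nil rev_is_Nil_conv)
  qed
qed

lemma of_qbar_simps:
  "of_qbar 0 = 0" "of_qbar 1 = 1" "of_qbar (x + y) = of_qbar x + of_qbar y"
  "of_qbar (x * y) = of_qbar x * of_qbar y" "of_qbar (- x) = - of_qbar x"
  "of_qbar (x - y) = of_qbar x - of_qbar y" "of_qbar (inverse x) = inverse (of_qbar x)"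
  "of_qbar x = of_qbar y \<longleftrightarrow> x = y"
  by (simp_all add: zero_qbar.rep_eq one_qbar.rep_eq plus_qbar.rep_eq times_qbar.rep_eq
      uminus_qbar.rep_eq minus_qbar.rep_eq inverse_qbar.rep_eq of_qbar_inject)

lemma of_qbar_power: "of_qbar (x ^ n) = of_qbar x ^ n"
  by (induction n) (simp_all add: of_qbar_simps)

text \<open>The complex root supplied by the fundamental theorem of algebra is algebraic over
  \<open>qbar\<close>, hence already in \<open>qbar\<close>.\<close>

lemma qbar_alg_closed:
  fixes p :: "qbar poly"
  assumes "Polynomial.degree p > 0"
  obtains x where "poly p x = 0"
proof -
  have c: "Polynomial.coeff (map_poly of_qbar p) i = of_qbar (Polynomial.coeff p i)" for i
    by (simp add: coeff_map_poly of_qbar_simps)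
  have ev: "poly (map_poly of_qbar p) (of_qbar x) = of_qbar (poly p x)" for x
    by (induction p) (simp_all add: map_poly_pCons of_qbar_simps)
  have d: "Polynomial.degree (map_poly of_qbar p) = Polynomial.degree p"
    by (rule degree_map_poly) (metis of_qbar_simps(1,8))
  then obtain z where z: "poly (map_poly of_qbar p) z = 0"
    using fundamental_theorem_of_algebra[of "map_poly of_qbar p"] assms
    by (auto simp: constant_degree)
  have "Polynomial.algebraic z"
  proof (rule algebraic_root_of_algebraic_poly[OF _ _ z])
    show "map_poly of_qbar p \<noteq> 0" using d assms by auto
    show "Polynomial.algebraic (Polynomial.coeff (map_poly of_qbar p) i)" for i
      unfolding c using of_qbar by simp
  qed
  then have "z = of_qbar (Abs_qbar z)" by (simp add: Abs_qbar_inverse)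
  with z ev show ?thesis by (metis that of_qbar_simps(1,8))
qed

lemma qbar_fourth_root:
  obtains x :: qbar where "x ^ 4 = a"
proof -
  have "Polynomial.degree (Polynomial.monom 1 4 - [:a:]) = 4"
    by (metis degree_add_eq_left degree_minus degree_monom_eq degree_pCons_0 diff_conv_add_uminus
        zero_less_numeral zero_neq_one)
  then obtain x where "poly (Polynomial.monom 1 4 - [:a:]) x = 0"
    using qbar_alg_closed[of "Polynomial.monom 1 4 - [:a:]"] by auto
  then show ?thesis by (intro that[of x]) (simp add: poly_monom)
qed

section \<open>Complex conjugation as an element of the Galois group\<close>

lift_definition cnj_qbar :: "qbar \<Rightarrow> qbar" is cnj by simp

lemma ring_hom_Rats_fixed:
  fixes f :: "'a::field_char_0 \<Rightarrow> 'a"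
  assumes "\<And>x y. f (x + y) = f x + f y" "\<And>x y. f (x * y) = f x * f y" "f 1 = 1" "x \<in> \<rat>"
  shows "f x = x"
proof -
  have z: "f 0 = 0" using assms(1)[of 0 0] by simp
  then have m: "f (- x) = - f x" for x
    using assms(1)[of x "- x"] by (simp add: eq_neg_iff_add_eq_0 add.commute)
  have n: "f (of_nat k) = of_nat k" for k by (induction k) (simp_all add: z assms)
  have i: "f (of_int k) = of_int k" for k by (cases k rule: int_cases2) (simp_all add: m n)
  obtain a b where ab: "b > 0" "x = of_int a / of_int b"
    using assms(4) by (metis Rats_cases')
  then have "x * of_int b = of_int a" by simp
  then have "f x * f (of_int b) = f (of_int a)" by (simp only: assms(2)[symmetric])
  then have "f x * of_int b = x * of_int b" using \<open>x * of_int b = of_int a\<close> by (simp add: i)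
  with ab(1) show ?thesis by simp
qed

lemma cnj_qbar_in_G_Q: "cnj_qbar \<in> G_Q"
proof -
  have 1: "cnj_qbar (x + y) = cnj_qbar x + cnj_qbar y" "cnj_qbar (x * y) = cnj_qbar x * cnj_qbar y"
    "cnj_qbar 1 = 1" "cnj_qbar (cnj_qbar x) = x" for x y
    by (transfer; simp)+
  moreover have "bij cnj_qbar" using 1(4) by (metis bijI')
  moreover have "cnj_qbar x = x" if "x \<in> \<rat>" for x
    using ring_hom_Rats_fixed[OF 1(1,2,3) that] .
  ultimately show ?thesis by (simp add: gal_def extensional_def)
qed

lemma zeta8_cnj: "cnj_qbar zeta8 = zeta8 ^ 7"
proof -
  have "cnj (exp (2 * of_real pi * \<i> / 8)) = exp (2 * of_real pi * \<i> / 8) ^ 7"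
  proof -
    have "exp (2 * of_real pi * \<i> / 8) ^ 8 = 1"
      using exp_two_pi_i by (simp add: exp_of_nat_mult[symmetric] ac_simps)
    then have "exp (2 * of_real pi * \<i> / 8) * exp (2 * of_real pi * \<i> / 8) ^ 7 = 1"
      by (simp flip: power_Suc)
    then have "exp (2 * of_real pi * \<i> / 8) ^ 7 = inverse (exp (2 * of_real pi * \<i> / 8))"
      by (rule inverse_unique[symmetric])
    then show ?thesis by (simp add: exp_cnj exp_minus[symmetric])
  qed
  then have "of_qbar (cnj_qbar zeta8) = of_qbar (zeta8 ^ 7)"
    by (simp add: cnj_qbar.rep_eq zeta8.rep_eq of_qbar_power)
  then show ?thesis by (simp only: of_qbar_simps)
qed

text \<open>The product is the square of an absolute value. This is the only place where positivity
  of real numbers enters.\<close>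

lemma cnj_qbar_mult_self_neq: "cnj_qbar x * x \<noteq> -1"
proof
  assume "cnj_qbar x * x = -1"
  then have "of_qbar (cnj_qbar x * x) = of_qbar (-1)" by simp
  then have "of_qbar x * cnj (of_qbar x) = -1" by (simp add: of_qbar_simps cnj_qbar.rep_eq mult.commute)
  then have "complex_of_real ((cmod (of_qbar x))\<^sup>2) = complex_of_real (-1)"
    by (simp only: complex_norm_square) simp
  then have "(cmod (of_qbar x))\<^sup>2 = -1" by (simp only: of_real_eq_iff)
  then show False by (metis zero_le_power2 neg_0_le_iff_le not_one_le_zero)
qed

section \<open>Forms\<close>

lemma degree_fermat_quartic: "Polynomial.degree fermat_quartic = 4"
  by (simp add: fermat_quartic_eq)

text \<open>The degree is that in \<open>Z\<close>, the outermost variable, in which the quartic is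
  monic of degree 4.\<close>

lemma not_fermat_quartic_dvd:
  "F \<noteq> 0 \<Longrightarrow> Polynomial.degree F < 4 \<Longrightarrow> \<not> fermat_quartic dvd F"
  using dvd_imp_degree_le[of fermat_quartic F] by (auto simp: degree_fermat_quartic)

definition const3 :: "qbar \<Rightarrow> poly3" where "const3 c = [:[:[:c:]:]:]"

lemma const3_simps:
  "const3 0 = 0" "const3 1 = 1" "const3 (a + b) = const3 a + const3 b" "const3 (a * b) = const3 a * const3 b"
  by (simp_all add: const3_def one_pCons mult.commute)

lemma mono3_eq:
  "Polynomial.monom (Polynomial.monom (Polynomial.monom c i) j) k =
    const3 c * varX ^ i * varY ^ j * varZ ^ k"
proof -
  have p1: "[:a:] ^ n = [:a ^ n:]" for a :: "'b::comm_ring_1" and n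
    by (induction n) (simp_all add: one_pCons)
  show ?thesis
    by (simp add: const3_def varX_def varY_def varZ_def p1 monom_altdef)
qed

lemma homogeneous_const: "homogeneous 0 (const3 c)"
  by (auto simp: const3_def homogeneous_def coeff_pCons split: nat.splits)

lemma homogeneous_var: "homogeneous 1 varX" "homogeneous 1 varY" "homogeneous 1 varZ"
  by (auto simp: homogeneous_def varX_def varY_def varZ_def coeff_pCons one_pCons split: nat.splits)

lemma homogeneous_power: "homogeneous d F \<Longrightarrow> homogeneous (n * d) (F ^ n)"
  by (induction n) (simp_all add: homogeneous_1 homogeneous_mult)

lemma homogeneous_mono3: "homogeneous (i + j + k) (const3 c * varX ^ i * varY ^ j * varZ ^ k)"
  using homogeneous_mult[OF homogeneous_mult[OF homogeneous_mult[OF homogeneous_const[of c]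
    homogeneous_power[OF homogeneous_var(1), of i]] homogeneous_power[OF homogeneous_var(2), of j]]
    homogeneous_power[OF homogeneous_var(3), of k]] by simp

lemma homogeneous_sum:
  "(\<And>x. x \<in> A \<Longrightarrow> homogeneous d (f x)) \<Longrightarrow> homogeneous d (sum f A)"
  by (induction A rule: infinite_finite_induct) (auto simp: homogeneous_0 homogeneous_add)

text \<open>Homogeneity is a condition on the coefficients, so each monomial of the full expansion
  of \<open>F\<close> either vanishes or has degree \<open>d\<close> itself.\<close>

lemma homogeneous_induct [consumes 1, case_names zero add mono]:
  assumes "homogeneous d F" and zero: "P 0"
    and add: "\<And>F G. homogeneous d F \<Longrightarrow> homogeneous d G \<Longrightarrow> P F \<Longrightarrow> P G \<Longrightarrow> P (F + G)"
    and mono: "\<And>c i j k. i + j + k = d \<Longrightarrow> P (const3 c * varX ^ i * varY ^ j * varZ ^ k)"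
  shows "P F"
proof -
  let ?c = "\<lambda>k j i. Polynomial.coeff (Polynomial.coeff (Polynomial.coeff F k) j) i"
  have m: "Polynomial.monom (sum f A) n = (\<Sum>x\<in>A. Polynomial.monom (f x) n)"
    for f :: "nat \<Rightarrow> 'z::comm_ring_1" and A n
    by (induction A rule: infinite_finite_induct) (simp_all add: add_monom[symmetric])
  have "F = (\<Sum>k\<le>Polynomial.degree F. Polynomial.monom (Polynomial.coeff F k) k)"
    by (simp add: poly_as_sum_of_monoms)
  also have "\<dots> = (\<Sum>k\<le>Polynomial.degree F. \<Sum>j\<le>Polynomial.degree (Polynomial.coeff F k).
      \<Sum>i\<le>Polynomial.degree (Polynomial.coeff (Polynomial.coeff F k) j).
        Polynomial.monom (Polynomial.monom (Polynomial.monom (?c k j i) i) j) k)"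
    by (simp add: poly_as_sum_of_monoms flip: m)
  finally have F: "F = \<dots>" .
  \<comment> \<open>Homogeneity is carried along with \<open>P\<close>, because the case
    \<open>add\<close> asks for both.\<close>
  have S: "homogeneous d (sum f A) \<and> P (sum f A)"
    if "\<And>x. x \<in> A \<Longrightarrow> homogeneous d (f x) \<and> P (f x)" for f :: "nat \<Rightarrow> poly3" and A
    using that by (induction A rule: infinite_finite_induct)
      (auto simp: homogeneous_0 homogeneous_add zero add)
  have "homogeneous d (Polynomial.monom (Polynomial.monom (Polynomial.monom (?c k j i) i) j) k) \<and>
      P (Polynomial.monom (Polynomial.monom (Polynomial.monom (?c k j i) i) j) k)" for k j i
  proof (cases "?c k j i = 0")
    case True then show ?thesis by (simp add: homogeneous_0 zero)
  next
    case False
    then have "i + j + k = d" using assms(1) by (simp add: homogeneous_def)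
    then show ?thesis using mono homogeneous_mono3[of i j k] by (simp add: mono3_eq)
  qed
  then show ?thesis by (subst F) (intro S[THEN conjunct2] S)
qed

lemma eval3_simps [simp]:
  "eval3 (F + G) v = eval3 F v + eval3 G v" "eval3 (F * G) v = eval3 F v * eval3 G v"
  "eval3 (- F) v = - eval3 F v" "eval3 (F - G) v = eval3 F v - eval3 G v" "eval3 (F ^ n) v = eval3 F v ^ n"
  "eval3 0 v = 0" "eval3 1 v = 1" "eval3 (const3 c) v = c"
  "eval3 varX (x, y, z) = x" "eval3 varY (x, y, z) = y" "eval3 varZ (x, y, z) = z"
  by (simp_all add: eval3_def const3_def varX_def varY_def varZ_def split: prod.splits)

lemma eval3_scale:
  assumes "homogeneous d F"
  shows "eval3 F (c * x, c * y, c * z) = c ^ d * eval3 F (x, y, z)"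
  using assms
proof (induction rule: homogeneous_induct)
  case (mono a i j k)
  then show ?case
    by (simp only: eval3_simps power_mult_distrib power_add flip: mono) (simp add: mult_ac)
qed (simp_all add: algebra_simps)

lemma eval3_fermat_quartic: "eval3 fermat_quartic (x, y, z) = x ^ 4 + y ^ 4 + z ^ 4"
  by (simp add: fermat_quartic_def)

section \<open>Points of the curve\<close>

lemma hpt_cases:
  assumes "P \<in> C4"
  obtains x y z where "P = hpt x y z" "(x, y, z) \<noteq> (0, 0, 0)" "x ^ 4 + y ^ 4 + z ^ 4 = 0"
  using assms by (auto simp: C4_def)

lemma hpt_in_C4: "(x, y, z) \<noteq> (0, 0, 0) \<Longrightarrow> x ^ 4 + y ^ 4 + z ^ 4 = 0 \<Longrightarrow> hpt x y z \<in> C4"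
  unfolding C4_def by blast

lemma C4_nonempty: "P \<in> C4 \<Longrightarrow> P \<noteq> {}"
  by (auto simp: C4_def hpt_def intro: exI[of _ 1])

lemma mem_hpt: "(x, y, z) \<in> hpt x y z"
  by (auto simp: hpt_def intro: exI[of _ 1])

lemma C4_fermat_zero: "P \<in> C4 \<Longrightarrow> v \<in> P \<Longrightarrow> fermat_quartic dvd F \<Longrightarrow> eval3 F v = 0"
  by (auto simp: C4_def hpt_def eval3_fermat_quartic power_mult_distrib dvd_def
      simp flip: distrib_left)

section \<open>Fractions of forms\<close>

lemma ratfun_rel_self: "ratfun_rel p p \<longleftrightarrow> form_pair p"
  by (auto simp: ratfun_rel_def)

lemma ratfun_cases:
  obtains d F G where "f = abs_ratfun (F, G)" "homogeneous d F" "homogeneous d G" "\<not> fermat_quartic dvd G"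
    "form_pair (F, G)"
proof -
  obtain p where "ratfun_rel p p" "f = abs_ratfun p"
    by (metis Quotient3_ratfun Quotient3_def)
  then show ?thesis using that by (cases p) (auto simp: ratfun_rel_self form_pair_def)
qed

lemma abs_ratfun_eq_iff:
  assumes "form_pair (F, G)" "form_pair (F', G')"
  shows "abs_ratfun (F, G) = abs_ratfun (F', G') \<longleftrightarrow> fermat_quartic dvd F * G' - F' * G"
  using Quotient3_rel[OF Quotient3_ratfun, of "(F, G)" "(F', G')"] assms
  by (simp add: ratfun_rel_def)

lemma abs_ratfun_eqI:
  "form_pair (F, G) \<Longrightarrow> form_pair (F', G') \<Longrightarrow> F * G' = F' * G \<Longrightarrow> abs_ratfun (F, G) = abs_ratfun (F', G')"
  by (simp add: abs_ratfun_eq_iff)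

lemma abs_ratfun_eq_0_iff: "form_pair (F, G) \<Longrightarrow> abs_ratfun (F, G) = 0 \<longleftrightarrow> fermat_quartic dvd F"
  by (simp add: zero_ratfun.abs_eq abs_ratfun_eq_iff form_pair_0)

lemma abs_ratfun_mult:
  "form_pair (F, G) \<Longrightarrow> form_pair (F', G') \<Longrightarrow>
    abs_ratfun (F, G) * abs_ratfun (F', G') = abs_ratfun (F * F', G * G')"
  by (simp add: times_ratfun.abs_eq ratfun_rel_self)

lemma abs_ratfun_add:
  "form_pair (F, G) \<Longrightarrow> form_pair (F', G') \<Longrightarrow>
    abs_ratfun (F, G) + abs_ratfun (F', G') = abs_ratfun (F * G' + F' * G, G * G')"
  by (simp add: plus_ratfun.abs_eq ratfun_rel_self)

lemma abs_ratfun_inverse: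
  "form_pair (F, G) \<Longrightarrow> \<not> fermat_quartic dvd F \<Longrightarrow> inverse (abs_ratfun (F, G)) = abs_ratfun (G, F)"
  by (simp add: inverse_ratfun.abs_eq ratfun_rel_self)

lemma form_pairI: "homogeneous d F \<Longrightarrow> homogeneous d G \<Longrightarrow> \<not> fermat_quartic dvd G \<Longrightarrow> form_pair (F, G)"
  by (auto simp: form_pair_def)

lemma form_pair_mult': "form_pair (F, G) \<Longrightarrow> form_pair (F', G') \<Longrightarrow> form_pair (F * F', G * G')"
  using form_pair_mult[of "(F, G)" "(F', G')"] by simp

lemma form_pair_add': "form_pair (F, G) \<Longrightarrow> form_pair (F', G') \<Longrightarrow> form_pair (F * G' + F' * G, G * G')"
  using form_pair_add[of "(F, G)" "(F', G')"] by simp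

lemma form_pair_const: "form_pair (const3 c, 1)"
  by (rule form_pairI[OF homogeneous_const homogeneous_1 not_fermat_quartic_dvd_1])

lemma abs_ratfun_add_same:
  assumes "homogeneous d F" "homogeneous d F'" "homogeneous d G" "\<not> fermat_quartic dvd G"
  shows "abs_ratfun (F, G) + abs_ratfun (F', G) = abs_ratfun (F + F', G)"
proof -
  have fp: "form_pair (F, G)" "form_pair (F', G)" "form_pair (F + F', G)"
    using assms by (auto intro: form_pairI homogeneous_add)
  then show ?thesis
    by (subst abs_ratfun_add) (auto intro!: abs_ratfun_eqI form_pair_add' simp: algebra_simps)
qed

lemma const_fun_eq: "const_fun c = abs_ratfun (const3 c, 1)"
  by (simp add: const_fun_def const3_def)

lemma const_fun_simps:
  "const_fun 0 = 0" "const_fun 1 = 1" "const_fun (a + b) = const_fun a + const_fun b"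
  "const_fun (a * b) = const_fun a * const_fun b"
  by (simp_all add: const_fun_eq zero_ratfun.abs_eq one_ratfun.abs_eq abs_ratfun_add abs_ratfun_mult
      form_pair_const const3_simps)

lemma const_fun_uminus: "const_fun (- a) = - const_fun a"
  using const_fun_simps(3)[of a "- a"] by (simp add: const_fun_simps eq_neg_iff_add_eq_0 add.commute)

lemma const_fun_diff: "const_fun (a - b) = const_fun a - const_fun b"
  using const_fun_simps(3)[of a "- b"] by (simp add: const_fun_uminus)

lemma const_fun_power: "const_fun (a ^ n) = const_fun a ^ n"
  by (induction n) (simp_all add: const_fun_simps)

lemma const_fun_eq_0_iff: "const_fun c = 0 \<longleftrightarrow> c = 0"
proof -
  have "\<not> fermat_quartic dvd const3 c" if "c \<noteq> 0"
    using that by (intro not_fermat_quartic_dvd) (auto simp: const3_def)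
  then show ?thesis
    by (auto simp: const_fun_eq abs_ratfun_eq_0_iff form_pair_const const3_simps)
qed

lemma const_fun_inject: "const_fun a = const_fun b \<longleftrightarrow> a = b"
  using const_fun_eq_0_iff[of "a - b"] by (simp add: const_fun_diff)

lemma const_fun_inverse: "const_fun (inverse a) = inverse (const_fun a)"
proof (cases "a = 0")
  case False
  then have "const_fun a * const_fun (inverse a) = 1" by (simp flip: const_fun_simps)
  then show ?thesis by (metis inverse_unique)
qed (simp add: const_fun_simps)

section \<open>Values of functions at points\<close>

text \<open>The value is a relation, since a function may have a pole at \<open>P\<close>. All
  coordinate vectors of \<open>P\<close> are quantified over so that the notion matches
  \<open>local_ring\<close> and \<open>max_ideal\<close>; by homogeneity a single vector suffices,
  see \<open>has_valI\<close>.\<close>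

definition has_val :: "point \<Rightarrow> ratfun \<Rightarrow> qbar \<Rightarrow> bool" where
  "has_val P f c \<longleftrightarrow> (\<exists>F G. form_pair (F, G) \<and> f = abs_ratfun (F, G) \<and>
    (\<forall>v\<in>P. eval3 G v \<noteq> 0 \<and> eval3 F v = c * eval3 G v))"

lemma has_valI:
  assumes "form_pair (F, G)" "eval3 G (x, y, z) \<noteq> 0" "eval3 F (x, y, z) = c * eval3 G (x, y, z)"
  shows "has_val (hpt x y z) (abs_ratfun (F, G)) c"
proof -
  obtain d where d: "homogeneous d F" "homogeneous d G" using assms(1) by (auto simp: form_pair_def)
  show ?thesis
    unfolding has_val_def using assms
    by (intro exI[of _ F] exI[of _ G]) (auto simp: hpt_def eval3_scale[OF d(1)] eval3_scale[OF d(2)])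
qed

text \<open>Cross-multiplying two representations gives a multiple of the quartic, and this vanishes
  at the points of the curve.\<close>

lemma has_val_unique:
  assumes "P \<in> C4" "has_val P f a" "has_val P f b" shows "a = b"
proof -
  obtain v where v: "v \<in> P" using C4_nonempty[OF assms(1)] by blast
  obtain F G where F: "form_pair (F, G)" "f = abs_ratfun (F, G)" "eval3 G v \<noteq> 0" "eval3 F v = a * eval3 G v"
    using assms(2) v by (auto simp: has_val_def)
  obtain F' G' where F': "form_pair (F', G')" "f = abs_ratfun (F', G')" "eval3 G' v \<noteq> 0" "eval3 F' v = b * eval3 G' v"
    using assms(3) v by (auto simp: has_val_def)
  have "fermat_quartic dvd F * G' - F' * G"
    using F F' by (simp flip: abs_ratfun_eq_iff)
  then have "eval3 (F * G' - F' * G) v = 0" using C4_fermat_zero assms(1) v by blast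
  then show ?thesis using F F' by simp
qed

lemma local_ring_eq:
  assumes "P \<in> C4" shows "local_ring P = {f. \<exists>c. has_val P f c}"
proof -
  obtain x y z where P: "P = hpt x y z" using assms by (rule hpt_cases)
  have "\<exists>c. has_val P (abs_ratfun (F, G)) c" if "form_pair (F, G)" "\<forall>v\<in>P. eval3 G v \<noteq> 0" for F G
  proof -
    have "eval3 G (x, y, z) \<noteq> 0" using that(2) mem_hpt P by blast
    with that(1) have "has_val P (abs_ratfun (F, G)) (eval3 F (x, y, z) / eval3 G (x, y, z))"
      unfolding P by (intro has_valI) simp_all
    then show ?thesis ..
  qed
  then show ?thesis unfolding local_ring_def by (auto simp: has_val_def) blast
qed

lemma max_ideal_eq: "max_ideal P = {f. has_val P f 0}"
  by (auto simp: max_ideal_def has_val_def)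

lemma has_val_const: "has_val P (const_fun c) c"
  unfolding has_val_def const_fun_eq
  by (intro exI[of _ "const3 c"] exI[of _ 1]) (simp add: form_pair_const)

lemma has_val_1: "has_val P 1 1" and has_val_0: "has_val P 0 0"
  using has_val_const[of P 1] has_val_const[of P 0] by (simp_all add: const_fun_simps)

lemma has_val_mult:
  assumes "has_val P f a" "has_val P g b" shows "has_val P (f * g) (a * b)"
proof -
  obtain F G F' G' where *: "form_pair (F, G)" "f = abs_ratfun (F, G)"
      "\<forall>v\<in>P. eval3 G v \<noteq> 0 \<and> eval3 F v = a * eval3 G v"
      "form_pair (F', G')" "g = abs_ratfun (F', G')"
      "\<forall>v\<in>P. eval3 G' v \<noteq> 0 \<and> eval3 F' v = b * eval3 G' v"
    using assms unfolding has_val_def by blast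
  then show ?thesis unfolding has_val_def
    by (intro exI[of _ "F * F'"] exI[of _ "G * G'"]) (simp add: abs_ratfun_mult form_pair_mult')
qed

lemma has_val_add:
  assumes "has_val P f a" "has_val P g b" shows "has_val P (f + g) (a + b)"
proof -
  obtain F G F' G' where *: "form_pair (F, G)" "f = abs_ratfun (F, G)"
      "\<forall>v\<in>P. eval3 G v \<noteq> 0 \<and> eval3 F v = a * eval3 G v"
      "form_pair (F', G')" "g = abs_ratfun (F', G')"
      "\<forall>v\<in>P. eval3 G' v \<noteq> 0 \<and> eval3 F' v = b * eval3 G' v"
    using assms unfolding has_val_def by blast
  then show ?thesis unfolding has_val_def
    by (intro exI[of _ "F * G' + F' * G"] exI[of _ "G * G'"])
      (simp add: abs_ratfun_add form_pair_add' algebra_simps)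
qed

lemma has_val_uminus: "has_val P f a \<Longrightarrow> has_val P (- f) (- a)"
  using has_val_mult[OF has_val_const[of P "-1"], of f a] by (simp add: const_fun_simps const_fun_uminus)

lemma has_val_diff: "has_val P f a \<Longrightarrow> has_val P g b \<Longrightarrow> has_val P (f - g) (a - b)"
  using has_val_add[of P f a "- g" "- b"] has_val_uminus[of P g b] by simp

lemma has_val_power: "has_val P f a \<Longrightarrow> has_val P (f ^ n) (a ^ n)"
  by (induction n) (simp_all add: has_val_1 has_val_mult)

lemma has_val_nonzero: "P \<in> C4 \<Longrightarrow> has_val P f a \<Longrightarrow> a \<noteq> 0 \<Longrightarrow> f \<noteq> 0"
  using has_val_unique has_val_0 by metis

lemma has_val_inverse:
  assumes "P \<in> C4" "has_val P f a" "a \<noteq> 0" shows "has_val P (inverse f) (inverse a)"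
proof -
  obtain v where v: "v \<in> P" using C4_nonempty[OF assms(1)] by blast
  obtain F G where *: "form_pair (F, G)" "f = abs_ratfun (F, G)"
      "\<forall>v\<in>P. eval3 G v \<noteq> 0 \<and> eval3 F v = a * eval3 G v"
    using assms(2) unfolding has_val_def by blast
  have "f \<noteq> 0" using has_val_nonzero assms by blast
  then have n: "\<not> fermat_quartic dvd F" using * by (simp add: abs_ratfun_eq_0_iff)
  then have "form_pair (G, F)" using *(1) by (auto simp: form_pair_def)
  with * n assms(3) show ?thesis unfolding has_val_def
    by (intro exI[of _ G] exI[of _ F]) (simp add: abs_ratfun_inverse)
qed

lemmas has_val_intros = has_val_const has_val_0 has_val_1 has_val_mult has_val_add has_val_uminus
  has_val_diff has_val_power

section \<open>Affine charts\<close>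

definition cpoly :: "qbar poly \<Rightarrow> ratfun \<Rightarrow> ratfun" where
  "cpoly a s = poly (map_poly const_fun a) s"

lemma cpoly_simps [simp]:
  "cpoly 0 s = 0" "cpoly 1 s = 1" "cpoly (pCons c a) s = const_fun c + s * cpoly a s"
  "cpoly (a + b) s = cpoly a s + cpoly b s" "cpoly (a * b) s = cpoly a s * cpoly b s"
  "cpoly (- a) s = - cpoly a s" "cpoly (a - b) s = cpoly a s - cpoly b s"
  "cpoly (Polynomial.smult c a) s = const_fun c * cpoly a s" "cpoly (a ^ n) s = cpoly a s ^ n"
  "cpoly (Polynomial.monom c n) s = const_fun c * s ^ n"
proof -
  note h = map_poly_hom[of const_fun, OF const_fun_simps(3,4,1,2)]
  show 1: "cpoly 0 s = 0" "cpoly 1 s = 1" "cpoly (pCons c a) s = const_fun c + s * cpoly a s"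
    "cpoly (a + b) s = cpoly a s + cpoly b s" "cpoly (a * b) s = cpoly a s * cpoly b s" for a b s c
    by (simp_all add: cpoly_def h map_poly_pCons const_fun_simps)
  show m: "cpoly (- a) s = - cpoly a s" for a
    using 1(4)[of a "- a" s] by (simp add: 1 eq_neg_iff_add_eq_0 add.commute)
  show "cpoly (a - b) s = cpoly a s - cpoly b s"
    using 1(4)[of a "- b" s] by (simp add: m)
  show sm: "cpoly (Polynomial.smult c a) s = const_fun c * cpoly a s" for c a
    using 1(5)[of "[:c:]" a s] by (simp add: 1)
  show pw: "cpoly (a ^ n) s = cpoly a s ^ n" for a n by (induction n) (simp_all add: 1)
  show "cpoly (Polynomial.monom c n) s = const_fun c * s ^ n"
    by (simp add: monom_altdef sm pw 1 const_fun_simps)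
qed

lemma has_val_cpoly: "has_val P s c \<Longrightarrow> has_val P (cpoly a s) (poly a c)"
  by (induction a) (auto intro!: has_val_intros)

abbreviation cubic :: "ratfun \<Rightarrow> ratfun \<Rightarrow> qbar poly \<Rightarrow> qbar poly \<Rightarrow> qbar poly \<Rightarrow> qbar poly \<Rightarrow> ratfun" where
  "cubic s w a0 a1 a2 a3 \<equiv> cpoly a0 s + cpoly a1 s * w + cpoly a2 s * w ^ 2 + cpoly a3 s * w ^ 3"

definition comb4 :: "ratfun \<Rightarrow> ratfun \<Rightarrow> (nat \<Rightarrow> qbar poly) \<Rightarrow> ratfun" where
  "comb4 s w a = (\<Sum>j<4. cpoly (a j) s * w ^ j)"

lemma comb4_expand:
  "comb4 s w a = cpoly (a 0) s + cpoly (a 1) s * w + cpoly (a 2) s * w ^ 2 + cpoly (a 3) s * w ^ 3"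
  by (simp add: comb4_def eval_nat_numeral)

text \<open>For functions with \<open>s ^ 4 + w ^ 4 = -1\<close> this is the affine coordinate ring
  generated by \<open>s\<close> and \<open>w\<close>: the equation removes all powers of
  \<open>w\<close> beyond the third.\<close>

definition chart_ring :: "ratfun \<Rightarrow> ratfun \<Rightarrow> ratfun set" where
  "chart_ring s w = range (comb4 s w)"

text \<open>Independence makes the chart ring free over the polynomials in \<open>s\<close>, with
  basis \<open>1, w, w ^ 2, w ^ 3\<close>.\<close>

locale fermat_chart =
  fixes s w :: ratfun
  assumes curve: "s ^ 4 + w ^ 4 = -1"
    and indep: "comb4 s w a = 0 \<Longrightarrow> j < 4 \<Longrightarrow> a j = 0"
begin

abbreviation "R \<equiv> chart_ring s w"

lemma w4: "w ^ 4 = - (1 + s ^ 4)"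
  using curve by (simp add: algebra_simps eq_neg_iff_add_eq_0)

lemma R_comb: "cubic s w a0 a1 a2 a3 \<in> R"
proof -
  have "comb4 s w (\<lambda>j. if j = 0 then a0 else if j = 1 then a1 else if j = 2 then a2 else a3) \<in> R"
    by (simp add: chart_ring_def)
  then show ?thesis by (simp add: comb4_expand)
qed

lemma indep4:
  assumes "cubic s w a0 a1 a2 a3 = 0"
  shows "a0 = 0" "a1 = 0" "a2 = 0" "a3 = 0"
proof -
  let ?a = "\<lambda>j::nat. if j = 0 then a0 else if j = 1 then a1 else if j = 2 then a2 else a3"
  have "comb4 s w ?a = 0" using assms by (simp add: comb4_expand)
  from indep[OF this, of 0] indep[OF this, of 1] indep[OF this, of 2] indep[OF this, of 3]
  show "a0 = 0" "a1 = 0" "a2 = 0" "a3 = 0" by simp_all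
qed

lemma R_cases:
  assumes "r \<in> R"
  obtains a0 a1 a2 a3 where "r = cubic s w a0 a1 a2 a3"
  using assms by (auto simp: chart_ring_def comb4_expand)

lemma R_cpoly: "cpoly a s \<in> R"
  using R_comb[of a 0 0 0] by simp

lemma R_const: "const_fun c \<in> R"
  using R_cpoly[of "[:c:]"] by simp

lemma R_s: "s \<in> R"
  using R_cpoly[of "[:0, 1:]"] by (simp add: const_fun_simps)

lemma R_add: "r \<in> R \<Longrightarrow> q \<in> R \<Longrightarrow> r + q \<in> R"
proof (elim R_cases)
  fix a0 a1 a2 a3 b0 b1 b2 b3
  assume "r = cubic s w a0 a1 a2 a3"
    "q = cubic s w b0 b1 b2 b3"
  then show ?thesis using R_comb[of "a0 + b0" "a1 + b1" "a2 + b2" "a3 + b3"]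
    by (simp add: algebra_simps)
qed

lemma R_cpoly_mult: "r \<in> R \<Longrightarrow> cpoly b s * r \<in> R"
proof (elim R_cases)
  fix a0 a1 a2 a3
  assume "r = cubic s w a0 a1 a2 a3"
  then show ?thesis using R_comb[of "b * a0" "b * a1" "b * a2" "b * a3"]
    by (simp add: algebra_simps)
qed

lemma R_w_mult: "r \<in> R \<Longrightarrow> w * r \<in> R"
proof (elim R_cases)
  fix a0 a1 a2 a3
  assume "r = cubic s w a0 a1 a2 a3"
  then have "w * r = cpoly a0 s * w + cpoly a1 s * w ^ 2 + cpoly a2 s * w ^ 3 + cpoly a3 s * w ^ 4"
    by (simp add: algebra_simps eval_nat_numeral)
  also have "\<dots> \<in> R" using R_comb[of "- (1 + [:0, 1:] ^ 4) * a3" a0 a1 a2]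
    by (simp add: w4 const_fun_simps algebra_simps)
  finally show ?thesis .
qed

lemma R_mult: "r \<in> R \<Longrightarrow> q \<in> R \<Longrightarrow> r * q \<in> R"
proof (erule R_cases)
  fix a0 a1 a2 a3
  assume r: "r = cubic s w a0 a1 a2 a3" and q: "q \<in> R"
  have "r * q = cpoly a0 s * q + cpoly a1 s * (w * q) + cpoly a2 s * (w * (w * q)) +
      cpoly a3 s * (w * (w * (w * q)))"
    unfolding r by (simp add: algebra_simps eval_nat_numeral)
  also have "\<dots> \<in> R" using q by (intro R_add R_cpoly_mult R_w_mult)
  finally show ?thesis .
qed

lemma R_w: "w \<in> R"
  using R_w_mult[OF R_const[of 1]] by (simp add: const_fun_simps)

lemma R_power: "r \<in> R \<Longrightarrow> r ^ n \<in> R"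
  using R_const[of 1] by (induction n) (simp_all add: const_fun_simps R_mult)

lemma cpoly_eq_0_iff: "cpoly a s = 0 \<longleftrightarrow> a = 0"
  using indep4(1)[of a 0 0 0] by auto

text \<open>The norm to \<open>qbar[s]\<close>, taken in the two quadratic steps \<open>w \<mapsto> -w\<close> and \<open>w\<^sup>2 \<mapsto> -w\<^sup>2\<close>.\<close>

lemma norm_exists:
  assumes "r \<in> R" "r \<noteq> 0"
  obtains q n where "q \<in> R" "n \<noteq> 0" "r * q = cpoly n s"
proof -
  obtain a0 a1 a2 a3 where r: "r = cubic s w a0 a1 a2 a3"
    using assms(1) by (rule R_cases)
  define e :: "qbar poly" where "e = - (1 + [:0, 1:] ^ 4)"
  have e: "cpoly e s = w ^ 4" by (simp add: e_def w4 const_fun_simps)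
  define r' where "r' = cubic s w a0 (- a1) a2 (- a3)"
  \<comment> \<open>\<open>C\<close> and \<open>D\<close> are the coefficients of
    \<open>r * r'\<close> at \<open>1\<close> and \<open>w ^ 2\<close>; odd powers of
    \<open>w\<close> cancel, and \<open>w ^ 4\<close> is replaced by \<open>e\<close>.\<close>
  define C where "C = a0 ^ 2 + a2 ^ 2 * e - 2 * a1 * a3 * e"
  define D where "D = 2 * a0 * a2 - a1 ^ 2 - a3 ^ 2 * e"
  have two: "cpoly 2 s = 2" using cpoly_simps(4)[of 1 1 s] by (simp del: cpoly_simps(4))
  have rr': "r * r' = cpoly C s + cpoly D s * w ^ 2"
    unfolding r r'_def C_def D_def
    by (simp add: e two) (simp add: algebra_simps eval_nat_numeral)
  define q where "q = r' * (cpoly C s + cpoly (- D) s * w ^ 2)"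
  define n where "n = C ^ 2 - e * D ^ 2"
  have "r * q = (cpoly C s + cpoly D s * w ^ 2) * (cpoly C s + cpoly (- D) s * w ^ 2)"
    by (simp add: q_def flip: rr' mult.assoc)
  also have "\<dots> = cpoly n s"
    by (simp add: n_def e) (simp add: algebra_simps eval_nat_numeral)
  finally have rq: "r * q = cpoly n s" .
  have "r' \<noteq> 0"
  proof
    assume "r' = 0"
    from indep4[OF this[unfolded r'_def]] have "r = 0" by (simp add: r)
    with assms(2) show False ..
  qed
  then have nz: "cpoly C s + cpoly D s * w ^ 2 \<noteq> 0" using assms(2) by (simp flip: rr')
  have "cpoly C s + cpoly (- D) s * w ^ 2 \<noteq> 0"
  proof
    assume "cpoly C s + cpoly (- D) s * w ^ 2 = 0"
    with indep4[of C 0 "- D" 0] have "C = 0" "D = 0" by simp_all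
    with nz show False by simp
  qed
  then have "cpoly n s \<noteq> 0" using \<open>r' \<noteq> 0\<close> assms(2) by (simp add: q_def flip: rq)
  then have "n \<noteq> 0" by auto
  moreover have "q \<in> R"
    unfolding q_def r'_def using R_comb[of C 0 "- D" 0] by (intro R_mult R_comb) simp
  ultimately show ?thesis using that rq by blast
qed

text \<open>Rationalising the denominator: numerator and denominator are multiplied by the cofactor
  that turns \<open>q\<close> into its norm.\<close>

lemma fraction_rep:
  assumes "r \<in> R" "q \<in> R" "q \<noteq> 0"
  obtains r' n where "r' \<in> R" "n \<noteq> 0" "r / q = r' / cpoly n s"
proof -
  obtain q' n where q': "q' \<in> R" "n \<noteq> 0" "q * q' = cpoly n s"
    using norm_exists[OF assms(2,3)] .
  then have "q' \<noteq> 0" by (metis cpoly_eq_0_iff mult_zero_right)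
  then have "r / q = r * q' / cpoly n s" using q'(3)[symmetric] by simp
  then show ?thesis using that q' assms(1) R_mult by blast
qed

end

section \<open>The two standard charts\<close>

lemma varX_nz: "\<not> fermat_quartic dvd varX" and varY_nz: "\<not> fermat_quartic dvd varY"
  by (rule not_fermat_quartic_dvd; simp add: varX_def varY_def)+

lemma not_fermat_quartic_dvd_power: "\<not> fermat_quartic dvd M \<Longrightarrow> \<not> fermat_quartic dvd M ^ n"
  by (induction n) (simp_all add: not_fermat_quartic_dvd_1 fermat_quartic_dvd_mult)

lemma form_pair_vars:
  assumes "homogeneous 1 F" "M = varX \<or> M = varY" shows "form_pair (F, M)"
  using assms homogeneous_var varX_nz varY_nz by (auto intro: form_pairI)

lemma abs_ratfun_const_mult:
  assumes "form_pair (F, G)"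
  shows "abs_ratfun (const3 c * F, G) = const_fun c * abs_ratfun (F, G)"
  unfolding const_fun_eq using assms
  by (subst abs_ratfun_mult) (auto simp: form_pair_const)

lemma abs_ratfun_power: "form_pair (F, G) \<Longrightarrow> form_pair (F ^ n, G ^ n) \<and> abs_ratfun (F ^ n, G ^ n) = abs_ratfun (F, G) ^ n"
proof (induction n)
  case (Suc n)
  then show ?case using abs_ratfun_mult[of F G "F ^ n" "G ^ n"] by (simp add: form_pair_mult')
qed (simp add: one_ratfun.abs_eq form_pair_1)

lemma abs_ratfun_mono:
  assumes "M = varX \<or> M = varY" "i + j + k = d"
  shows "abs_ratfun (const3 c * varX ^ i * varY ^ j * varZ ^ k, M ^ d) =
    const_fun c * abs_ratfun (varX, M) ^ i * abs_ratfun (varY, M) ^ j * abs_ratfun (varZ, M) ^ k"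
proof -
  note p = abs_ratfun_power[OF form_pair_vars[OF homogeneous_var(1) assms(1)], of i]
    abs_ratfun_power[OF form_pair_vars[OF homogeneous_var(2) assms(1)], of j]
    abs_ratfun_power[OF form_pair_vars[OF homogeneous_var(3) assms(1)], of k]
  have 1: "form_pair (const3 c * varX ^ i, M ^ i)"
    using form_pair_mult'[OF form_pair_const, of "varX ^ i" "M ^ i" c] p by simp
  have 2: "form_pair (const3 c * varX ^ i * varY ^ j, M ^ i * M ^ j)"
    using 1 p by (intro form_pair_mult') auto
  have "abs_ratfun (const3 c * varX ^ i * varY ^ j * varZ ^ k, M ^ d) =
      abs_ratfun (const3 c * varX ^ i * varY ^ j, M ^ i * M ^ j) * abs_ratfun (varZ ^ k, M ^ k)"
    using 2 p by (subst abs_ratfun_mult) (auto simp: power_add simp flip: assms(2))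
  also have "abs_ratfun (const3 c * varX ^ i * varY ^ j, M ^ i * M ^ j) =
      abs_ratfun (const3 c * varX ^ i, M ^ i) * abs_ratfun (varY ^ j, M ^ j)"
    using 1 p by (subst abs_ratfun_mult) auto
  also have "abs_ratfun (const3 c * varX ^ i, M ^ i) = const_fun c * abs_ratfun (varX ^ i, M ^ i)"
    using p by (intro abs_ratfun_const_mult) auto
  finally show ?thesis using p by simp
qed

lemma abs_ratfun_self: "form_pair (M, M) \<Longrightarrow> abs_ratfun (M, M) = 1"
  by (auto simp: one_ratfun.abs_eq intro!: abs_ratfun_eqI form_pair_1)

lemma form_pair_power_var:
  assumes "M = varX \<or> M = varY" "homogeneous d F" shows "form_pair (F, M ^ d)"
  using assms homogeneous_power[OF homogeneous_var(1), of d] homogeneous_power[OF homogeneous_var(2), of d]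
    not_fermat_quartic_dvd_power[OF varX_nz] not_fermat_quartic_dvd_power[OF varY_nz]
  by (auto intro: form_pairI)

lemma abs_ratfun_div_same:
  assumes "form_pair (F, G)" "form_pair (F, M)" "form_pair (G, M)"
  shows "abs_ratfun (F, G) = abs_ratfun (F, M) / abs_ratfun (G, M)"
proof -
  have G: "\<not> fermat_quartic dvd G" using assms(1) by (simp add: form_pair_def)
  then have MG: "form_pair (M, G)" using assms(3) by (auto simp: form_pair_def)
  have "abs_ratfun (F, M) / abs_ratfun (G, M) = abs_ratfun (F * M, M * G)"
    using assms MG G by (simp add: divide_inverse abs_ratfun_inverse abs_ratfun_mult)
  also have "\<dots> = abs_ratfun (F, G)"
    using assms MG by (intro abs_ratfun_eqI form_pair_mult') (auto simp: mult_ac)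
  finally show ?thesis ..
qed

lemma abs_ratfun_sum:
  assumes "finite A" "homogeneous d G" "\<not> fermat_quartic dvd G" "\<And>x. x \<in> A \<Longrightarrow> homogeneous d (f x)"
  shows "abs_ratfun (\<Sum>x\<in>A. f x, G) = (\<Sum>x\<in>A. abs_ratfun (f x, G))"
  using assms(1,4)
proof (induction A rule: finite_induct)
  case empty
  then show ?case using assms homogeneous_0
    by (auto simp: zero_ratfun.abs_eq intro!: abs_ratfun_eqI form_pair_0 form_pairI)
next
  case (insert x A)
  have "abs_ratfun (f x + sum f A, G) = abs_ratfun (f x, G) + abs_ratfun (sum f A, G)"
    using insert.prems assms(2,3) by (intro abs_ratfun_add_same[symmetric] homogeneous_sum) auto
  with insert show ?case by simp
qed

lemma chart_curve:
  assumes "M = varX \<or> M = varY"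
  shows "abs_ratfun (varX, M) ^ 4 + abs_ratfun (varY, M) ^ 4 + abs_ratfun (varZ, M) ^ 4 = 0"
proof -
  note m = abs_ratfun_mono[OF assms, where c = 1]
  have h: "homogeneous 4 (varX ^ 4)" "homogeneous 4 (varY ^ 4)" "homogeneous 4 (varZ ^ 4)"
    using homogeneous_power[OF homogeneous_var(1), of 4] homogeneous_power[OF homogeneous_var(2), of 4]
     homogeneous_power[OF homogeneous_var(3), of 4] by simp_all
  have M: "homogeneous 4 (M ^ 4)" "\<not> fermat_quartic dvd M ^ 4"
    using assms h not_fermat_quartic_dvd_power[OF varX_nz] not_fermat_quartic_dvd_power[OF varY_nz] by auto
  have "abs_ratfun (fermat_quartic, M ^ 4) =
      abs_ratfun (varX, M) ^ 4 + abs_ratfun (varY, M) ^ 4 + abs_ratfun (varZ, M) ^ 4"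
  proof -
    have "abs_ratfun (fermat_quartic, M ^ 4) =
        abs_ratfun (varX ^ 4, M ^ 4) + abs_ratfun (varY ^ 4, M ^ 4) + abs_ratfun (varZ ^ 4, M ^ 4)"
      by (simp only: fermat_quartic_def abs_ratfun_add_same[OF h(1,2) M]
          abs_ratfun_add_same[OF homogeneous_add[OF h(1,2)] h(3) M])
    then show ?thesis
      using m[of 4 0 0 4] m[of 0 4 0 4] m[of 0 0 4 4] by (simp add: const_fun_simps const3_simps)
  qed
  moreover have "abs_ratfun (fermat_quartic, M ^ 4) = 0"
    using h M by (subst abs_ratfun_eq_0_iff) (auto simp: fermat_quartic_def intro!: form_pairI homogeneous_add)
  ultimately show ?thesis by simp
qed

text \<open>Clearing denominators turns a relation into a form of degree at most 3 in \<open>Z\<close>, which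
  the quartic can only divide if it vanishes.\<close>

lemma chart_indep:
  assumes "(N = varX \<and> M = varY) \<or> (N = varY \<and> M = varX)"
    and z: "comb4 (abs_ratfun (N, M)) (abs_ratfun (varZ, M)) a = 0" and "j < 4"
  shows "a j = 0"
proof -
  \<comment> \<open>A common degree for homogenising all terms, large enough that the natural
    subtraction \<open>D - i - j\<close> is never truncated.\<close>
  define D where "D = (\<Sum>j<4. Polynomial.degree (a j)) + 4"
  have D: "i + j \<le> D" if "j < 4" "i \<le> Polynomial.degree (a j)" for i j
    using member_le_sum[of j "{..<4}" "\<lambda>j. Polynomial.degree (a j)"] that by (simp add: D_def)
  have M: "M = varX \<or> M = varY" using assms(1) by auto
  \<comment> \<open>The term of \<open>a j\<close> at \<open>i\<close>, multiplied by
    \<open>M ^ D\<close>: the power of \<open>M\<close> fills the degree up to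
    \<open>D\<close>.\<close>
  define t where "t = (\<lambda>j i. const3 (Polynomial.coeff (a j) i) * N ^ i * M ^ (D - i - j) * varZ ^ j)"
  have hom: "homogeneous D (t j i)"
    and val: "abs_ratfun (t j i, M ^ D) = const_fun (Polynomial.coeff (a j) i) * abs_ratfun (N, M) ^ i * abs_ratfun (varZ, M) ^ j"
    if "j < 4" "i \<le> Polynomial.degree (a j)" for i j
  proof -
    have 1: "i + (D - i - j) + j = D" "D - i - j + i + j = D" using D[OF that] by simp_all
    have self: "abs_ratfun (varX, varX) = 1" "abs_ratfun (varY, varY) = 1"
      by (intro abs_ratfun_self form_pair_vars homogeneous_var; simp)+
    consider "N = varX" "M = varY" | "N = varY" "M = varX" using assms(1) by auto
    then have "homogeneous D (t j i) \<and> abs_ratfun (t j i, M ^ D) = const_fun (Polynomial.coeff (a j) i) * abs_ratfun (N, M) ^ i * abs_ratfun (varZ, M) ^ j"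
    proof cases
      case 1
      then show ?thesis
        using homogeneous_mono3[of i "D - i - j" j "Polynomial.coeff (a j) i"] self
          abs_ratfun_mono[OF _ \<open>i + (D - i - j) + j = D\<close>, of varY] \<open>i + (D - i - j) + j = D\<close>
        by (simp only: t_def) simp
    next
      case 2
      have "t j i = const3 (Polynomial.coeff (a j) i) * varX ^ (D - i - j) * varY ^ i * varZ ^ j"
        by (simp only: t_def 2 mult_ac)
      then show ?thesis
        using homogeneous_mono3[of "D - i - j" i j "Polynomial.coeff (a j) i"] self 2
          abs_ratfun_mono[OF _ \<open>D - i - j + i + j = D\<close>, of varX] \<open>D - i - j + i + j = D\<close>
        by simp
    qed
    then show "homogeneous D (t j i)"
      "abs_ratfun (t j i, M ^ D) = const_fun (Polynomial.coeff (a j) i) * abs_ratfun (N, M) ^ i * abs_ratfun (varZ, M) ^ j"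
      by auto
  qed
  define F where "F = (\<Sum>j<4. \<Sum>i\<le>Polynomial.degree (a j). t j i)"
  have cp: "cpoly p s = (\<Sum>i\<le>Polynomial.degree p. const_fun (Polynomial.coeff p i) * s ^ i)" for p s
    by (simp add: cpoly_def poly_altdef degree_map_poly const_fun_eq_0_iff coeff_map_poly const_fun_simps)
  have homM: "form_pair (G, M ^ D)" if "homogeneous D G" for G
    using form_pair_power_var[OF M that] .
  have MD: "homogeneous D (M ^ D)" "\<not> fermat_quartic dvd M ^ D"
    using homM[OF homogeneous_0] M homogeneous_power[OF homogeneous_var(1), of D]
      homogeneous_power[OF homogeneous_var(2), of D] by (auto simp: form_pair_def)
  have "abs_ratfun (F, M ^ D) = (\<Sum>j<4. \<Sum>i\<le>Polynomial.degree (a j). abs_ratfun (t j i, M ^ D))"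
    unfolding F_def using MD hom
    by (subst abs_ratfun_sum[of _ D]) (auto intro!: homogeneous_sum sum.cong abs_ratfun_sum[of _ D])
  also have "\<dots> = comb4 (abs_ratfun (N, M)) (abs_ratfun (varZ, M)) a"
    by (simp add: comb4_def cp sum_distrib_right val)
  finally have "abs_ratfun (F, M ^ D) = 0" using z by simp
  moreover have "homogeneous D F" unfolding F_def by (intro homogeneous_sum hom) auto
  ultimately have dvd: "fermat_quartic dvd F" by (simp add: abs_ratfun_eq_0_iff homM)
  have tm: "t j i = (if N = varX then Polynomial.monom (Polynomial.monom (Polynomial.monom (Polynomial.coeff (a j) i) i) (D - i - j)) j
      else Polynomial.monom (Polynomial.monom (Polynomial.monom (Polynomial.coeff (a j) i) (D - i - j)) i) j)" for j i
    using assms(1) by (auto simp: t_def mono3_eq simp del: mult_pCons_left; simp only: mult_ac)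
  have "Polynomial.degree F \<le> 3"
    unfolding F_def by (intro degree_sum_le) (auto simp: tm intro!: order.trans[OF degree_monom_le])
  then have F0: "F = 0" using not_fermat_quartic_dvd[of F] dvd by auto
  have "Polynomial.coeff (a j) i = 0" if i: "i \<le> Polynomial.degree (a j)" for i
  proof -
    \<comment> \<open>No two terms share a monomial: the exponent of \<open>Z\<close> determines
      \<open>j\<close> and the exponent of \<open>N\<close> determines \<open>i\<close>, so one
      coefficient of \<open>F\<close> isolates one coefficient of \<open>a j\<close>.\<close>
    have pick: "(\<Sum>j'<4. \<Sum>i'\<le>Polynomial.degree (a j'). f j' i') = Polynomial.coeff (a j) i"
      if "\<And>j' i'. j' < 4 \<Longrightarrow> i' \<le> Polynomial.degree (a j') \<Longrightarrow>
          f j' i' = (if j' = j \<and> i' = i then Polynomial.coeff (a j) i else 0)" for f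
    proof -
      have "(\<Sum>j'<4. \<Sum>i'\<le>Polynomial.degree (a j'). f j' i') =
          (\<Sum>j'<4. if j' = j then Polynomial.coeff (a j) i else 0)"
        using that i by (intro sum.cong refl) (auto intro!: sum.neutral)
      then show ?thesis using \<open>j < 4\<close> by simp
    qed
    show ?thesis
    proof (cases "N = varX")
      case True
      have "0 = Polynomial.coeff (Polynomial.coeff (Polynomial.coeff F j) (D - i - j)) i" by (simp add: F0)
      also have "\<dots> = Polynomial.coeff (a j) i"
        unfolding F_def coeff_sum using D[OF \<open>j < 4\<close> i] D by (intro pick) (auto simp: tm True)
      finally show ?thesis ..
    next
      case False
      have "0 = Polynomial.coeff (Polynomial.coeff (Polynomial.coeff F j) i) (D - i - j)" by (simp add: F0)
      also have "\<dots> = Polynomial.coeff (a j) i"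
        unfolding F_def coeff_sum using D[OF \<open>j < 4\<close> i] D by (intro pick) (auto simp: tm False)
      finally show ?thesis ..
    qed
  qed
  then show ?thesis by (intro poly_eqI) (metis coeff_0 coeff_eq_0 not_le)
qed

section \<open>The local rings are discrete valuation rings\<close>

definition regular :: "point \<Rightarrow> ratfun \<Rightarrow> bool" where
  "regular P f \<longleftrightarrow> (\<exists>c. has_val P f c)"

definition unit_at :: "point \<Rightarrow> ratfun \<Rightarrow> bool" where
  "unit_at P f \<longleftrightarrow> (\<exists>c. c \<noteq> 0 \<and> has_val P f c)"

lemma regularI: "has_val P f c \<Longrightarrow> regular P f"
  by (auto simp: regular_def)

lemma regular_intros:
  "regular P (const_fun c)" "regular P 0" "regular P 1"
  "regular P f \<Longrightarrow> regular P g \<Longrightarrow> regular P (f + g)"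
  "regular P f \<Longrightarrow> regular P g \<Longrightarrow> regular P (f - g)"
  "regular P f \<Longrightarrow> regular P g \<Longrightarrow> regular P (f * g)"
  "regular P f \<Longrightarrow> regular P (- f)"
  "regular P f \<Longrightarrow> regular P (f ^ n)"
  "regular P s \<Longrightarrow> regular P (cpoly a s)"
  unfolding regular_def using has_val_intros has_val_cpoly by meson+

lemma unit_at_imp_regular: "unit_at P f \<Longrightarrow> regular P f"
  by (auto simp: regular_def unit_at_def)

lemma unit_at_mult: "unit_at P f \<Longrightarrow> unit_at P g \<Longrightarrow> unit_at P (f * g)"
  unfolding unit_at_def by (metis has_val_mult mult_eq_0_iff)

lemma unit_at_inverse: "P \<in> C4 \<Longrightarrow> unit_at P f \<Longrightarrow> unit_at P (inverse f)"
  unfolding unit_at_def by (metis has_val_inverse inverse_nonzero_iff_nonzero)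

lemma unit_at_1: "unit_at P 1"
  unfolding unit_at_def using has_val_1[of P] by (metis zero_neq_one)

lemma unit_at_uminus: "unit_at P f \<Longrightarrow> unit_at P (- f)"
  unfolding unit_at_def by (metis has_val_uminus neg_equal_0_iff_equal)

lemma unit_at_power: "unit_at P f \<Longrightarrow> unit_at P (f ^ n)"
  by (induction n) (simp_all add: unit_at_1 unit_at_mult)

lemma unit_at_nonzero: "P \<in> C4 \<Longrightarrow> unit_at P f \<Longrightarrow> f \<noteq> 0"
  unfolding unit_at_def by (metis has_val_nonzero)

lemma unit_at_powi: "P \<in> C4 \<Longrightarrow> unit_at P f \<Longrightarrow> unit_at P (f powi n)"
  by (simp add: power_int_def unit_at_power unit_at_inverse)

lemma unit_at_eq: "P \<in> C4 \<Longrightarrow> u \<in> local_ring P - max_ideal P \<longleftrightarrow> unit_at P u"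
  unfolding local_ring_eq max_ideal_eq unit_at_def by (auto dest: has_val_unique) (metis)

lemma local_ring_regular: "P \<in> C4 \<Longrightarrow> f \<in> local_ring P \<longleftrightarrow> regular P f"
  by (simp add: local_ring_eq regular_def)

lemma max_ideal_ideal:
  "has_val P f 0 \<Longrightarrow> regular P g \<Longrightarrow> has_val P (f * g) 0"
  unfolding regular_def using has_val_mult by fastforce

text \<open>Every function has a denominator in \<open>s\<close> alone, so its possible poles within
  the chart lie over the roots of one polynomial.\<close>

locale function_chart = fermat_chart +
  assumes frac: "\<exists>r\<in>R. \<exists>n. n \<noteq> 0 \<and> f = r / cpoly n s"

text \<open>\<open>P\<close> is the point with affine coordinates \<open>(s0, w0)\<close>; \<open>val_frac\<close> says that the local ring is a
  localisation of the coordinate ring.\<close>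

locale chart_point = function_chart +
  fixes P :: point and s0 w0 :: qbar
  assumes P: "P \<in> C4" and s0: "has_val P s s0" and w0: "has_val P w w0"
    and val_frac: "has_val P f c \<Longrightarrow> \<exists>r\<in>R. \<exists>q\<in>R. \<exists>b. b \<noteq> 0 \<and> has_val P q b \<and> f = r / q"
begin

section \<open>Generators of the maximal ideal at a point\<close>

lemma reg_s: "regular P s" and reg_w: "regular P w"
  using s0 w0 by (auto simp: regular_def)

lemma R_regular: "r \<in> R \<Longrightarrow> regular P r"
  by (elim R_cases) (simp add: regular_intros reg_s reg_w)

lemma curve0: "s0 ^ 4 + w0 ^ 4 = -1"
proof -
  have "has_val P (s ^ 4 + w ^ 4) (s0 ^ 4 + w0 ^ 4)"
    by (intro has_val_intros s0 w0)
  moreover have "has_val P (s ^ 4 + w ^ 4) (-1)"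
    unfolding curve by (intro has_val_uminus has_val_1)
  ultimately show ?thesis using has_val_unique[OF P] by blast
qed

text \<open>The ideal of the local ring generated by the two coordinate differences. By
  \<open>max_ideal_imp_I\<close> it contains every function vanishing at \<open>P\<close>.\<close>

definition I :: "ratfun set" where
  "I = {f. \<exists>g h. regular P g \<and> regular P h \<and> f = (s - const_fun s0) * g + (w - const_fun w0) * h}"

lemma I_intro:
  "regular P g \<Longrightarrow> regular P h \<Longrightarrow> f = (s - const_fun s0) * g + (w - const_fun w0) * h \<Longrightarrow> f \<in> I"
  by (auto simp: I_def)

lemma I_add: "f \<in> I \<Longrightarrow> g \<in> I \<Longrightarrow> f + g \<in> I"
proof -
  assume "f \<in> I" "g \<in> I"
  then obtain a b c d where "regular P a" "regular P b" "regular P c" "regular P d"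
    "f = (s - const_fun s0) * a + (w - const_fun w0) * b" "g = (s - const_fun s0) * c + (w - const_fun w0) * d"
    by (auto simp: I_def)
  then show "f + g \<in> I"
    by (intro I_intro[of "a + c" "b + d"] regular_intros) (simp_all add: distrib_left)
qed

lemma I_mult: "f \<in> I \<Longrightarrow> regular P g \<Longrightarrow> f * g \<in> I"
proof -
  assume "f \<in> I" and g: "regular P g"
  then obtain a b where "regular P a" "regular P b"
    "f = (s - const_fun s0) * a + (w - const_fun w0) * b"
    by (auto simp: I_def)
  with g show "f * g \<in> I"
    by (intro I_intro[of "a * g" "b * g"] regular_intros) (simp_all add: distrib_right mult.assoc)
qed

text \<open>The remainder theorem, stated for an arbitrary function because it is applied to
  \<open>s\<close> and to \<open>w\<close>.\<close>

lemma cpoly_split: "\<exists>b. cpoly a s' = const_fun (poly a c) + (s' - const_fun c) * cpoly b s'"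
proof -
  have "a = [:- c, 1:] * synthetic_div a c + [:poly a c:]"
    using synthetic_div_correct'[of c a] by simp
  then have "cpoly a s' = cpoly ([:- c, 1:] * synthetic_div a c + [:poly a c:]) s'" by simp
  also have "\<dots> = const_fun (poly a c) + (s' - const_fun c) * cpoly (synthetic_div a c) s'"
    by (simp only: cpoly_simps) (simp add: const_fun_simps const_fun_uminus algebra_simps)
  finally show ?thesis ..
qed

lemma cpoly_s_I: "cpoly a s - const_fun (poly a s0) \<in> I"
proof -
  obtain b where "cpoly a s = const_fun (poly a s0) + (s - const_fun s0) * cpoly b s"
    using cpoly_split by blast
  then show ?thesis 
    by (intro I_intro[of "cpoly b s" 0]) (auto intro: regular_intros reg_s)
qed

lemma power_w_I: "w ^ j - const_fun (w0 ^ j) \<in> I"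
proof -
  obtain b where "cpoly (Polynomial.monom 1 j) w = const_fun (poly (Polynomial.monom 1 j) w0) + (w - const_fun w0) * cpoly b w"
    using cpoly_split by blast
  then have "w ^ j = const_fun (w0 ^ j) + (w - const_fun w0) * cpoly b w"
    by (simp add: poly_monom const_fun_simps)
  then show ?thesis 
    by (intro I_intro[of 0 "cpoly b w"]) (auto intro: regular_intros reg_w)
qed

lemma term_I: "cpoly a s * w ^ j - const_fun (poly a s0 * w0 ^ j) \<in> I"
proof -
  have "cpoly a s * w ^ j - const_fun (poly a s0 * w0 ^ j) =
      (cpoly a s - const_fun (poly a s0)) * w ^ j + (w ^ j - const_fun (w0 ^ j)) * const_fun (poly a s0)"
    by (simp add: algebra_simps const_fun_simps)
  also have "\<dots> \<in> I" by (intro I_add I_mult cpoly_s_I power_w_I regular_intros reg_w)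
  finally show ?thesis .
qed

text \<open>Every term of the normal form is congruent modulo \<open>I\<close> to its value at
  \<open>P\<close>, so \<open>r\<close> is congruent to the sum of these values, which is 0.\<close>

lemma R_val_0_imp_I:
  assumes "r \<in> R" "has_val P r 0" shows "r \<in> I"
proof -
  obtain a where r: "r = comb4 s w a" using assms(1) by (auto simp: chart_ring_def)
  define c where "c = (\<Sum>j<4. poly (a j) s0 * w0 ^ j)"
  have "has_val P r c"
    unfolding r comb4_expand c_def
    by (simp add: eval_nat_numeral) (intro has_val_intros has_val_cpoly s0 w0)
  then have "c = 0" using assms(2) P has_val_unique by blast
  have cs: "const_fun (\<Sum>j<n. f j) = (\<Sum>j<n. const_fun (f j))" for f and n :: nat
    by (induction n) (simp_all add: const_fun_simps)
  have S: "(\<Sum>j<n. f j) \<in> I" if "\<And>j. f j \<in> I" for f and n :: nat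
  proof (induction n)
    case 0
    show ?case by (rule I_intro[of 0 0]) (simp_all add: regular_intros)
  qed (simp add: I_add that)
  have "r - const_fun c = (\<Sum>j<4. cpoly (a j) s * w ^ j - const_fun (poly (a j) s0 * w0 ^ j))"
    by (simp add: r comb4_def c_def sum_subtractf cs)
  also have "\<dots> \<in> I" by (intro S term_I)
  finally show ?thesis using \<open>c = 0\<close> by (simp add: const_fun_simps)
qed

text \<open>By \<open>val_frac\<close> the denominator is a unit at \<open>P\<close>, so the claim
  reduces to the numerator in the chart ring.\<close>

lemma max_ideal_imp_I:
  assumes "has_val P f 0" shows "f \<in> I"
proof -
  obtain r q b where *: "r \<in> R" "q \<in> R" "b \<noteq> 0" "has_val P q b" "f = r / q"
    using val_frac[OF assms] by blast
  have "q \<noteq> 0" using has_val_nonzero P * by blast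
  then have "has_val P r 0" using has_val_mult[OF assms *(4)] * by simp
  then have "r \<in> I" using * R_val_0_imp_I by blast
  moreover have "regular P (inverse q)"
    using has_val_inverse[OF P *(4,3)] by (rule regularI)
  ultimately show ?thesis using I_mult * by (simp add: divide_inverse)
qed

text \<open>\<open>A\<close> and \<open>B\<close> are the cofactors in
  \<open>s ^ 4 - s0 ^ 4 = (s - s0) * A\<close> and \<open>w ^ 4 - w0 ^ 4 = (w - w0) * B\<close>.
  Their values at \<open>P\<close> are \<open>4 * s0 ^ 3\<close> and \<open>4 * w0 ^ 3\<close>, the
  partial derivatives of the affine equation; smoothness appears as one of them being a
  unit.\<close>

definition A where "A = s ^ 3 + s ^ 2 * const_fun s0 + s * const_fun s0 ^ 2 + const_fun s0 ^ 3"
definition B where "B = w ^ 3 + w ^ 2 * const_fun w0 + w * const_fun w0 ^ 2 + const_fun w0 ^ 3"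

lemma AB: "(s - const_fun s0) * A + (w - const_fun w0) * B = 0"
proof -
  have "(s - const_fun s0) * A + (w - const_fun w0) * B =
      (s ^ 4 + w ^ 4) - (const_fun s0 ^ 4 + const_fun w0 ^ 4)"
    by (simp add: A_def B_def algebra_simps eval_nat_numeral)
  also have "const_fun s0 ^ 4 + const_fun w0 ^ 4 = -1"
    using curve0 by (metis const_fun_power const_fun_simps(2,3) const_fun_uminus)
  finally show ?thesis by (simp add: curve)
qed

lemma unit_A: "s0 \<noteq> 0 \<Longrightarrow> unit_at P A" and unit_B: "w0 \<noteq> 0 \<Longrightarrow> unit_at P B"
proof -
  have "has_val P A (s0 ^ 3 + s0 ^ 2 * s0 + s0 * s0 ^ 2 + s0 ^ 3)"
    "has_val P B (w0 ^ 3 + w0 ^ 2 * w0 + w0 * w0 ^ 2 + w0 ^ 3)"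
    unfolding A_def B_def by (intro has_val_intros s0 w0)+
  then have "has_val P A (4 * s0 ^ 3)" "has_val P B (4 * w0 ^ 3)"
    by (simp_all add: eval_nat_numeral algebra_simps)
  then show "s0 \<noteq> 0 \<Longrightarrow> unit_at P A" "w0 \<noteq> 0 \<Longrightarrow> unit_at P B"
    unfolding unit_at_def by (metis mult_eq_0_iff power_not_zero zero_neq_numeral)+
qed

text \<open>The local parameter is \<open>s - s0\<close>, or \<open>w\<close> where the projection to the \<open>s\<close>-line ramifies.\<close>

definition param :: "ratfun \<Rightarrow> nat \<Rightarrow> ratfun \<Rightarrow> bool" where
  "param t k u \<longleftrightarrow> has_val P t 0 \<and> t \<noteq> 0 \<and> (\<forall>f. has_val P f 0 \<longrightarrow> (\<exists>g. regular P g \<and> f = t * g)) \<and>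
    unit_at P u \<and> s - const_fun s0 = u * t ^ k"

lemma s_nz: "s - const_fun s0 \<noteq> 0"
  using cpoly_eq_0_iff[of "[:- s0, 1:]"] by (simp add: const_fun_simps const_fun_uminus)

lemma w_nz: "w \<noteq> 0"
  using indep4[of 0 1 0 0] by auto

lemma param_s: assumes "w0 \<noteq> 0" shows "param (s - const_fun s0) 1 1"
proof -
  have *: "w - const_fun w0 = (s - const_fun s0) * - (A * inverse B)"
  proof -
    have "(w - const_fun w0) * B = (s - const_fun s0) * - A"
      using AB by (simp add: eq_neg_iff_add_eq_0 add.commute)
    moreover have "B \<noteq> 0" using unit_B[OF assms] P unit_at_nonzero by blast
    ultimately show ?thesis by (simp add: field_simps)
  qed
  have reg: "regular P (- (A * inverse B))"
    unfolding A_def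
    by (intro regular_intros reg_s unit_at_imp_regular[OF unit_at_inverse[OF P unit_B[OF assms]]])
  have "\<exists>g. regular P g \<and> f = (s - const_fun s0) * g" if f: "has_val P f 0" for f
  proof -
    obtain g h where gh: "regular P g" "regular P h" "f = (s - const_fun s0) * g + (w - const_fun w0) * h"
      using max_ideal_imp_I[OF f] by (auto simp: I_def)
    have "f = (s - const_fun s0) * (g + - (A * inverse B) * h)"
      using gh(3) unfolding * by (simp add: algebra_simps)
    moreover have "regular P (g + - (A * inverse B) * h)"
      using gh reg by (intro regular_intros(4,6))
    ultimately show ?thesis by blast
  qed
  moreover have "has_val P (s - const_fun s0) 0"
    using has_val_diff[OF s0 has_val_const[of P s0]] by simp
  ultimately show ?thesis using s_nz unit_at_1 by (simp add: param_def)
qed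

text \<open>For \<open>w0 = 0\<close> the equation forces \<open>s0 ^ 4 = -1\<close>, so
  \<open>A\<close> is a unit, while \<open>B\<close> is just \<open>w ^ 3\<close>. Then
  \<open>AB\<close> reads \<open>s - s0 = - w ^ 4 / A\<close>: total ramification with index
  4.\<close>

lemma param_w: assumes "w0 = 0" shows "param w 4 (- inverse A)"
proof -
  have "s0 \<noteq> 0" using curve0 assms by auto
  then have A: "unit_at P A" "A \<noteq> 0" using unit_A unit_at_nonzero P by blast+
  have "(s - const_fun s0) * A = - (w ^ 4)"
    using AB unfolding B_def by (simp add: assms const_fun_simps eq_neg_iff_add_eq_0 eval_nat_numeral)
  then have *: "s - const_fun s0 = - inverse A * w ^ 4"
    using A(2) by (simp add: field_simps)
  have "\<exists>g. regular P g \<and> f = w * g" if f: "has_val P f 0" for f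
  proof -
    obtain g h where gh: "regular P g" "regular P h" "f = (s - const_fun s0) * g + (w - const_fun w0) * h"
      using max_ideal_imp_I[OF f] by (auto simp: I_def)
    have "f = w * (- inverse A * w ^ 3 * g + h)"
      using gh(3) unfolding * by (simp add: algebra_simps eval_nat_numeral assms const_fun_simps)
    moreover have "regular P (- inverse A * w ^ 3 * g + h)"
      using gh unit_at_imp_regular[OF unit_at_inverse[OF P A(1)]] by (intro regular_intros reg_w)
    ultimately show ?thesis by blast
  qed
  then show ?thesis
    using * w_nz w0 assms unit_at_uminus[OF unit_at_inverse[OF P A(1)]] by (simp add: param_def)
qed

lemma param_exists: obtains t k u where "param t k u"
  using param_s param_w by blast

text \<open>Splitting off the factor \<open>s - s0\<close> as often as it occurs leaves a polynomial
  that does not vanish at \<open>s0\<close>, hence a unit at \<open>P\<close>.\<close>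

lemma cpoly_unit_power:
  assumes "param t k u" "n \<noteq> 0"
  obtains v m where "unit_at P v" "cpoly n s = v * t ^ m"
proof -
  obtain q where q: "n = [:- s0, 1:] ^ Polynomial.order s0 n * q" "\<not> [:- s0, 1:] dvd q"
    using order_decomp[OF assms(2)] by blast
  define e where "e = Polynomial.order s0 n"
  have "unit_at P (cpoly q s)"
    unfolding unit_at_def using q(2) has_val_cpoly[OF s0, of q] by (intro exI[of _ "poly q s0"]) (simp add: poly_eq_0_iff_dvd)
  moreover have u: "unit_at P u" "s - const_fun s0 = u * t ^ k" using assms(1) by (simp_all add: param_def)
  ultimately have "unit_at P (u ^ e * cpoly q s)" by (intro unit_at_mult unit_at_power)
  moreover have "cpoly n s = cpoly [:- s0, 1:] s ^ e * cpoly q s"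
    using q(1) unfolding e_def[symmetric] by (simp only: cpoly_simps)
  then have "cpoly n s = (u * t ^ k) ^ e * cpoly q s"
    by (simp add: const_fun_simps const_fun_uminus u(2)[symmetric])
  then have "cpoly n s = (u ^ e * cpoly q s) * t ^ (k * e)"
    by (simp add: power_mult_distrib power_mult)
  ultimately show ?thesis using that by blast
qed

text \<open>A non-unit \<open>f\<close> is divisible by \<open>t\<close>, and cancelling
  \<open>t\<close> lowers \<open>e\<close>; for \<open>e = 0\<close> the product is a unit and so is
  \<open>f\<close>. The known exponent of the product bounds the order of \<open>f\<close>, which
  makes the division process terminate.\<close>

lemma factor_unit_power:
  assumes t: "param t k u" and "unit_at P v" "regular P f" "regular P h" "f * h = v * t ^ e"
  shows "\<exists>a m. unit_at P a \<and> f = a * t ^ m"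
  using assms(3-5)
proof (induction e arbitrary: f)
  case 0
  obtain a b c where *: "has_val P f a" "has_val P h b" "c \<noteq> 0" "has_val P v c"
    using 0 assms(2) by (auto simp: regular_def unit_at_def)
  have "has_val P v (a * b)" using has_val_mult[OF *(1,2)] 0(3) by simp
  then have "a * b = c" using has_val_unique[OF P] *(4) by blast
  then have "unit_at P f" using * by (auto simp: unit_at_def)
  then show ?case by (intro exI[of _ f] exI[of _ 0]) simp
next
  case (Suc e)
  show ?case
  proof (cases "unit_at P f")
    case True
    then show ?thesis by (intro exI[of _ f] exI[of _ 0]) simp
  next
    case False
    then have "has_val P f 0" using Suc.prems(1) unfolding unit_at_def regular_def by metis
    then obtain g where g: "regular P g" "f = t * g" using t by (auto simp: param_def)
    have "t \<noteq> 0" using t by (simp add: param_def)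
    then have "g * h = v * t ^ e" using Suc.prems(3) g(2) by (simp add: mult_ac)
    then obtain a m where "unit_at P a" "g = a * t ^ m" using Suc.IH g(1) Suc.prems(2) by blast
    then show ?thesis using g(2) by (intro exI[of _ a] exI[of _ "Suc m"]) simp
  qed
qed

text \<open>Write \<open>f\<close> as \<open>r\<close> over a polynomial in \<open>s\<close>. The
  numerator \<open>r\<close> divides its norm, again a polynomial in \<open>s\<close>, and such
  polynomials are units times powers of \<open>t\<close>.\<close>

lemma unit_power_exists:
  assumes t: "param t k u" and "f \<noteq> 0"
  shows "\<exists>v n. unit_at P v \<and> f = v * t powi n"
proof -
  have t0: "t \<noteq> 0" using t by (simp add: param_def)
  obtain r n where rn: "r \<in> R" "n \<noteq> 0" "f = r / cpoly n s" using frac by blast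
  then have "r \<noteq> 0" using assms(2) by auto
  then obtain q m where q: "q \<in> R" "m \<noteq> 0" "r * q = cpoly m s" using norm_exists rn(1) by blast
  obtain v i where v: "unit_at P v" "cpoly m s = v * t ^ i" using cpoly_unit_power[OF t q(2)] .
  have "r * q = v * t ^ i" using q(3) v(2) by simp
  from factor_unit_power[OF t v(1) R_regular[OF rn(1)] R_regular[OF q(1)] this]
  obtain a j where a: "unit_at P a" "r = a * t ^ j" by blast
  obtain b l where b: "unit_at P b" "cpoly n s = b * t ^ l" using cpoly_unit_power[OF t rn(2)] .
  have "f = (a * inverse b) * t powi (int j - int l)"
    using t0 unit_at_nonzero[OF P b(1)] by (simp add: rn(3) a b power_int_diff field_simps)
  moreover have "unit_at P (a * inverse b)" using a b P by (intro unit_at_mult unit_at_inverse)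
  ultimately show ?thesis by blast
qed

lemma uniformizer_param: "param t k u \<Longrightarrow> uniformizer P t"
  using P unfolding uniformizer_def param_def max_ideal_eq
  by (auto simp: local_ring_regular intro: max_ideal_ideal)

lemma dvr:
  obtains t where "uniformizer P t" "\<forall>f. f \<noteq> 0 \<longrightarrow> (\<exists>v n. unit_at P v \<and> f = v * t powi n)"
  using param_exists uniformizer_param unit_power_exists by metis

end

section \<open>Orders of functions\<close>

text \<open>One locale serves the charts \<open>(X/Y, Z/Y)\<close> and \<open>(Y/X, Z/X)\<close>.
  The coordinate \<open>Z\<close> is never inverted, so in both charts the quartic stays monic in
  the second coordinate.\<close>

locale two_charts =
  fixes N M :: poly3
  assumes NM: "(N = varX \<and> M = varY) \<or> (N = varY \<and> M = varX)"
begin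

definition "s = abs_ratfun (N, M)"
definition "w = abs_ratfun (varZ, M)"

lemma M: "M = varX \<or> M = varY" and hom_M: "homogeneous 1 M" and hom_N: "homogeneous 1 N"
  using NM homogeneous_var by auto

lemma abs_self: "abs_ratfun (M, M) = 1"
  using form_pair_vars[OF hom_M M] by (rule abs_ratfun_self)

sublocale fermat_chart s w
proof
  have "s ^ 4 + 1 + w ^ 4 = 0"
    using chart_curve[OF M] NM abs_self by (auto simp: s_def w_def algebra_simps)
  then show "s ^ 4 + w ^ 4 = -1" by (simp add: eq_neg_iff_add_eq_0 algebra_simps)
  show "a j = 0" if "comb4 s w a = 0" "j < 4" for a j
    using chart_indep[OF NM] that by (simp add: s_def w_def)
qed

text \<open>Dehomogenisation: one of \<open>X/M\<close> and \<open>Y/M\<close> is 1, so a monomial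
  becomes a constant times powers of \<open>s\<close> and \<open>w\<close>.\<close>

lemma hom_in_R:
  assumes "homogeneous d F" shows "abs_ratfun (F, M ^ d) \<in> R"
  using assms
proof (induction rule: homogeneous_induct)
  case zero
  have "abs_ratfun (0, M ^ d) = 0"
    using form_pair_power_var[OF M homogeneous_0] by (simp add: abs_ratfun_eq_0_iff)
  then show ?case using R_const[of 0] by (simp add: const_fun_simps)
next
  case (add F G)
  have "homogeneous d (M ^ d)" using homogeneous_power[OF hom_M, of d] by simp
  moreover have "\<not> fermat_quartic dvd M ^ d"
    using form_pair_power_var[OF M homogeneous_0] by (simp add: form_pair_def)
  ultimately show ?case using add abs_ratfun_add_same R_add by metis
next
  case (mono c i j k)
  have "abs_ratfun (varX, M) \<in> R" "abs_ratfun (varY, M) \<in> R" "abs_ratfun (varZ, M) \<in> R"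
    using NM R_s R_w R_const[of 1] abs_self by (auto simp: s_def w_def const_fun_simps)
  then show ?case unfolding abs_ratfun_mono[OF M mono] by (intro R_mult R_power R_const)
qed

lemma ratfun_rep:
  assumes "homogeneous d F" "homogeneous d G" "\<not> fermat_quartic dvd G"
  shows "abs_ratfun (F, G) = abs_ratfun (F, M ^ d) / abs_ratfun (G, M ^ d)" "abs_ratfun (G, M ^ d) \<noteq> 0"
  using assms(3) form_pair_power_var[OF M assms(1)] form_pair_power_var[OF M assms(2)] form_pairI[OF assms]
  by (auto intro: abs_ratfun_div_same simp: abs_ratfun_eq_0_iff)

sublocale function_chart s w
proof
  fix f
  obtain d F G where *: "f = abs_ratfun (F, G)" "homogeneous d F" "homogeneous d G" "\<not> fermat_quartic dvd G"
    by (rule ratfun_cases)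
  show "\<exists>r\<in>R. \<exists>n. n \<noteq> 0 \<and> f = r / cpoly n s"
    using fraction_rep[OF hom_in_R[OF *(2)] hom_in_R[OF *(3)] ratfun_rep(2)[OF *(2-4)]]
    unfolding *(1) ratfun_rep(1)[OF *(2-4)] by metis
qed

lemma chart_pointI:
  assumes P: "hpt x y z \<in> C4" and nz: "eval3 M (x, y, z) \<noteq> 0"
  shows "chart_point s w (hpt x y z) (eval3 N (x, y, z) / eval3 M (x, y, z)) (z / eval3 M (x, y, z))"
proof
  show "hpt x y z \<in> C4" by fact
  show "has_val (hpt x y z) s (eval3 N (x, y, z) / eval3 M (x, y, z))"
    unfolding s_def using nz by (intro has_valI form_pair_vars hom_N M) simp_all
  show "has_val (hpt x y z) w (z / eval3 M (x, y, z))"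
    unfolding w_def using nz by (intro has_valI form_pair_vars homogeneous_var M) simp_all
  fix f c assume "has_val (hpt x y z) f c"
  then obtain F G where *: "form_pair (F, G)" "f = abs_ratfun (F, G)" "eval3 G (x, y, z) \<noteq> 0"
    using mem_hpt unfolding has_val_def by blast
  then obtain d where d: "homogeneous d F" "homogeneous d G" "\<not> fermat_quartic dvd G"
    by (auto simp: form_pair_def)
  have "has_val (hpt x y z) (abs_ratfun (G, M ^ d)) (eval3 G (x, y, z) / eval3 (M ^ d) (x, y, z))"
    using nz by (intro has_valI form_pair_power_var M d) simp_all
  moreover have "eval3 G (x, y, z) / eval3 (M ^ d) (x, y, z) \<noteq> 0"
    using *(3) nz by simp
  ultimately show "\<exists>r\<in>R. \<exists>q\<in>R. \<exists>b. b \<noteq> 0 \<and> has_val (hpt x y z) q b \<and> f = r / q"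
    using hom_in_R[OF d(1)] hom_in_R[OF d(2)] ratfun_rep(1)[OF d] *(2) by blast
qed

end

interpretation chartXY: two_charts varX varY by unfold_locales simp
interpretation chartYX: two_charts varY varX by unfold_locales simp

lemma local_dvr:
  assumes "P \<in> C4"
  obtains t where "uniformizer P t" "\<forall>f. f \<noteq> 0 \<longrightarrow> (\<exists>v n. unit_at P v \<and> f = v * t powi n)"
proof -
  obtain x y z where P: "P = hpt x y z" "(x, y, z) \<noteq> (0, 0, 0)" "x ^ 4 + y ^ 4 + z ^ 4 = 0"
    using assms by (rule hpt_cases)
  \<comment> \<open>\<open>X = Y = 0\<close> would give \<open>Z ^ 4 = 0\<close>, so each point lies
    in one of the two charts.\<close>
  consider "y \<noteq> 0" | "x \<noteq> 0" using P(2,3) by (cases "x = 0"; cases "y = 0") auto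
  then show ?thesis
  proof cases
    case 1
    then interpret chart_point chartXY.s chartXY.w P "x / y" "z / y"
      using chartXY.chart_pointI[of x y z] assms P by simp
    show ?thesis using dvr that by blast
  next
    case 2
    then interpret chart_point chartYX.s chartYX.w P "y / x" "z / x"
      using chartYX.chart_pointI[of x y z] assms P by simp
    show ?thesis using dvr that by blast
  qed
qed

section \<open>Uniformizers and the order at a point\<close>

lemma uniformizerD:
  assumes "uniformizer P t" "P \<in> C4"
  shows "t \<noteq> 0" "has_val P t 0" "has_val P f 0 \<Longrightarrow> \<exists>g. regular P g \<and> f = t * g"
proof -
  show "t \<noteq> 0" using assms by (simp add: uniformizer_def)
  have *: "{f. has_val P f 0} = (\<lambda>g. t * g) ` {g. regular P g}"
    using assms by (auto simp: uniformizer_def max_ideal_eq local_ring_regular)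
  have "t * 1 \<in> (\<lambda>g. t * g) ` {g. regular P g}" using regular_intros(3) by blast
  then show "has_val P t 0" using * by auto
  show "has_val P f 0 \<Longrightarrow> \<exists>g. regular P g \<and> f = t * g" using * by blast
qed

lemma uniformizer_associated:
  assumes "uniformizer P t" "uniformizer P t'" "P \<in> C4"
  obtains u where "unit_at P u" "t = u * t'"
proof -
  note t = uniformizerD[OF assms(1,3)] and t' = uniformizerD[OF assms(2,3)]
  obtain g h where gh: "regular P g" "t = t' * g" "regular P h" "t' = t * h"
    using t(3)[OF t'(2)] t'(3)[OF t(2)] by blast
  then have gh1: "g * h = 1" using t(1) by (metis mult.assoc mult_cancel_left1)
  obtain a b where ab: "has_val P g a" "has_val P h b" using gh by (auto simp: regular_def)
  have "a * b = 1" using has_val_mult[OF ab] has_val_1[of P] gh1 has_val_unique[OF assms(3)] by metis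
  then have "a \<noteq> 0" by (metis mult_zero_left zero_neq_one)
  then have "unit_at P g" using ab(1) unfolding unit_at_def by blast
  moreover have "t = g * t'" using gh(2) by (simp only: mult.commute)
  ultimately show ?thesis by (rule that)
qed

text \<open>If the exponents differed, one of the two units would be divisible by \<open>t\<close>
  and would vanish at \<open>P\<close>.\<close>

lemma unit_power_unique:
  assumes "P \<in> C4" "uniformizer P t" "unit_at P u" "unit_at P v" "u * t powi m = v * t powi n"
  shows "m = n"
proof -
  note t = uniformizerD[OF assms(2,1)]
  have *: False if "unit_at P u" "unit_at P v" "u * t powi m = v * t powi n" "m < n" for u v m n
  proof -
    have "u = v * t powi (n - m)"
      using that(3) t(1) by (simp add: power_int_diff field_simps)
    moreover have "t powi (n - m) = t * t ^ (nat (n - m - 1))"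
      using that(4) by (simp add: power_int_def flip: power_Suc) (simp add: Suc_nat_eq_nat_zadd1)
    ultimately have "u = t * (t ^ nat (n - m - 1) * v)" by (simp add: mult_ac)
    moreover have "regular P (t ^ nat (n - m - 1) * v)"
      using regularI[OF t(2)] unit_at_imp_regular[OF that(2)] by (intro regular_intros(6,8))
    ultimately have "has_val P u 0" using max_ideal_ideal t(2) by blast
    with that(1) show False unfolding unit_at_def using has_val_unique assms(1) by blast
  qed
  show ?thesis
    using *[OF assms(3-5)] *[OF assms(4,3) assms(5)[symmetric]] by (metis linorder_less_linear)
qed

text \<open>Evaluates the definite description. It ranges over all uniformizers, but changing the
  uniformizer only moves a power of a unit into the unit factor.\<close>

lemma ord_at_unique:
  assumes "P \<in> C4" "uniformizer P t" "unit_at P u" "f = u * t powi n"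
  shows "ord_at P f = n"
  unfolding ord_at_def unit_at_eq[OF assms(1)]
proof (rule the_equality)
  show "\<exists>t u. uniformizer P t \<and> unit_at P u \<and> f = u * t powi n" using assms by blast
  fix m assume "\<exists>t u. uniformizer P t \<and> unit_at P u \<and> f = u * t powi m"
  then obtain t' u' where t': "uniformizer P t'" "unit_at P u'" "f = u' * t' powi m" by blast
  obtain v where v: "unit_at P v" "t' = v * t" using uniformizer_associated[OF t'(1) assms(2,1)] .
  have "u * t powi n = (u' * v powi m) * t powi m"
    using assms(4) t'(3) v(2) by (simp add: power_int_mult_distrib mult.assoc)
  then show "m = n"
    using unit_power_unique[OF assms(1,2,3)] unit_at_mult[OF t'(2) unit_at_powi[OF assms(1) v(1)]] by metis
qed

lemma ord_at_decomp:
  assumes "P \<in> C4" "f \<noteq> 0"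
  obtains t u where "uniformizer P t" "unit_at P u" "f = u * t powi ord_at P f"
proof -
  obtain t where t: "uniformizer P t" "\<forall>f. f \<noteq> 0 \<longrightarrow> (\<exists>v n. unit_at P v \<and> f = v * t powi n)"
    using local_dvr[OF assms(1)] by blast
  obtain v n where v: "unit_at P v" "f = v * t powi n" using t(2) assms(2) by blast
  show ?thesis using that[OF t(1) v(1)] v(2) ord_at_unique[OF assms(1) t(1) v] by simp
qed

lemma ord_at_decomp_uniformizer:
  assumes "P \<in> C4" "f \<noteq> 0" "uniformizer P t"
  obtains u where "unit_at P u" "f = u * t powi ord_at P f"
proof -
  obtain t' u' where t': "uniformizer P t'" "unit_at P u'" "f = u' * t' powi ord_at P f"
    using ord_at_decomp[OF assms(1,2)] .
  obtain v where v: "unit_at P v" "t' = v * t" using uniformizer_associated[OF t'(1) assms(3,1)] .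
  have "f = (u' * v powi ord_at P f) * t powi ord_at P f"
    by (subst t'(3)) (simp add: v(2) power_int_mult_distrib)
  then show ?thesis using that unit_at_mult[OF t'(2) unit_at_powi[OF assms(1) v(1)]] by blast
qed

lemma ord_at_mult:
  assumes "P \<in> C4" "f \<noteq> 0" "g \<noteq> 0" shows "ord_at P (f * g) = ord_at P f + ord_at P g"
proof -
  obtain t u where t: "uniformizer P t" "unit_at P u" "f = u * t powi ord_at P f"
    using ord_at_decomp[OF assms(1,2)] .
  obtain v where v: "unit_at P v" "g = v * t powi ord_at P g"
    using ord_at_decomp_uniformizer[OF assms(1,3) t(1)] .
  show ?thesis
    using assms(1) t(1) unit_at_mult[OF t(2) v(1)]
  proof (rule ord_at_unique)
    have "f * g = (u * t powi ord_at P f) * (v * t powi ord_at P g)"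
      by (rule arg_cong2[OF t(3) v(2)])
    also have "\<dots> = (u * v) * (t powi ord_at P f * t powi ord_at P g)"
      by (simp only: mult_ac)
    also have "t powi ord_at P f * t powi ord_at P g = t powi (ord_at P f + ord_at P g)"
      using uniformizerD(1)[OF t(1) assms(1)] by (simp add: power_int_add)
    finally show "f * g = (u * v) * t powi (ord_at P f + ord_at P g)" .
  qed
qed

lemma ord_at_unit:
  assumes "P \<in> C4" "unit_at P u" shows "ord_at P u = 0"
proof -
  \<comment> \<open>The decomposition of 1 serves only as a source of a uniformizer at
    \<open>P\<close>.\<close>
  obtain t v where t: "uniformizer P t" "unit_at P v" "1 = v * t powi ord_at P 1"
    by (rule ord_at_decomp[OF assms(1) one_neq_zero])
  show ?thesis by (rule ord_at_unique[OF assms(1) t(1) assms(2)]) simp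
qed

lemma ord_at_inverse: "P \<in> C4 \<Longrightarrow> f \<noteq> 0 \<Longrightarrow> ord_at P (inverse f) = - ord_at P f"
  using ord_at_mult[of P f "inverse f"] ord_at_unit[OF _ unit_at_1, of P] by simp

lemma ord_at_eq_0_imp_unit: "P \<in> C4 \<Longrightarrow> f \<noteq> 0 \<Longrightarrow> ord_at P f = 0 \<Longrightarrow> unit_at P f"
  by (erule (1) ord_at_decomp) simp

section \<open>Divisors of products and constants\<close>

lemma div_of_mult: "f \<noteq> 0 \<Longrightarrow> g \<noteq> 0 \<Longrightarrow> div_of (f * g) P = div_of f P + div_of g P"
  by (simp add: div_of_def ord_at_mult)

lemma div_of_inverse: "f \<noteq> 0 \<Longrightarrow> div_of (inverse f) P = - div_of f P"
  by (simp add: div_of_def ord_at_inverse)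

lemma div_of_divide: "f \<noteq> 0 \<Longrightarrow> g \<noteq> 0 \<Longrightarrow> div_of (f / g) P = div_of f P - div_of g P"
  by (simp add: divide_inverse div_of_mult div_of_inverse)

lemma div_of_const: "c \<noteq> 0 \<Longrightarrow> div_of (const_fun c) P = 0"
  using has_val_const[of P c] by (auto simp: div_of_def unit_at_def intro!: ord_at_unit)

section \<open>Functions without poles are constant\<close>

text \<open>Each solution of the affine equation is a point of the chart, so regularity can be
  tested at every point of a fibre of \<open>s\<close>.\<close>

locale affine_curve = function_chart +
  assumes points: "s0 ^ 4 + w0 ^ 4 = -1 \<Longrightarrow> \<exists>P. chart_point s w P s0 w0"
begin

lemma cpoly_dvd:
  assumes "poly a s0 = 0" shows "\<exists>b. cpoly a s = (s - const_fun s0) * cpoly b s"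
proof -
  obtain b where "a = [:- s0, 1:] * b" using assms by (auto simp: poly_eq_0_iff_dvd)
  then have "cpoly a s = cpoly [:- s0, 1:] s * cpoly b s" by (simp only: cpoly_simps)
  then show ?thesis by (auto simp: const_fun_simps const_fun_uminus)
qed

text \<open>Elimination for a cubic vanishing at \<open>w0\<close>, \<open>-w0\<close>,
  \<open>i * w0\<close> and \<open>-i * w0\<close>, where \<open>A\<close> to \<open>D\<close> are
  its four terms at \<open>w0\<close> and the powers of \<open>i\<close> have already been
  reduced.\<close>

lemma four_relations:
  fixes A :: qbar
  assumes "A + B + C + D = 0" "A - B + C - D = 0" "A + i * B - C - i * D = 0" "A - i * B - C + i * D = 0"
    and "i \<noteq> 0"
  shows "A = 0 \<and> B = 0 \<and> C = 0 \<and> D = 0"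
proof -
  have "2 * (A + C) = (A + B + C + D) + (A - B + C - D)" by simp
  then have "2 * (A + C) = 0" unfolding assms(1,2) by (simp only: add_0)
  then have 1: "A + C = 0" by (metis mult_eq_0_iff zero_neq_numeral)
  have "2 * (A - C) = (A + i * B - C - i * D) + (A - i * B - C + i * D)" by simp
  then have "2 * (A - C) = 0" unfolding assms(3,4) by (simp only: add_0)
  then have 2: "A - C = 0" by (metis mult_eq_0_iff zero_neq_numeral)
  have "2 * A = (A + C) + (A - C)" by simp
  then have A: "A = 0" unfolding 1 2 by simp
  then have C: "C = 0" using 1 by simp
  have "i * (B - D) = 0" using assms(3) A C by (simp add: right_diff_distrib)
  then have 3: "B = D" using assms(5) by simp
  have "2 * B = 0" using assms(1) A C 3 by simp
  then show ?thesis using A C 3 by simp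
qed

text \<open>A polynomial of degree at most 3 in \<open>w\<close> has no room for the four zeros on a fibre of
  \<open>s\<close>; on a ramified fibre it would vanish to order 4 in the parameter \<open>w\<close>.\<close>

lemma vanishing_on_fibre:
  assumes reg: "\<And>P s0 w0. chart_point s w P s0 w0 \<Longrightarrow> regular P g"
    and a: "comb4 s w a = (s - const_fun s0) * g" and "j < 4"
  shows "poly (a j) s0 = 0"
proof -
  let ?c = "\<lambda>j. poly (a j) s0"
  have "?c 0 = 0 \<and> ?c 1 = 0 \<and> ?c 2 = 0 \<and> ?c 3 = 0"
  proof (cases "s0 ^ 4 = -1")
    case False
    obtain w0 where w0: "w0 ^ 4 = - 1 - s0 ^ 4" using qbar_fourth_root by blast
    have "w0 \<noteq> 0" using False w0 by (auto simp: algebra_simps)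
    have ev: "?c 0 + ?c 1 * v + ?c 2 * v ^ 2 + ?c 3 * v ^ 3 = 0" if v: "v ^ 4 = w0 ^ 4" for v
    proof -
      obtain P where "chart_point s w P s0 v" using points[of s0 v] v w0 by auto
      then interpret chart_point s w P s0 v .
      have "has_val P (comb4 s w a) (?c 0 + ?c 1 * v + ?c 2 * v ^ 2 + ?c 3 * v ^ 3)"
        unfolding comb4_expand by (intro has_val_intros has_val_cpoly s0 w0)
      moreover have "has_val P (s - const_fun s0) 0"
        using has_val_diff[OF s0 has_val_const[of P s0]] by simp
      then have "has_val P (comb4 s w a) 0"
        unfolding a by (rule max_ideal_ideal) (rule reg, unfold_locales)
      ultimately show ?thesis using has_val_unique P by blast
    qed
    \<comment> \<open>A square root of \<open>-1\<close>; it generates the four points of an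
      unramified fibre from one of them.\<close>
    define i where "i = zeta8 ^ 2"
    have i: "i ^ 2 = -1" using zeta8_pow4 by (simp add: i_def)
    then have i4: "i ^ 4 = 1" "i ^ 3 = - i" by (simp_all add: eval_nat_numeral)
    note e = ev[of w0] ev[of "- w0"] ev[of "i * w0"] ev[of "- i * w0"]
    have 1: "?c 0 + ?c 1 * w0 + ?c 2 * w0 ^ 2 + ?c 3 * w0 ^ 3 = 0"
      "?c 0 - ?c 1 * w0 + ?c 2 * w0 ^ 2 - ?c 3 * w0 ^ 3 = 0"
      "?c 0 + i * (?c 1 * w0) - ?c 2 * w0 ^ 2 - i * (?c 3 * w0 ^ 3) = 0"
      "?c 0 - i * (?c 1 * w0) - ?c 2 * w0 ^ 2 + i * (?c 3 * w0 ^ 3) = 0"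
      using e by (simp_all add: power_mult_distrib i i4 algebra_simps)
    have "i \<noteq> 0" using i by auto
    from four_relations[OF 1 this] show ?thesis using \<open>w0 \<noteq> 0\<close> by simp
  next
    case True
    obtain P where "chart_point s w P s0 0" using points[of s0 0] True by auto
    then interpret chart_point s w P s0 0 .
    define u where "u = - inverse A"
    have u: "unit_at P u" "s - const_fun s0 = u * w ^ 4"
      using param_w[OF refl] by (simp_all add: param_def u_def)
    have "\<exists>b. cpoly (a j) s = const_fun (?c j) + (s - const_fun s0) * cpoly b s" for j
      by (rule cpoly_split)
    then obtain b where b: "\<And>j. cpoly (a j) s = const_fun (?c j) + (s - const_fun s0) * cpoly (b j) s"
      by metis
    define h where "h = u * (g - comb4 s w b)"
    have "regular P g" by (rule reg) unfold_locales
    then have h: "regular P h"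
      unfolding h_def comb4_expand
      by (intro regular_intros reg_s reg_w unit_at_imp_regular[OF u(1)])
    \<comment> \<open>Each coefficient is split into its value at \<open>s0\<close> and a multiple
      of \<open>s - s0\<close>. The first parts stay on the left; everything else is divisible by
      \<open>s - s0\<close>, that is by \<open>w ^ 4\<close>.\<close>
    have "const_fun (?c 0) + const_fun (?c 1) * w + const_fun (?c 2) * w ^ 2 + const_fun (?c 3) * w ^ 3 =
        comb4 s w a - (s - const_fun s0) * comb4 s w b"
      unfolding comb4_expand b by (simp add: algebra_simps)
    also have "\<dots> = h * w ^ 4"
      unfolding a h_def u(2) by (simp add: algebra_simps)
    finally have eq: "const_fun (?c 0) + const_fun (?c 1) * w + const_fun (?c 2) * w ^ 2 + const_fun (?c 3) * w ^ 3 = h * w ^ 4" .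
    have wv: "has_val P w 0" by (rule w0)
    \<comment> \<open>Taking values at \<open>P\<close>, where \<open>w\<close> vanishes, kills the
      constant term. After each use a factor \<open>w\<close> is cancelled, which reaches the next
      coefficient.\<close>
    have step: "c = 0" if "const_fun c + w * f = w * f'" "regular P f" "regular P f'" for c f f'
    proof -
      have "const_fun c = w * (f' - f)" using that(1) by (simp add: algebra_simps)
      moreover have "has_val P (w * (f' - f)) 0"
        using wv that(2,3) by (intro max_ideal_ideal regular_intros(5))
      ultimately show ?thesis using has_val_const has_val_unique P by metis
    qed
    note ri = regular_intros reg_w h
    have c0: "?c 0 = 0"
      by (rule step[of _ "const_fun (?c 1) + const_fun (?c 2) * w + const_fun (?c 3) * w ^ 2" "h * w ^ 3"])
        (use eq in \<open>simp add: algebra_simps eval_nat_numeral\<close>, (intro ri)+)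
    have "w * (const_fun (?c 1) + w * (const_fun (?c 2) + const_fun (?c 3) * w)) = w * (w * (h * w ^ 2))"
      using eq by (simp add: c0 const_fun_simps algebra_simps eval_nat_numeral)
    then have eq1: "const_fun (?c 1) + w * (const_fun (?c 2) + const_fun (?c 3) * w) = w * (h * w ^ 2)"
      using w_nz by simp
    have c1: "?c 1 = 0" by (rule step[OF eq1]) (intro ri)+
    have eq2: "const_fun (?c 2) + w * const_fun (?c 3) = w * (h * w)"
      using eq1 w_nz unfolding c1 by (simp add: const_fun_simps power2_eq_square mult_ac)
    have c2: "?c 2 = 0" by (rule step[OF eq2]) (intro ri)+
    have eq3: "const_fun (?c 3) + w * 0 = w * h"
      using eq2 w_nz by (simp add: c2 const_fun_simps mult.commute)
    have c3: "?c 3 = 0" by (rule step[OF eq3]) (intro ri)+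
    show ?thesis using c0 c1 c2 c3 by simp
  qed
  moreover have "j = 0 \<or> j = 1 \<or> j = 2 \<or> j = 3" using assms(3) by auto
  ultimately show ?thesis by auto
qed

text \<open>Induction on the degree of the denominator. At a root \<open>s0\<close> of it,
  regularity of \<open>f\<close> makes the numerator vanish on the whole fibre, so all its
  coefficients are divisible by \<open>s - s0\<close> and the factor cancels.\<close>

lemma regular_imp_R:
  assumes reg: "\<And>P s0 w0. chart_point s w P s0 w0 \<Longrightarrow> regular P f"
  shows "f \<in> R"
proof -
  have "f \<in> R" if "n \<noteq> 0" "r \<in> R" "f = r / cpoly n s" for n r
    using that
  proof (induction "Polynomial.degree n" arbitrary: n r)
    case 0
    then obtain c where c: "n = [:c:]" by (metis degree_eq_zeroE)
    then have "f = const_fun (inverse c) * r"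
      using 0 by (simp add: const_fun_inverse divide_inverse mult.commute)
    then show ?case using R_mult[OF R_const 0(3)] by simp
  next
    case (Suc k)
    obtain s0 where s0: "poly n s0 = 0" using qbar_alg_closed[of n] Suc(2) by auto
    then obtain m where m: "n = [:- s0, 1:] * m" by (auto simp: poly_eq_0_iff_dvd)
    then have "m \<noteq> 0" using Suc.prems(1) by auto
    then have deg: "Polynomial.degree m = k" using Suc(2) unfolding m by (subst (asm) degree_mult_eq) auto
    have cn: "cpoly n s = (s - const_fun s0) * cpoly m s"
      unfolding m by (simp only: cpoly_simps) (simp add: const_fun_simps const_fun_uminus)
    have nz: "cpoly m s \<noteq> 0" "cpoly n s \<noteq> 0" using \<open>m \<noteq> 0\<close> Suc.prems(1) by (simp_all add: cpoly_eq_0_iff)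
    obtain a where a: "r = comb4 s w a" using Suc.prems(2) by (auto simp: chart_ring_def)
    \<comment> \<open>The cofactor of \<open>s - s0\<close> is regular on the chart because
      \<open>f\<close> is, which is the form required by \<open>vanishing_on_fibre\<close>.\<close>
    have ra: "comb4 s w a = (s - const_fun s0) * (cpoly m s * f)"
      using Suc.prems(3) nz by (simp add: a cn)
    have "poly (a j) s0 = 0" if "j < 4" for j
      using ra that
    proof (rule vanishing_on_fibre[rotated])
      fix P s1 w1 assume cp: "chart_point s w P s1 w1"
      then interpret chart_point s w P s1 w1 .
      show "regular P (cpoly m s * f)" using reg[OF cp] by (intro regular_intros reg_s)
    qed
    then have "\<forall>j. \<exists>b. j < 4 \<longrightarrow> cpoly (a j) s = (s - const_fun s0) * cpoly b s"
      using cpoly_dvd by blast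
    from choice[OF this] obtain b where b: "\<And>j. j < 4 \<Longrightarrow> cpoly (a j) s = (s - const_fun s0) * cpoly (b j) s" by blast
    have "r = (s - const_fun s0) * comb4 s w b"
      unfolding a comb4_def sum_distrib_left by (intro sum.cong) (simp_all add: b)
    then have "f = comb4 s w b / cpoly m s"
      using Suc.prems(3) nz by (simp add: cn)
    then show ?case using Suc.hyps(1)[of m "comb4 s w b"] deg \<open>m \<noteq> 0\<close> by (simp add: chart_ring_def)
  qed
  then show ?thesis using frac[of f] by blast
qed

end

interpretation affXY: affine_curve chartXY.s chartXY.w
proof
  fix s0 w0 :: qbar assume "s0 ^ 4 + w0 ^ 4 = -1"
  then have "s0 ^ 4 + 1 + w0 ^ 4 = 0" by (simp add: eq_neg_iff_add_eq_0 algebra_simps)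
  then have "hpt s0 1 w0 \<in> C4" by (intro hpt_in_C4) simp_all
  then show "\<exists>P. chart_point chartXY.s chartXY.w P s0 w0"
    using chartXY.chart_pointI[of s0 1 w0] by auto
qed

interpretation affYX: affine_curve chartYX.s chartYX.w
proof
  fix s0 w0 :: qbar assume "s0 ^ 4 + w0 ^ 4 = -1"
  then have "1 + s0 ^ 4 + w0 ^ 4 = 0" by (simp add: eq_neg_iff_add_eq_0 algebra_simps)
  then have "hpt 1 s0 w0 \<in> C4" by (intro hpt_in_C4) simp_all
  then show "\<exists>P. chart_point chartYX.s chartYX.w P s0 w0"
    using chartYX.chart_pointI[of 1 s0 w0] by auto
qed

text \<open>\<open>q\<close> is the polynomial \<open>p\<close> with its coefficients reversed and
  padded to degree \<open>m\<close>. This rewrites coefficients of the chart \<open>1/s\<close> in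
  terms of \<open>s\<close>.\<close>

lemma reverse_cpoly:
  assumes "s \<noteq> 0" "Polynomial.degree p \<le> m"
  shows "\<exists>q. Polynomial.degree q \<le> m \<and> s ^ m * cpoly p (inverse s) = cpoly q s"
  using assms(2)
proof (induction p arbitrary: m)
  case 0
  show ?case by (intro exI[of _ 0]) simp
next
  case (pCons c p)
  show ?case
  proof (cases "p = 0")
    case True
    then show ?thesis by (intro exI[of _ "Polynomial.monom c m"]) (simp add: degree_monom_le mult.commute)
  next
    case False
    then obtain k where k: "m = Suc k" using pCons.prems by (cases m) auto
    obtain q where q: "Polynomial.degree q \<le> k" "s ^ k * cpoly p (inverse s) = cpoly q s"
      using pCons.IH[of k] pCons.prems False k by auto
    have "s ^ m * cpoly (pCons c p) (inverse s) = const_fun c * s ^ m + s ^ k * cpoly p (inverse s)"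
      using assms(1) by (simp add: k field_simps)
    then show ?thesis using q k
      by (intro exI[of _ "Polynomial.monom c m + q"]) (auto intro!: degree_add_le degree_monom_le)
  qed
qed

lemma chartXY_s_nz: "chartXY.s \<noteq> 0"
  using form_pair_vars[OF homogeneous_var(1), of varY] varX_nz
  by (simp add: chartXY.s_def abs_ratfun_eq_0_iff)

lemma chartYX_eq: "chartYX.s = inverse chartXY.s" "chartYX.w = chartXY.w * inverse chartXY.s"
proof -
  have fp: "form_pair (varX, varY)" "form_pair (varY, varX)" "form_pair (varZ, varX)" "form_pair (varZ, varY)"
    by (intro form_pair_vars homogeneous_var; simp)+
  show s': "chartYX.s = inverse chartXY.s"
    unfolding chartXY.s_def chartYX.s_def using fp varX_nz by (simp add: abs_ratfun_inverse)
  show "chartYX.w = chartXY.w * inverse chartXY.s"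
    unfolding s'[symmetric] unfolding chartXY.w_def chartYX.s_def chartYX.w_def
    using fp by (subst abs_ratfun_mult) (auto intro!: abs_ratfun_eqI form_pair_mult' simp: mult_ac)
qed

text \<open>The function is a polynomial of degree at most 3 in the second coordinate in both charts
  \<open>(s, w)\<close> and \<open>(1/s, w/s)\<close>, and comparing degrees in \<open>s\<close> leaves only constants.\<close>

lemma regular_imp_const:
  assumes "\<And>P. P \<in> C4 \<Longrightarrow> regular P f"
  obtains c where "f = const_fun c"
proof -
  define s w where "s = chartXY.s" and "w = chartXY.w"
  note s' = chartYX_eq(1)[folded s_def] and w' = chartYX_eq(2)[folded s_def w_def]
  have s0: "s \<noteq> 0" using chartXY_s_nz by (simp add: s_def)
  have "f \<in> chart_ring s w"
    unfolding s_def w_def by (rule affXY.regular_imp_R) (metis assms chart_point.P)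
  then obtain a where a: "f = comb4 s w a" by (auto simp: chart_ring_def)
  have "f \<in> chart_ring (inverse s) (w * inverse s)"
    unfolding w'[symmetric] unfolding s'[symmetric] by (rule affYX.regular_imp_R) (metis assms chart_point.P)
  then obtain b where b: "f = comb4 (inverse s) (w * inverse s) b" by (auto simp: chart_ring_def)
  \<comment> \<open>The term with index \<open>j\<close> involves powers of \<open>1/s\<close> up to
    \<open>degree (b j) + j\<close>; multiplication by \<open>s ^ D\<close> clears them all.\<close>
  define D where "D = (\<Sum>j<4. Polynomial.degree (b j)) + 4"
  have "Polynomial.degree (b j) + j \<le> D" if "j < 4" for j
    using member_le_sum[of j "{..<4}" "\<lambda>j. Polynomial.degree (b j)"] that by (simp add: D_def)
  then have "\<exists>q. Polynomial.degree q \<le> D - j \<and> s ^ (D - j) * cpoly (b j) (inverse s) = cpoly q s" if "j < 4" for j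
    using that by (intro reverse_cpoly s0) fastforce
  then obtain q where q: "\<And>j. j < 4 \<Longrightarrow> Polynomial.degree (q j) \<le> D - j"
    "\<And>j. j < 4 \<Longrightarrow> s ^ (D - j) * cpoly (b j) (inverse s) = cpoly (q j) s"
    by metis
  have sD: "s ^ D * (cpoly (b j) (inverse s) * (w * inverse s) ^ j) = cpoly (q j) s * w ^ j" if "j < 4" for j
  proof -
    have "s ^ D = s ^ (D - j) * s ^ j" using that by (simp add: D_def flip: power_add)
    then show ?thesis using s0 by (simp add: q(2)[OF that, symmetric] power_mult_distrib power_inverse)
  qed
  have "comb4 s w (\<lambda>j. Polynomial.monom 1 D * a j) = s ^ D * f"
    unfolding a comb4_def sum_distrib_left by (simp add: const_fun_simps mult.assoc)
  also have "\<dots> = comb4 s w q"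
    unfolding b comb4_def sum_distrib_left by (intro sum.cong) (simp_all add: sD)
  finally have "comb4 s w (\<lambda>j. Polynomial.monom 1 D * a j - q j) = 0"
    by (simp add: comb4_def left_diff_distrib sum_subtractf)
  then have "Polynomial.monom 1 D * a j - q j = 0" if "j < 4" for j
    using chartXY.indep[of "\<lambda>j. Polynomial.monom 1 D * a j - q j" j] that by (simp add: s_def w_def)
  \<comment> \<open>Comparing degrees in \<open>s\<close> on the two sides. As \<open>D\<close> is
    at least 4, the inequality is impossible for \<open>j = 1, 2, 3\<close>, and for
    \<open>j = 0\<close> it leaves only degree 0.\<close>
  then have deg: "D + Polynomial.degree (a j) \<le> D - j" if "j < 4" "a j \<noteq> 0" for j
    using q(1)[of j] that by (metis (no_types, lifting) degree_monom_eq degree_mult_eq monom_eq_0_iff right_minus_eq zero_neq_one)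
  have "a 1 = 0" "a 2 = 0" "a 3 = 0" using deg[of 1] deg[of 2] deg[of 3] by (auto simp: D_def)
  moreover have "Polynomial.degree (a 0) = 0" using deg[of 0] by (cases "a 0 = 0") auto
  then obtain c where "a 0 = [:c:]" by (metis degree_eq_zeroE)
  ultimately have "f = const_fun c" by (simp add: a comb4_expand)
  then show ?thesis by (rule that)
qed

lemma div_of_eq_0_imp_const:
  assumes "f \<noteq> 0" "\<And>P. div_of f P = 0"
  obtains c where "c \<noteq> 0" "f = const_fun c"
proof -
  have "regular P f" if "P \<in> C4" for P
    using assms that ord_at_eq_0_imp_unit[OF that assms(1)] unit_at_imp_regular by (metis div_of_def)
  then obtain c where "f = const_fun c" using regular_imp_const by blast
  then show ?thesis using that assms(1) const_fun_simps(1) by metis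
qed

section \<open>The tangent lines at the points of \<open>C4\<close> with \<open>Y = 0\<close>\<close>

definition flex_pt :: "qbar \<Rightarrow> point" where "flex_pt \<eta> = hpt 1 0 \<eta>"

text \<open>The defining form \<open>Z - \<eta> X\<close> of the tangent line at \<open>flex_pt \<eta>\<close>, divided by \<open>Y\<close>.\<close>

definition tangent_fun :: "qbar \<Rightarrow> ratfun" where "tangent_fun \<eta> = chartXY.w - const_fun \<eta> * chartXY.s"

lemma flex_pt_in_C4: "\<eta> ^ 4 = -1 \<Longrightarrow> flex_pt \<eta> \<in> C4"
  unfolding flex_pt_def by (intro hpt_in_C4) simp_all

lemma hpt_eq_flex_pt_iff: "hpt x y z = flex_pt \<eta> \<longleftrightarrow> x \<noteq> 0 \<and> y = 0 \<and> z = \<eta> * x"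
proof
  assume "hpt x y z = flex_pt \<eta>"
  then have "(x, y, z) \<in> hpt 1 0 \<eta>" using mem_hpt[of x y z] by (simp add: flex_pt_def)
  then show "x \<noteq> 0 \<and> y = 0 \<and> z = \<eta> * x" by (auto simp: hpt_def)
next
  assume *: "x \<noteq> 0 \<and> y = 0 \<and> z = \<eta> * x"
  have "(a, b, c) \<in> hpt x y z \<longleftrightarrow> (a, b, c) \<in> hpt 1 0 \<eta>" for a b c
  proof
    assume "(a, b, c) \<in> hpt x y z"
    then obtain k where "k \<noteq> 0" "a = k * x" "b = k * y" "c = k * z" by (auto simp: hpt_def)
    then show "(a, b, c) \<in> hpt 1 0 \<eta>" using * by (auto simp: hpt_def intro!: exI[of _ "k * x"])
  next
    assume "(a, b, c) \<in> hpt 1 0 \<eta>"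
    then obtain k where "k \<noteq> 0" "a = k" "b = 0" "c = k * \<eta>" by (auto simp: hpt_def)
    then show "(a, b, c) \<in> hpt x y z" using * by (auto simp: hpt_def intro!: exI[of _ "k / x"])
  qed
  then show "hpt x y z = flex_pt \<eta>" unfolding flex_pt_def by (simp add: set_eq_iff)
qed

lemma flex_pt_eq_iff: "flex_pt \<eta> = flex_pt \<theta> \<longleftrightarrow> \<eta> = \<theta>"
  using hpt_eq_flex_pt_iff[of 1 0 \<eta> \<theta>] by (simp add: flex_pt_def)

text \<open>Where \<open>Y\<close> does not vanish, \<open>Z = \<eta> X\<close> on the curve would
  give \<open>Y ^ 4 = 0\<close>, so there are no zeros. At a point with \<open>Y = 0\<close>,
  \<open>Y/X\<close> is a uniformizer: the denominator contributes a simple pole, and the numerator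
  is a unit unless the point is \<open>flex_pt \<eta>\<close>, where it has order 4.\<close>

lemma div_of_tangent_fun:
  assumes \<eta>: "\<eta> ^ 4 = -1"
  shows "tangent_fun \<eta> \<noteq> 0"
    and "div_of (tangent_fun \<eta>) P = 4 * of_bool (P = flex_pt \<eta>) - of_bool (\<exists>\<theta>. \<theta> ^ 4 = -1 \<and> P = flex_pt \<theta>)"
proof -
  \<comment> \<open>The same function in the other chart, \<open>(Z/X - \<eta>) / (Y/X)\<close>, for
    use at the points with \<open>Y = 0\<close>.\<close>
  have g: "tangent_fun \<eta> = (chartYX.w - const_fun \<eta>) * inverse chartYX.s"
    unfolding chartYX_eq using chartXY_s_nz by (simp add: tangent_fun_def field_simps)
  have nz: "chartYX.s \<noteq> 0" unfolding chartYX_eq using chartXY_s_nz by simp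
  show gnz: "tangent_fun \<eta> \<noteq> 0"
  proof
    assume "tangent_fun \<eta> = 0"
    then have "cpoly [:0, - \<eta>:] chartXY.s + cpoly 1 chartXY.s * chartXY.w + cpoly 0 chartXY.s * chartXY.w ^ 2 +
        cpoly 0 chartXY.s * chartXY.w ^ 3 = 0"
      by (simp add: tangent_fun_def const_fun_simps const_fun_uminus algebra_simps)
    from chartXY.indep4(2)[OF this] show False by simp
  qed
  show "div_of (tangent_fun \<eta>) P = 4 * of_bool (P = flex_pt \<eta>) - of_bool (\<exists>\<theta>. \<theta> ^ 4 = -1 \<and> P = flex_pt \<theta>)"
  proof (cases "P \<in> C4")
    case False
    then show ?thesis using flex_pt_in_C4 \<eta> by (auto simp: div_of_def)
  next
    case True
    then obtain x y z where Pe: "P = hpt x y z" "(x, y, z) \<noteq> (0, 0, 0)" "x ^ 4 + y ^ 4 + z ^ 4 = 0"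
      by (rule hpt_cases)
    show ?thesis
    proof (cases "y = 0")
      case False
      then interpret chart_point chartXY.s chartXY.w P "x / y" "z / y"
        using chartXY.chart_pointI[of x y z] True Pe by simp
      have "has_val P (tangent_fun \<eta>) (z / y - \<eta> * (x / y))"
        unfolding tangent_fun_def by (intro has_val_intros s0 w0)
      moreover have "z / y - \<eta> * (x / y) \<noteq> 0"
      proof
        assume "z / y - \<eta> * (x / y) = 0"
        then have "z = \<eta> * x" using False by (simp add: field_simps)
        then have "y ^ 4 = 0" using Pe(3) \<eta> by (simp add: power_mult_distrib)
        with False show False by simp
      qed
      ultimately have "ord_at P (tangent_fun \<eta>) = 0"
        using True
        by (intro ord_at_unit[unfolded unit_at_def]) blast+
      moreover have "P \<noteq> flex_pt \<theta>" for \<theta> unfolding Pe(1) using False by (simp add: hpt_eq_flex_pt_iff)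
      ultimately show ?thesis using True by (simp add: div_of_def)
    next
      case y: True
      then have x: "x \<noteq> 0" using Pe by auto
      define \<theta> where "\<theta> = z / x"
      have P\<theta>: "P = flex_pt \<theta>" using x y by (simp add: Pe(1) hpt_eq_flex_pt_iff \<theta>_def)
      have "z ^ 4 = - (x ^ 4)" using Pe(3) y by (simp add: eq_neg_iff_add_eq_0 add.commute)
      then have \<theta>: "\<theta> ^ 4 = -1" using x by (simp add: \<theta>_def power_divide)
      then have \<theta>0: "\<theta> \<noteq> 0" by auto
      interpret chart_point chartYX.s chartYX.w P 0 \<theta>
        using chartYX.chart_pointI[of x y z] True Pe x y by (simp add: \<theta>_def)
      have unif: "uniformizer P chartYX.s"
        using uniformizer_param[OF param_s[OF \<theta>0]] by (simp add: const_fun_simps)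
      have "ord_at P (tangent_fun \<eta>) = (if \<theta> = \<eta> then 3 else -1)"
      proof (cases "\<theta> = \<eta>")
        case False
        have "has_val P (chartYX.w - const_fun \<eta>) (\<theta> - \<eta>)" by (intro has_val_intros w0)
        then have "unit_at P (chartYX.w - const_fun \<eta>)" using False unfolding unit_at_def
          by (intro exI[of _ "\<theta> - \<eta>"]) simp
        then have "ord_at P (tangent_fun \<eta>) = -1"
          using True unif g by (intro ord_at_unique) (auto simp: power_int_minus)
        then show ?thesis using False by simp
      next
        case e: True
        have B: "unit_at P B" using unit_B[OF \<theta>0] .
        then have B0: "B \<noteq> 0" using unit_at_nonzero True by blast
        \<comment> \<open>Here the first coordinate of the point is 0, so \<open>A\<close> is the
          cube of the uniformizer and the numerator has order 4.\<close>
        have "chartYX.s * A + (chartYX.w - const_fun \<theta>) * B = 0" using AB by (simp add: const_fun_simps)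
        moreover have "A = chartYX.s ^ 3" by (simp add: A_def const_fun_simps)
        ultimately have "(chartYX.w - const_fun \<theta>) * B = - (chartYX.s * chartYX.s ^ 3)"
          by (simp add: eq_neg_iff_add_eq_0 add.commute)
        then have "chartYX.w - const_fun \<theta> = - inverse B * (chartYX.s * chartYX.s ^ 3)"
          using B0 by (simp add: field_simps)
        then have "tangent_fun \<eta> = - inverse B * chartYX.s powi 3"
          using nz by (simp add: g e field_simps)
        moreover have "unit_at P (- inverse B)" using B True by (intro unit_at_uminus unit_at_inverse)
        ultimately have "ord_at P (tangent_fun \<eta>) = 3"
          using True unif by (intro ord_at_unique)
        then show ?thesis using e by simp
      qed
      then show ?thesis using True \<theta> by (auto simp: div_of_def P\<theta> flex_pt_eq_iff)
    qed
  qed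
qed

text \<open>The factors are \<open>w - \<phi> s\<close> for the four roots \<open>\<phi>\<close> of
  \<open>\<phi> ^ 4 = -1\<close>, so the product is \<open>w ^ 4 + s ^ 4\<close>, which is
  \<open>-1\<close> on the chart.\<close>

lemma tangent_fun_prod:
  assumes "i ^ 2 = -1" "\<eta> ^ 4 = -1"
  shows "tangent_fun \<eta> * tangent_fun (- \<eta>) * (tangent_fun (i * \<eta>) * tangent_fun (- (i * \<eta>))) = -1"
proof -
  define c where "c = const_fun \<eta>"
  define I where "I = const_fun i"
  have c: "c ^ 4 = -1" "I ^ 2 = -1"
    using assms by (simp_all add: c_def I_def const_fun_simps const_fun_uminus flip: const_fun_power)
  let ?s = chartXY.s and ?w = chartXY.w
  have "tangent_fun \<eta> * tangent_fun (- \<eta>) * (tangent_fun (i * \<eta>) * tangent_fun (- (i * \<eta>))) =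
      (?w ^ 2 - c ^ 2 * ?s ^ 2) * (?w ^ 2 - I ^ 2 * c ^ 2 * ?s ^ 2)"
    by (simp add: tangent_fun_def const_fun_simps const_fun_uminus flip: c_def I_def) (simp add: algebra_simps power2_eq_square)
  also have "\<dots> = ?w ^ 4 - c ^ 4 * ?s ^ 4"
    unfolding c(2) by (simp add: algebra_simps eval_nat_numeral)
  finally show ?thesis unfolding c(1) using chartXY.curve by (simp add: add.commute)
qed

section \<open>Galois action\<close>

lemma poly_map_poly_hom:
  fixes f :: "'a::comm_ring_1 \<Rightarrow> 'b::comm_ring_1"
  assumes "\<And>x y. f (x + y) = f x + f y" "\<And>x y. f (x * y) = f x * f y" "f 0 = 0"
  shows "poly (map_poly f p) (f x) = f (poly p x)"
  by (induction p) (simp_all add: map_poly_pCons assms)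

lemma eval3_map_poly3:
  assumes "\<sigma> \<in> gal UNIV K"
  shows "eval3 (map_poly3 \<sigma> F) (\<sigma> x, \<sigma> y, \<sigma> z) = \<sigma> (eval3 F (x, y, z))"
proof -
  note h = gal_hom[OF assms]
  note h1 = map_poly_hom[of \<sigma>, OF h(1,2,3,4)]
  note h2 = map_poly_hom[of "map_poly \<sigma>", OF h1]
  have 1: "poly (map_poly (map_poly (map_poly \<sigma>)) F) [:[:\<sigma> z:]:] = map_poly (map_poly \<sigma>) (poly F [:[:z:]:])"
    using poly_map_poly_hom[of "map_poly (map_poly \<sigma>)" F "[:[:z:]:]", OF h2(1,2,3)]
    by (simp add: map_poly_pCons h)
  have 2: "poly (map_poly (map_poly \<sigma>) G) [:\<sigma> y:] = map_poly \<sigma> (poly G [:y:])" for G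
    using poly_map_poly_hom[of "map_poly \<sigma>" G "[:y:]", OF h1(1,2,3)] by (simp add: map_poly_pCons h)
  have 3: "poly (map_poly \<sigma> H) (\<sigma> x) = \<sigma> (poly H x)" for H
    by (rule poly_map_poly_hom) (rule h)+
  show ?thesis by (simp add: eval3_def map_poly3_def 1 2 3)
qed

text \<open>Makes everything proved for \<open>G_Q\<close> available for the absolute Galois groups
  of other fields, in particular \<open>Q_zeta8\<close>.\<close>

lemma gal_UNIV_Rats:
  assumes "\<sigma> \<in> gal UNIV K" shows "\<sigma> \<in> G_Q"
proof -
  have "\<sigma> x = x" if "x \<in> \<rat>" for x
    using gal_hom(1,2,4)[OF assms] that by (rule ring_hom_Rats_fixed)
  then show ?thesis using assms by (simp add: gal_def)
qed

lemma gal_comp: "\<sigma> \<in> gal UNIV K \<Longrightarrow> \<tau> \<in> gal UNIV K \<Longrightarrow> \<sigma> \<circ> \<tau> \<in> gal UNIV K"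
  using bij_comp[of \<tau> \<sigma>] by (auto simp: gal_def)

lemma id_in_gal: "id \<in> gal UNIV K"
  by (auto simp: gal_def)

lemma gal_inv_apply:
  assumes "\<sigma> \<in> gal UNIV K"
  shows "\<sigma> (inv_into UNIV \<sigma> x) = x" "inv_into UNIV \<sigma> (\<sigma> x) = x"
    "\<sigma> \<circ> inv_into UNIV \<sigma> = id" "inv_into UNIV \<sigma> \<circ> \<sigma> = id"
  using gal_hom(6)[OF assms] by (auto simp: bij_is_surj surj_f_inv_f bij_is_inj)

lemma gal_power: "\<sigma> \<in> gal UNIV K \<Longrightarrow> \<sigma> (x ^ n) = \<sigma> x ^ n"
  by (induction n) (simp_all add: gal_hom)

lemma gal_eq_0_iff:
  assumes "\<sigma> \<in> gal UNIV K" shows "\<sigma> x = 0 \<longleftrightarrow> x = 0"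
  using gal_hom(3)[OF assms] gal_inv_apply(2)[OF assms] by metis

subsection \<open>Functions\<close>

lemma gal_fun_abs:
  assumes "\<sigma> \<in> G_Q" "form_pair (F, G)"
  shows "gal_fun \<sigma> (abs_ratfun (F, G)) = abs_ratfun (map_poly3 \<sigma> F, map_poly3 \<sigma> G)"
  using assms by (simp add: gal_fun.abs_eq ratfun_rel_self)

lemma form_pair_map:
  assumes "\<sigma> \<in> G_Q" "form_pair (F, G)" shows "form_pair (map_poly3 \<sigma> F, map_poly3 \<sigma> G)"
  using ratfun_rel_map_poly3[OF assms(1), of "(F, G)" "(F, G)"] assms(2) by (simp add: ratfun_rel_self)

lemma map_poly3_vars:
  assumes "\<sigma> \<in> gal UNIV K"
  shows "map_poly3 \<sigma> varX = varX" "map_poly3 \<sigma> varY = varY" "map_poly3 \<sigma> varZ = varZ"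
    "map_poly3 \<sigma> (const3 c) = const3 (\<sigma> c)"
  using gal_hom(3,4)[OF assms]
  by (simp_all add: map_poly3_def varX_def varY_def varZ_def const3_def map_poly_pCons)

lemma gal_fun_hom:
  assumes "\<sigma> \<in> G_Q"
  shows "gal_fun \<sigma> (f + g) = gal_fun \<sigma> f + gal_fun \<sigma> g"
    "gal_fun \<sigma> (f * g) = gal_fun \<sigma> f * gal_fun \<sigma> g"
    "gal_fun \<sigma> (const_fun c) = const_fun (\<sigma> c)"
    "gal_fun \<sigma> chartXY.s = chartXY.s" "gal_fun \<sigma> chartXY.w = chartXY.w"
proof -
  obtain d F G where f: "f = abs_ratfun (F, G)" "form_pair (F, G)" by (rule ratfun_cases)
  obtain d' F' G' where g: "g = abs_ratfun (F', G')" "form_pair (F', G')" by (rule ratfun_cases)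
  note h = map_poly3_hom[OF assms] gal_fun_abs[OF assms] form_pair_map[OF assms] map_poly3_vars[OF assms]
  show "gal_fun \<sigma> (f + g) = gal_fun \<sigma> f + gal_fun \<sigma> g"
    "gal_fun \<sigma> (f * g) = gal_fun \<sigma> f * gal_fun \<sigma> g"
    using f g by (simp_all add: abs_ratfun_add abs_ratfun_mult form_pair_add' form_pair_mult' h)
  show "gal_fun \<sigma> (const_fun c) = const_fun (\<sigma> c)"
    by (simp add: const_fun_eq form_pair_const h)
  show "gal_fun \<sigma> chartXY.s = chartXY.s" "gal_fun \<sigma> chartXY.w = chartXY.w"
    unfolding chartXY.s_def chartXY.w_def
    using form_pair_vars[OF homogeneous_var(1), of varY] form_pair_vars[OF homogeneous_var(3), of varY]
    by (simp_all add: h)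
qed

lemma gal_fun_simps:
  assumes "\<sigma> \<in> G_Q"
  shows "gal_fun \<sigma> 0 = 0" "gal_fun \<sigma> 1 = 1" "gal_fun \<sigma> (- f) = - gal_fun \<sigma> f"
    "gal_fun \<sigma> (f - g) = gal_fun \<sigma> f - gal_fun \<sigma> g"
    "gal_fun \<sigma> (f ^ n) = gal_fun \<sigma> f ^ n" "gal_fun \<sigma> (cpoly a s) = cpoly (map_poly \<sigma> a) (gal_fun \<sigma> s)"
proof -
  note h = gal_fun_hom[OF assms] gal_hom[OF assms]
  show 0: "gal_fun \<sigma> 0 = 0" using h(3)[of 0] by (simp add: const_fun_simps h)
  show 1: "gal_fun \<sigma> 1 = 1" using h(3)[of 1] by (simp add: const_fun_simps h)
  show m: "gal_fun \<sigma> (- f) = - gal_fun \<sigma> f" for f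
    using h(1)[of f "- f"] by (simp add: 0 eq_neg_iff_add_eq_0 add.commute)
  show "gal_fun \<sigma> (f - g) = gal_fun \<sigma> f - gal_fun \<sigma> g"
    using h(1)[of f "- g"] by (simp add: m)
  show "gal_fun \<sigma> (f ^ n) = gal_fun \<sigma> f ^ n" by (induction n) (simp_all add: 1 h)
  show "gal_fun \<sigma> (cpoly a s) = cpoly (map_poly \<sigma> a) (gal_fun \<sigma> s)"
    by (induction a) (simp_all add: 0 h map_poly_pCons)
qed

lemma gal_fun_comp:
  assumes "\<sigma> \<in> G_Q" "\<tau> \<in> G_Q" shows "gal_fun (\<sigma> \<circ> \<tau>) f = gal_fun \<sigma> (gal_fun \<tau> f)"
proof -
  obtain d F G where f: "f = abs_ratfun (F, G)" "form_pair (F, G)" by (rule ratfun_cases)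
  have "map_poly3 (\<sigma> \<circ> \<tau>) F = map_poly3 \<sigma> (map_poly3 \<tau> F)" for F
    by (intro poly_eqI) (simp add: coeff_map_poly3[OF assms(1)] coeff_map_poly3[OF assms(2)]
      coeff_map_poly3[OF gal_comp[OF assms]])
  then show ?thesis using f gal_fun_abs form_pair_map assms gal_comp[OF assms] by simp
qed

lemma gal_fun_id: "gal_fun id f = f"
proof -
  obtain d F G where f: "f = abs_ratfun (F, G)" "form_pair (F, G)" by (rule ratfun_cases)
  have "map_poly3 id F = F" for F
    by (intro poly_eqI) (simp add: coeff_map_poly3[OF id_in_gal])
  then show ?thesis using f gal_fun_abs id_in_gal by simp
qed

lemma gal_fun_inv:
  assumes "\<sigma> \<in> G_Q"
  shows "gal_fun \<sigma> (gal_fun (inv_into UNIV \<sigma>) f) = f" "gal_fun (inv_into UNIV \<sigma>) (gal_fun \<sigma> f) = f"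
  using gal_fun_comp[OF assms gal_inv[OF assms], of f] gal_fun_comp[OF gal_inv[OF assms] assms, of f]
    gal_inv_apply(3,4)[OF assms] gal_fun_id by simp_all

lemma gal_fun_eq_0_iff:
  assumes "\<sigma> \<in> G_Q" shows "gal_fun \<sigma> f = 0 \<longleftrightarrow> f = 0"
  using gal_fun_inv(2)[OF assms, of f] gal_fun_simps(1)[OF assms] gal_fun_simps(1)[OF gal_inv[OF assms]]
  by auto

lemma gal_fun_inverse:
  assumes "\<sigma> \<in> G_Q" shows "gal_fun \<sigma> (inverse f) = inverse (gal_fun \<sigma> f)"
proof (cases "f = 0")
  case False
  then have "gal_fun \<sigma> f * gal_fun \<sigma> (inverse f) = 1"
    by (simp flip: gal_fun_hom(2)[OF assms]) (simp add: gal_fun_simps[OF assms])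
  then show ?thesis by (rule inverse_unique[symmetric])
qed (simp add: gal_fun_simps(1)[OF assms])

lemma gal_fun_divide: "\<sigma> \<in> G_Q \<Longrightarrow> gal_fun \<sigma> (f / g) = gal_fun \<sigma> f / gal_fun \<sigma> g"
  by (simp add: divide_inverse gal_fun_hom gal_fun_inverse)

lemma gal_fun_powi: "\<sigma> \<in> G_Q \<Longrightarrow> gal_fun \<sigma> (f powi n) = gal_fun \<sigma> f powi n"
  by (simp add: power_int_def gal_fun_simps gal_fun_inverse)

lemma gal_fun_tangent_fun: "\<sigma> \<in> G_Q \<Longrightarrow> gal_fun \<sigma> (tangent_fun \<eta>) = tangent_fun (\<sigma> \<eta>)"
  by (simp add: tangent_fun_def gal_fun_simps gal_fun_hom)

text \<open>The chart coordinates are Galois invariant, so the action on \<open>f\<close> is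
  determined by the action on the finitely many coefficients of its chart representation. This is
  continuity of the action on the discrete group of functions.\<close>

lemma gal_fun_locally_constant:
  "\<exists>A. finite A \<and> (\<forall>\<sigma>\<in>G_Q. \<forall>\<tau>\<in>G_Q. (\<forall>x\<in>A. \<tau> x = \<sigma> x) \<longrightarrow> gal_fun \<tau> f = gal_fun \<sigma> f)"
proof -
  obtain r n where f: "r \<in> chart_ring chartXY.s chartXY.w" "f = r / cpoly n chartXY.s"
    using chartXY.frac by blast
  then obtain a0 a1 a2 a3 where r: "r = cubic chartXY.s chartXY.w a0 a1 a2 a3"
    by (auto elim: chartXY.R_cases)
  define A where "A = set (coeffs a0) \<union> set (coeffs a1) \<union> set (coeffs a2) \<union> set (coeffs a3) \<union> set (coeffs n)"
  show ?thesis
  proof (intro exI[of _ A] conjI ballI impI)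
    show "finite A" by (simp add: A_def)
    fix \<sigma> \<tau> assume "\<sigma> \<in> G_Q" "\<tau> \<in> G_Q" "\<forall>x\<in>A. \<tau> x = \<sigma> x"
    moreover from this(3) have "map_poly \<tau> a0 = map_poly \<sigma> a0" "map_poly \<tau> a1 = map_poly \<sigma> a1"
      "map_poly \<tau> a2 = map_poly \<sigma> a2" "map_poly \<tau> a3 = map_poly \<sigma> a3" "map_poly \<tau> n = map_poly \<sigma> n"
      by (auto simp: map_poly_def A_def intro!: arg_cong[where f = Poly])
    ultimately show "gal_fun \<tau> f = gal_fun \<sigma> f"
      by (simp add: f(2) r gal_fun_divide gal_fun_simps gal_fun_hom)
  qed
qed

subsection \<open>Points and divisors\<close>

lemma gal_pt_hpt:
  assumes "\<sigma> \<in> gal UNIV K" shows "gal_pt UNIV \<sigma> (hpt x y z) = hpt (\<sigma> x) (\<sigma> y) (\<sigma> z)"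
proof (intro Set.set_eqI iffI)
  fix v assume "v \<in> gal_pt UNIV \<sigma> (hpt x y z)"
  then obtain c k where "c \<noteq> 0" "k \<noteq> 0" "v = (c * \<sigma> (k * x), c * \<sigma> (k * y), c * \<sigma> (k * z))"
    by (auto simp: gal_pt_def hpt_def)
  then have "v = ((c * \<sigma> k) * \<sigma> x, (c * \<sigma> k) * \<sigma> y, (c * \<sigma> k) * \<sigma> z)" "c * \<sigma> k \<noteq> 0"
    by (simp_all add: gal_hom(2)[OF assms] mult.assoc gal_eq_0_iff[OF assms])
  then show "v \<in> hpt (\<sigma> x) (\<sigma> y) (\<sigma> z)" unfolding hpt_def by blast
next
  fix v assume "v \<in> hpt (\<sigma> x) (\<sigma> y) (\<sigma> z)"
  then obtain c where "c \<noteq> 0" "v = (c * \<sigma> x, c * \<sigma> y, c * \<sigma> z)" by (auto simp: hpt_def)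
  then show "v \<in> gal_pt UNIV \<sigma> (hpt x y z)" using mem_hpt unfolding gal_pt_def by blast
qed

lemma gal_pt_C4:
  assumes "\<sigma> \<in> gal UNIV K" "P \<in> C4" shows "gal_pt UNIV \<sigma> P \<in> C4"
proof -
  obtain x y z where P: "P = hpt x y z" "(x, y, z) \<noteq> (0, 0, 0)" "x ^ 4 + y ^ 4 + z ^ 4 = 0"
    using assms(2) by (rule hpt_cases)
  have "\<sigma> x ^ 4 + \<sigma> y ^ 4 + \<sigma> z ^ 4 = 0"
    using P(3) gal_hom(1,3)[OF assms(1)] gal_power[OF assms(1)] by metis
  then show ?thesis unfolding P(1) gal_pt_hpt[OF assms(1)]
    using P(2) gal_eq_0_iff[OF assms(1)] by (intro hpt_in_C4) auto
qed

lemma gal_pt_comp: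
  assumes "\<sigma> \<in> gal UNIV K" "\<tau> \<in> gal UNIV K" "P \<in> C4"
  shows "gal_pt UNIV (\<sigma> \<circ> \<tau>) P = gal_pt UNIV \<sigma> (gal_pt UNIV \<tau> P)"
  using assms(3) by (rule hpt_cases) (simp add: gal_pt_hpt[OF assms(1)] gal_pt_hpt[OF assms(2)] gal_pt_hpt[OF gal_comp[OF assms(1,2)]])

lemma gal_pt_id: "P \<in> C4 \<Longrightarrow> gal_pt UNIV id P = P"
  by (erule hpt_cases) (simp only: gal_pt_hpt[OF id_in_gal] id_apply)

lemma gal_pt_inv:
  assumes "\<sigma> \<in> gal UNIV K" "P \<in> C4"
  shows "gal_pt UNIV \<sigma> (gal_pt UNIV (inv_into UNIV \<sigma>) P) = P"
    "gal_pt UNIV (inv_into UNIV \<sigma>) (gal_pt UNIV \<sigma> P) = P"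
  using gal_pt_comp[OF assms(1) gal_inv[OF assms(1)] assms(2)] gal_pt_comp[OF gal_inv[OF assms(1)] assms(1,2)]
    gal_inv_apply(3,4)[OF assms(1)] gal_pt_id[OF assms(2)] by simp_all

lemma has_val_gal:
  assumes "\<sigma> \<in> G_Q" "P \<in> C4" "has_val P f c"
  shows "has_val (gal_pt UNIV \<sigma> P) (gal_fun \<sigma> f) (\<sigma> c)"
proof -
  obtain x y z where P: "P = hpt x y z" using assms(2) by (rule hpt_cases)
  obtain F G where F: "form_pair (F, G)" "f = abs_ratfun (F, G)" "eval3 G (x, y, z) \<noteq> 0"
      "eval3 F (x, y, z) = c * eval3 G (x, y, z)"
    using assms(3) mem_hpt unfolding has_val_def P by blast
  show ?thesis
    unfolding P F(2) gal_pt_hpt[OF assms(1)] gal_fun_abs[OF assms(1) F(1)]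
    using F by (intro has_valI form_pair_map assms(1))
      (simp_all add: eval3_map_poly3[OF assms(1)] gal_eq_0_iff[OF assms(1)] gal_hom(2)[OF assms(1)])
qed

lemma unit_at_gal: "\<sigma> \<in> G_Q \<Longrightarrow> P \<in> C4 \<Longrightarrow> unit_at P u \<Longrightarrow> unit_at (gal_pt UNIV \<sigma> P) (gal_fun \<sigma> u)"
  unfolding unit_at_def using has_val_gal gal_eq_0_iff by metis

lemma uniformizerI:
  assumes "P \<in> C4" "t \<noteq> 0" "has_val P t 0" "\<And>f. has_val P f 0 \<Longrightarrow> \<exists>g. regular P g \<and> f = t * g"
  shows "uniformizer P t"
proof -
  have "{f. has_val P f 0} = (\<lambda>g. t * g) ` {g. regular P g}"
    using assms(4) max_ideal_ideal[OF assms(3)] by blast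
  moreover have "local_ring P = {g. regular P g}" using local_ring_regular[OF assms(1)] by blast
  ultimately show ?thesis
    using assms(2) by (simp add: uniformizer_def max_ideal_eq)
qed

lemma uniformizer_gal:
  assumes s: "\<sigma> \<in> G_Q" and P: "P \<in> C4" and t: "uniformizer P t"
  shows "uniformizer (gal_pt UNIV \<sigma> P) (gal_fun \<sigma> t)"
proof (rule uniformizerI)
  note t = uniformizerD[OF t P]
  show "gal_pt UNIV \<sigma> P \<in> C4" using gal_pt_C4[OF s P] .
  show "gal_fun \<sigma> t \<noteq> 0" using t s by (simp add: gal_fun_eq_0_iff)
  show "has_val (gal_pt UNIV \<sigma> P) (gal_fun \<sigma> t) 0"
    using has_val_gal[OF s P t(2)] gal_hom(3)[OF s] by simp
  fix f assume "has_val (gal_pt UNIV \<sigma> P) f 0"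
  from has_val_gal[OF gal_inv[OF s] gal_pt_C4[OF s P] this]
  have "has_val P (gal_fun (inv_into UNIV \<sigma>) f) 0"
    using gal_pt_inv(2)[OF s P] gal_hom(3)[OF gal_inv[OF s]] by simp
  then obtain g where g: "regular P g" "gal_fun (inv_into UNIV \<sigma>) f = t * g" using t(3) by blast
  then have "f = gal_fun \<sigma> t * gal_fun \<sigma> g"
    by (metis gal_fun_hom(2)[OF s] gal_fun_inv(1)[OF s])
  moreover have "regular (gal_pt UNIV \<sigma> P) (gal_fun \<sigma> g)"
    using g(1) has_val_gal[OF s P] unfolding regular_def by blast
  ultimately show "\<exists>g. regular (gal_pt UNIV \<sigma> P) g \<and> f = gal_fun \<sigma> t * g" by blast
qed

text \<open>Conjugation carries uniformizers to uniformizers and units to units, hence also the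
  decomposition that determines the order.\<close>

lemma ord_at_gal:
  assumes "\<sigma> \<in> G_Q" "P \<in> C4" "f \<noteq> 0"
  shows "ord_at (gal_pt UNIV \<sigma> P) (gal_fun \<sigma> f) = ord_at P f"
proof -
  obtain t u where t: "uniformizer P t" "unit_at P u" "f = u * t powi ord_at P f"
    using ord_at_decomp[OF assms(2,3)] .
  have "gal_fun \<sigma> f = gal_fun \<sigma> u * gal_fun \<sigma> t powi ord_at P f"
    by (subst t(3)) (simp add: gal_fun_hom[OF assms(1)] gal_fun_powi[OF assms(1)])
  then show ?thesis
    using gal_pt_C4 uniformizer_gal unit_at_gal assms t by (intro ord_at_unique)
qed

text \<open>As \<open>\<sigma>\<close> permutes the points of the curve, the sum defining
  \<open>gal_div\<close> has at most one term.\<close>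

lemma gal_div_eq:
  assumes "\<sigma> \<in> gal UNIV K" "{P. D P \<noteq> 0} \<subseteq> C4"
  shows "gal_div UNIV \<sigma> D Q = (if Q \<in> C4 then D (gal_pt UNIV (inv_into UNIV \<sigma>) Q) else 0)"
proof -
  have "{P. D P \<noteq> 0 \<and> gal_pt UNIV \<sigma> P = Q} =
      (if Q \<in> C4 \<and> D (gal_pt UNIV (inv_into UNIV \<sigma>) Q) \<noteq> 0 then {gal_pt UNIV (inv_into UNIV \<sigma>) Q} else {})"
    using assms(2) gal_pt_inv[OF assms(1)] gal_pt_C4[OF assms(1)] gal_pt_C4[OF gal_inv[OF assms(1)]]
    by auto
  then show ?thesis by (simp add: gal_div_def)
qed

lemma div_of_supp: "{P. div_of f P \<noteq> 0} \<subseteq> C4"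
  by (auto simp: div_of_def)

lemma gal_div_div_of:
  assumes "\<sigma> \<in> G_Q" "f \<noteq> 0" shows "gal_div UNIV \<sigma> (div_of f) Q = div_of (gal_fun \<sigma> f) Q"
proof (cases "Q \<in> C4")
  case True
  note Q = gal_pt_C4[OF gal_inv[OF assms(1)] True]
  show ?thesis
    using ord_at_gal[OF assms(1) Q assms(2)] gal_pt_inv(1)[OF assms(1) True] Q True
    by (simp add: gal_div_eq[OF assms(1) div_of_supp]) (simp add: div_of_def)
qed (simp add: gal_div_eq[OF assms(1) div_of_supp], simp add: div_of_def)

lemma DivD: "D \<in> Div \<Longrightarrow> {P. D P \<noteq> 0} \<subseteq> C4" "D \<in> Div \<Longrightarrow> finite {P. D P \<noteq> 0}"
  "D \<in> Div \<Longrightarrow> P \<notin> C4 \<Longrightarrow> D P = 0"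
  by (auto simp: Div_def)

lemma gal_div_Div:
  assumes "\<sigma> \<in> gal UNIV K" "D \<in> Div" shows "gal_div UNIV \<sigma> D \<in> Div"
proof -
  note e = gal_div_eq[OF assms(1) DivD(1)[OF assms(2)]]
  have "{Q. gal_div UNIV \<sigma> D Q \<noteq> 0} \<subseteq> gal_pt UNIV \<sigma> ` {P. D P \<noteq> 0}"
  proof
    fix Q assume "Q \<in> {Q. gal_div UNIV \<sigma> D Q \<noteq> 0}"
    then have "Q \<in> C4" "D (gal_pt UNIV (inv_into UNIV \<sigma>) Q) \<noteq> 0" by (auto simp: e split: if_splits)
    then show "Q \<in> gal_pt UNIV \<sigma> ` {P. D P \<noteq> 0}"
      using gal_pt_inv(1)[OF assms(1), of Q] by (metis (mono_tags) imageI mem_Collect_eq)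
  qed
  then have "finite {Q. gal_div UNIV \<sigma> D Q \<noteq> 0}"
    using DivD(2)[OF assms(2)] finite_subset by blast
  then show ?thesis by (auto simp: Div_def e split: if_splits)
qed

lemma gal_div_inv:
  assumes "\<sigma> \<in> gal UNIV K" "D \<in> Div"
  shows "gal_div UNIV \<sigma> (gal_div UNIV (inv_into UNIV \<sigma>) D) = D"
proof
  fix Q
  note e = gal_div_eq[OF gal_inv[OF assms(1)] DivD(1)[OF assms(2)]]
  have "inv_into UNIV (inv_into UNIV \<sigma>) = \<sigma>"
    using gal_hom(6)[OF assms(1)] by (rule inv_inv_eq)
  then show "gal_div UNIV \<sigma> (gal_div UNIV (inv_into UNIV \<sigma>) D) Q = D Q"
    using gal_pt_inv[OF assms(1)] gal_pt_C4[OF gal_inv[OF assms(1)], of Q] DivD(3)[OF assms(2), of Q]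
    by (auto simp: gal_div_eq[OF assms(1) DivD(1)[OF gal_div_Div[OF gal_inv[OF assms(1)] assms(2)]]] e)
qed

section \<open>Linear equivalence under the Galois action\<close>

lemma lin_equiv_gal:
  assumes "\<sigma> \<in> G_Q" "D \<in> Div" "D' \<in> Div" "f \<noteq> 0" "\<And>P. D P - D' P = div_of f P"
  shows "gal_div UNIV \<sigma> D P - gal_div UNIV \<sigma> D' P = div_of (gal_fun \<sigma> f) P"
  unfolding gal_div_div_of[OF assms(1,4), symmetric]
  by (simp add: gal_div_eq[OF assms(1) DivD(1)[OF assms(2)]] gal_div_eq[OF assms(1) DivD(1)[OF assms(3)]]
      gal_div_eq[OF assms(1) div_of_supp] flip: assms(5))

lemma lin_equiv_refl: "lin_equiv D D"
  unfolding lin_equiv_def using div_of_const[of 1]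
  by (intro exI[of _ 1]) (simp add: const_fun_simps)

lemma lin_equiv_sym: "lin_equiv D D' \<Longrightarrow> lin_equiv D' D"
proof -
  assume "lin_equiv D D'"
  then obtain f where f: "f \<noteq> 0" "\<And>P. D P - D' P = div_of f P" by (auto simp: lin_equiv_def)
  have "D' P - D P = div_of (inverse f) P" for P
    using f(2)[of P] div_of_inverse[OF f(1), of P] by simp
  then show ?thesis unfolding lin_equiv_def using f(1) by (intro exI[of _ "inverse f"]) simp
qed

lemma lin_equiv_trans: "lin_equiv D D' \<Longrightarrow> lin_equiv D' D'' \<Longrightarrow> lin_equiv D D''"
proof -
  assume "lin_equiv D D'" "lin_equiv D' D''"
  then obtain f g where f: "f \<noteq> 0" "\<And>P. D P - D' P = div_of f P"
    and g: "g \<noteq> 0" "\<And>P. D' P - D'' P = div_of g P" by (auto simp: lin_equiv_def)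
  have "D P - D'' P = div_of (f * g) P" for P
    using f(2)[of P] g(2)[of P] div_of_mult[OF f(1) g(1), of P] by simp
  then show ?thesis unfolding lin_equiv_def using f(1) g(1) by (intro exI[of _ "f * g"]) simp
qed

lemma div_class_eqI: "lin_equiv D D' \<Longrightarrow> div_class D = div_class D'"
  unfolding div_class_def using lin_equiv_trans lin_equiv_sym by blast

lemma gal_div_class_subset:
  assumes "\<sigma> \<in> G_Q" "D \<in> Div" "lin_equiv (gal_div UNIV \<sigma> D) D"
  shows "gal_div UNIV \<sigma> ` div_class D \<subseteq> div_class D"
proof
  fix D2 assume "D2 \<in> gal_div UNIV \<sigma> ` div_class D"
  then obtain D1 where D1: "D1 \<in> Div" "lin_equiv D1 D" "D2 = gal_div UNIV \<sigma> D1" by (auto simp: div_class_def)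
  then obtain f where f: "f \<noteq> 0" "\<And>P. D1 P - D P = div_of f P" by (auto simp: lin_equiv_def)
  have "lin_equiv D2 (gal_div UNIV \<sigma> D)"
    unfolding lin_equiv_def D1(3) using lin_equiv_gal[OF assms(1) D1(1) assms(2) f] f(1)
    by (intro exI[of _ "gal_fun \<sigma> f"]) (simp add: gal_fun_eq_0_iff[OF assms(1)])
  then show "D2 \<in> div_class D"
    using lin_equiv_trans[OF _ assms(3)] gal_div_Div[OF assms(1) D1(1)] by (simp add: div_class_def D1(3))
qed

text \<open>One inclusion for \<open>\<sigma>\<close> and the same inclusion for its inverse give
  equality.\<close>

lemma gal_div_class:
  assumes "\<And>\<sigma>. \<sigma> \<in> G_Q \<Longrightarrow> lin_equiv (gal_div UNIV \<sigma> D) D" "D \<in> Div" "\<sigma> \<in> G_Q"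
  shows "gal_div UNIV \<sigma> ` div_class D = div_class D"
proof
  show "gal_div UNIV \<sigma> ` div_class D \<subseteq> div_class D" using gal_div_class_subset assms by blast
  show "div_class D \<subseteq> gal_div UNIV \<sigma> ` div_class D"
  proof
    fix D1 assume D1: "D1 \<in> div_class D"
    then have "gal_div UNIV (inv_into UNIV \<sigma>) D1 \<in> div_class D"
      using gal_div_class_subset[OF gal_inv[OF assms(3)] assms(2) assms(1)[OF gal_inv[OF assms(3)]]] by blast
    moreover have "D1 = gal_div UNIV \<sigma> (gal_div UNIV (inv_into UNIV \<sigma>) D1)"
      using gal_div_inv[OF assms(3)] D1 by (simp add: div_class_def)
    ultimately show "D1 \<in> gal_div UNIV \<sigma> ` div_class D" by blast
  qed
qed

section \<open>The divisor \<open>E\<close> and its conjugates\<close>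

text \<open>The conjugates of \<open>E\<close>: it is itself of this form since
  \<open>zeta8 ^ 7 = - (zeta8 ^ 3)\<close>, and an automorphism acts only on
  \<open>\<eta>\<close>.\<close>

definition Ediv :: "qbar \<Rightarrow> divisor" where
  "Ediv \<eta> = (\<lambda>P. 2 * of_bool (P = flex_pt \<eta>) - 2 * of_bool (P = flex_pt (- \<eta>)))"

lemma divisor_E_eq: "divisor_E = Ediv (zeta8 ^ 3)"
proof -
  have "zeta8 ^ 7 = zeta8 ^ 4 * zeta8 ^ 3" by (simp flip: power_add)
  then show ?thesis unfolding divisor_E_def Ediv_def flex_pt_def by (simp add: zeta8_pow4)
qed

lemma zeta8_3_pow4: "(zeta8 ^ 3) ^ 4 = -1"
proof -
  have "(zeta8 ^ 3) ^ 4 = (zeta8 ^ 4) ^ 3" by (simp flip: power_mult)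
  then show ?thesis by (simp add: zeta8_pow4)
qed

lemma neg_neq_self: "\<eta> ^ 4 = -1 \<Longrightarrow> - \<eta> \<noteq> (\<eta>::qbar)"
proof
  assume "\<eta> ^ 4 = -1" "- \<eta> = \<eta>"
  then have "2 * \<eta> = 0" by (metis add.right_inverse mult_2)
  then have "\<eta> = 0" by simp
  with \<open>\<eta> ^ 4 = -1\<close> show False by simp
qed

text \<open>The squares are square roots of \<open>-1\<close>, of which there are two. Under the
  hypotheses \<open>\<theta> ^ 2\<close> and \<open>\<eta> ^ 2\<close> are both of them.\<close>

lemma fourth_roots:
  fixes \<theta> :: qbar
  assumes "\<theta> ^ 4 = -1" "\<eta> ^ 4 = -1" "\<eta> \<noteq> \<theta>" "\<eta> \<noteq> - \<theta>" "\<phi> ^ 4 = -1"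
  shows "\<phi> = \<theta> \<or> \<phi> = - \<theta> \<or> \<phi> = \<eta> \<or> \<phi> = - \<eta>"
proof -
  have sq: "(a ^ 2 - b ^ 2) * (a ^ 2 + b ^ 2) = a ^ 4 - b ^ 4" for a b :: qbar
    by (simp add: algebra_simps eval_nat_numeral)
  have "(\<eta> ^ 2 - \<theta> ^ 2) * (\<eta> ^ 2 + \<theta> ^ 2) = 0" "(\<phi> ^ 2 - \<theta> ^ 2) * (\<phi> ^ 2 + \<theta> ^ 2) = 0"
    unfolding sq using assms by simp_all
  moreover have "\<eta> ^ 2 \<noteq> \<theta> ^ 2" using assms(3,4) by (simp add: power2_eq_iff)
  ultimately have "\<eta> ^ 2 = - (\<theta> ^ 2)" "\<phi> ^ 2 = \<theta> ^ 2 \<or> \<phi> ^ 2 = - (\<theta> ^ 2)"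
    by (auto simp: eq_neg_iff_add_eq_0)
  then have "\<phi> ^ 2 = \<theta> ^ 2 \<or> \<phi> ^ 2 = \<eta> ^ 2" by simp
  then show ?thesis by (auto simp: power2_eq_iff)
qed

text \<open>A function with divisor \<open>Ediv \<eta> - Ediv \<theta>\<close>, read off from the divisors
  \<open>4 flex_pt \<eta> - \<Sum>\<^sub>\<phi> flex_pt \<phi>\<close> of the tangent functions.\<close>

definition conj_fun :: "qbar \<Rightarrow> qbar \<Rightarrow> ratfun" where
  "conj_fun \<theta> \<eta> = (if \<eta> = \<theta> then 1 else if \<eta> = - \<theta> then tangent_fun (- \<theta>) / tangent_fun \<theta>
    else inverse (tangent_fun \<theta> * tangent_fun (- \<eta>)))"

lemma conj_fun:
  assumes "\<theta> ^ 4 = -1" "\<eta> ^ 4 = -1"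
  shows "conj_fun \<theta> \<eta> \<noteq> 0" "div_of (conj_fun \<theta> \<eta>) P = Ediv \<eta> P - Ediv \<theta> P"
proof -
  have m: "(- \<theta>) ^ 4 = -1" "(- \<eta>) ^ 4 = -1" using assms by simp_all
  note g = div_of_tangent_fun[OF assms(1)] div_of_tangent_fun[OF m(1)] div_of_tangent_fun[OF assms(2)] div_of_tangent_fun[OF m(2)]
  show "conj_fun \<theta> \<eta> \<noteq> 0" using g by (simp add: conj_fun_def)
  consider "\<eta> = \<theta>" | "\<eta> \<noteq> \<theta>" "\<eta> = - \<theta>" | "\<eta> \<noteq> \<theta>" "\<eta> \<noteq> - \<theta>" by blast
  then show "div_of (conj_fun \<theta> \<eta>) P = Ediv \<eta> P - Ediv \<theta> P"
  proof cases
    case 1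
    then show ?thesis using div_of_const[of 1 P] by (simp add: conj_fun_def const_fun_simps)
  next
    case 2
    then have "div_of (conj_fun \<theta> \<eta>) P = 4 * of_bool (P = flex_pt (- \<theta>)) - 4 * of_bool (P = flex_pt \<theta>)"
      using g by (simp add: conj_fun_def div_of_divide)
    then show ?thesis by (simp add: Ediv_def 2(2))
  next
    case 3
    have d: "\<theta> \<noteq> - \<theta>" "\<eta> \<noteq> - \<eta>" "- \<theta> \<noteq> \<eta>" "\<theta> \<noteq> - \<eta>"
      using neg_neq_self assms 3 by (metis, metis, metis, metis minus_minus)
    have S: "(\<exists>\<phi>. \<phi> ^ 4 = -1 \<and> P = flex_pt \<phi>) \<longleftrightarrow> P = flex_pt \<theta> \<or> P = flex_pt (- \<theta>) \<or> P = flex_pt \<eta> \<or> P = flex_pt (- \<eta>)"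
      using fourth_roots[OF assms 3] assms m by blast
    \<comment> \<open>Each inverse tangent function contributes the section \<open>Y = 0\<close>
      with coefficient 1. Adding 2 at all four points to -4 at two of them leaves -2 there and 2 at
      the others, which is the difference of the two conjugates.\<close>
    have "div_of (conj_fun \<theta> \<eta>) P = - (4 * of_bool (P = flex_pt \<theta>)) - 4 * of_bool (P = flex_pt (- \<eta>)) +
        2 * of_bool (P = flex_pt \<theta> \<or> P = flex_pt (- \<theta>) \<or> P = flex_pt \<eta> \<or> P = flex_pt (- \<eta>))"
      using g 3 by (simp add: conj_fun_def div_of_inverse div_of_mult S)
    also have "\<dots> = Ediv \<eta> P - Ediv \<theta> P"
      using d 3 by (auto simp: Ediv_def flex_pt_eq_iff)
    finally show ?thesis .
  qed
qed

section \<open>Degree and Galois conjugates of \<open>E\<close>\<close>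

lemma Ediv_supp: "\<eta> ^ 4 = -1 \<Longrightarrow> {P. Ediv \<eta> P \<noteq> 0} = {flex_pt \<eta>, flex_pt (- \<eta>)}"
  using neg_neq_self[of \<eta>] by (auto simp: Ediv_def flex_pt_eq_iff split: if_splits)

lemma Ediv_Div: "\<eta> ^ 4 = -1 \<Longrightarrow> Ediv \<eta> \<in> Div"
  using flex_pt_in_C4[of \<eta>] flex_pt_in_C4[of "- \<eta>"] by (auto simp: Div_def Ediv_supp)

lemma Ediv_degree:
  assumes "\<eta> ^ 4 = -1" shows "div_degree (Ediv \<eta>) = 0"
proof -
  have "flex_pt \<eta> \<noteq> flex_pt (- \<eta>)" using neg_neq_self[OF assms] by (metis flex_pt_eq_iff)
  then show ?thesis unfolding div_degree_def Ediv_supp[OF assms] by (simp add: Ediv_def)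
qed

text \<open>Stated for a general \<open>L\<close> to cover both \<open>UNIV\<close> and
  \<open>Q_zeta8\<close>. The first coordinate of the point is 1, so every scalar giving coordinates
  in \<open>L\<close> lies in \<open>L\<close>, where \<open>\<sigma>\<close> is
  multiplicative.\<close>

lemma gal_pt_flex_pt:
  assumes "\<sigma> 0 = 0" "\<sigma> 1 = 1" "\<And>x y. x \<in> L \<Longrightarrow> y \<in> L \<Longrightarrow> \<sigma> (x * y) = \<sigma> x * \<sigma> y"
    and "\<And>x. x \<in> L \<Longrightarrow> x \<noteq> 0 \<Longrightarrow> \<sigma> x \<noteq> 0" and "0 \<in> L" "1 \<in> L" "\<eta> \<in> L"
  shows "gal_pt L \<sigma> (flex_pt \<eta>) = flex_pt (\<sigma> \<eta>)"
proof (intro Set.set_eqI iffI)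
  fix v assume "v \<in> gal_pt L \<sigma> (flex_pt \<eta>)"
  then obtain c k where *: "c \<noteq> 0" "k \<noteq> 0" "k \<in> L" "v = (c * \<sigma> k, c * \<sigma> 0, c * \<sigma> (k * \<eta>))"
    by (auto simp: gal_pt_def flex_pt_def hpt_def)
  then have "v = ((c * \<sigma> k) * 1, (c * \<sigma> k) * 0, (c * \<sigma> k) * \<sigma> \<eta>)" "c * \<sigma> k \<noteq> 0"
    using assms by simp_all
  then show "v \<in> flex_pt (\<sigma> \<eta>)" unfolding flex_pt_def hpt_def by blast
next
  fix v assume "v \<in> flex_pt (\<sigma> \<eta>)"
  then obtain c where "c \<noteq> 0" "v = (c * \<sigma> 1, c * \<sigma> 0, c * \<sigma> \<eta>)" using assms(1,2) by (auto simp: flex_pt_def hpt_def)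
  moreover have "(1, 0, \<eta>) \<in> flex_pt \<eta>" unfolding flex_pt_def by (rule mem_hpt)
  ultimately show "v \<in> gal_pt L \<sigma> (flex_pt \<eta>)" using assms(5-7) unfolding gal_pt_def by blast
qed

lemma is_subfield_UNIV: "is_subfield UNIV"
  by (simp add: is_subfield_def)

lemma gal_facts:
  assumes "\<sigma> \<in> gal L K" "is_subfield L"
  shows "\<sigma> 0 = 0" "\<sigma> 1 = 1" "x \<in> L \<Longrightarrow> \<sigma> (- x) = - \<sigma> x" "x \<in> L \<Longrightarrow> x \<noteq> 0 \<Longrightarrow> \<sigma> x \<noteq> 0"
    "x \<in> L \<Longrightarrow> y \<in> L \<Longrightarrow> \<sigma> (x * y) = \<sigma> x * \<sigma> y" "x \<in> L \<Longrightarrow> \<sigma> (x ^ n) = \<sigma> x ^ n" "x \<in> L \<Longrightarrow> x ^ n \<in> L"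
proof -
  have L: "0 \<in> L" "1 \<in> L" "x \<in> L \<Longrightarrow> - x \<in> L" "x \<in> L \<Longrightarrow> y \<in> L \<Longrightarrow> x * y \<in> L" for x y
    using assms(2) by (auto simp: is_subfield_def)
  have h: "\<sigma> (x + y) = \<sigma> x + \<sigma> y" "\<sigma> (x * y) = \<sigma> x * \<sigma> y" if "x \<in> L" "y \<in> L" for x y
    using assms(1) that by (auto simp: gal_def)
  have inj: "inj_on \<sigma> L" using assms(1) by (auto simp: gal_def bij_betw_def)
  show 0: "\<sigma> 0 = 0" using h(1)[OF L(1,1)] by simp
  show nz: "\<sigma> x \<noteq> 0" if "x \<in> L" "x \<noteq> 0" for x
    using inj_onD[OF inj, of x 0] that 0 L(1) by auto
  show 1: "\<sigma> 1 = 1" using h(2)[OF L(2,2)] nz[OF L(2)] by simp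
  show "\<sigma> (- x) = - \<sigma> x" if "x \<in> L" for x
    using h(1)[OF that L(3)[OF that]] by (simp add: 0 eq_neg_iff_add_eq_0 add.commute)
  show "x \<in> L \<Longrightarrow> y \<in> L \<Longrightarrow> \<sigma> (x * y) = \<sigma> x * \<sigma> y" by (rule h)
  show pw: "x ^ n \<in> L" if "x \<in> L" for x n using that by (induction n) (auto intro: L)
  show "\<sigma> (x ^ n) = \<sigma> x ^ n" if "x \<in> L" for x n
    using that by (induction n) (auto simp: 1 h pw)
qed

lemma gal_div_Ediv:
  assumes "\<sigma> \<in> gal L K" "is_subfield L" "\<eta> \<in> L" "\<eta> ^ 4 = -1"
  shows "gal_div L \<sigma> (Ediv \<eta>) = Ediv (\<sigma> \<eta>)" "(\<sigma> \<eta>) ^ 4 = -1"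
proof -
  have L: "0 \<in> L" "1 \<in> L" "- \<eta> \<in> L" "-1 \<in> L" using assms(2,3) by (auto simp: is_subfield_def)
  note g = gal_facts[OF assms(1,2)]
  have p: "gal_pt L \<sigma> (flex_pt \<eta>) = flex_pt (\<sigma> \<eta>)" "gal_pt L \<sigma> (flex_pt (- \<eta>)) = flex_pt (- \<sigma> \<eta>)"
    using gal_pt_flex_pt[of \<sigma> L \<eta>] gal_pt_flex_pt[of \<sigma> L "- \<eta>"] L g assms(3) by simp_all
  have "(\<sigma> \<eta>) ^ 4 = \<sigma> (\<eta> ^ 4)" using g(6)[OF assms(3)] by simp
  then show e4: "(\<sigma> \<eta>) ^ 4 = -1" using assms(4) g(3)[OF L(2)] g(2) by simp
  have ne: "flex_pt \<eta> \<noteq> flex_pt (- \<eta>)" "flex_pt (\<sigma> \<eta>) \<noteq> flex_pt (- \<sigma> \<eta>)"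
    using neg_neq_self[OF e4] neg_neq_self[OF assms(4)] by (simp_all add: flex_pt_eq_iff)
  show "gal_div L \<sigma> (Ediv \<eta>) = Ediv (\<sigma> \<eta>)"
  proof
    fix Q
    have "{P. Ediv \<eta> P \<noteq> 0 \<and> gal_pt L \<sigma> P = Q} = {P \<in> {flex_pt \<eta>, flex_pt (- \<eta>)}. gal_pt L \<sigma> P = Q}"
      using Ediv_supp[OF assms(4)] by blast
    then have "gal_div L \<sigma> (Ediv \<eta>) Q = sum (Ediv \<eta>) {P \<in> {flex_pt \<eta>, flex_pt (- \<eta>)}. gal_pt L \<sigma> P = Q}"
      by (simp add: gal_div_def)
    also have "\<dots> = (\<Sum>P\<in>{flex_pt \<eta>, flex_pt (- \<eta>)}. if gal_pt L \<sigma> P = Q then Ediv \<eta> P else 0)"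
      by (rule sum.inter_filter) simp
    also have "\<dots> = Ediv (\<sigma> \<eta>) Q"
      using ne by (auto simp: p Ediv_def)
    finally show "gal_div L \<sigma> (Ediv \<eta>) Q = Ediv (\<sigma> \<eta>) Q" .
  qed
qed

lemma Q_zeta8: "is_subfield Q_zeta8" "zeta8 \<in> Q_zeta8" "\<rat> \<subseteq> Q_zeta8"
proof -
  show sf: "is_subfield Q_zeta8" unfolding Q_zeta8_def hull_def by (auto simp: is_subfield_def)
  show "zeta8 \<in> Q_zeta8" unfolding Q_zeta8_def by (rule hull_inc) simp
  show "\<rat> \<subseteq> Q_zeta8"
  proof
    fix x :: qbar assume "x \<in> \<rat>"
    then obtain a b where x: "b > 0" "x = of_int a / of_int b" by (metis Rats_cases')
    have c: "0 \<in> Q_zeta8" "1 \<in> Q_zeta8" "x \<in> Q_zeta8 \<Longrightarrow> y \<in> Q_zeta8 \<Longrightarrow> x + y \<in> Q_zeta8"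
      "x \<in> Q_zeta8 \<Longrightarrow> y \<in> Q_zeta8 \<Longrightarrow> x * y \<in> Q_zeta8"
      "x \<in> Q_zeta8 \<Longrightarrow> - x \<in> Q_zeta8" "x \<in> Q_zeta8 \<Longrightarrow> inverse x \<in> Q_zeta8" for x y
      using sf by (auto simp: is_subfield_def)
    have n: "of_nat n \<in> Q_zeta8" for n by (induction n) (simp_all add: c)
    have i: "of_int k \<in> Q_zeta8" for k by (cases k rule: int_cases2) (simp_all add: c n)
    show "x \<in> Q_zeta8" unfolding x(2) divide_inverse by (intro c i)
  qed
qed

lemma lin_equiv_Ediv: "\<theta> ^ 4 = -1 \<Longrightarrow> \<eta> ^ 4 = -1 \<Longrightarrow> lin_equiv (Ediv \<eta>) (Ediv \<theta>)"
  unfolding lin_equiv_def using conj_fun by metis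

lemma divisor_E_Jac:
  "divisor_E \<in> Div_over Q_zeta8" "div_class divisor_E \<in> Jac Q_zeta8"
  "\<sigma> \<in> gal Q_zeta8 \<rat> \<Longrightarrow> div_class (gal_div Q_zeta8 \<sigma> divisor_E) = div_class divisor_E"
  "div_class divisor_E \<in> Jac \<rat>"
proof -
  have Q: "zeta8 ^ 3 \<in> Q_zeta8" using gal_facts(7)[OF id_in_gal is_subfield_UNIV] Q_zeta8(1,2)
    by (simp add: is_subfield_def power3_eq_cube)
  note gd = gal_div_Ediv[OF _ is_subfield_UNIV UNIV_I zeta8_3_pow4, folded divisor_E_eq]
  note E = Ediv_Div[OF zeta8_3_pow4, folded divisor_E_eq]
  have "gal_div UNIV \<sigma> divisor_E = divisor_E" if "\<sigma> \<in> gal UNIV Q_zeta8" for \<sigma>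
  proof -
    have "\<sigma> (zeta8 ^ 3) = zeta8 ^ 3" using that Q by (auto simp: gal_def)
    then show ?thesis using gd(1)[OF that] by (simp add: divisor_E_eq)
  qed
  then show "divisor_E \<in> Div_over Q_zeta8" using E by (simp add: Div_over_def)
  have inv: "lin_equiv (gal_div UNIV \<sigma> divisor_E) divisor_E" if "\<sigma> \<in> G_Q" for \<sigma>
    using lin_equiv_Ediv[OF zeta8_3_pow4 gd(2)[OF that]] gd(1)[OF that] by (simp add: divisor_E_eq)
  \<comment> \<open>Invariance under all of \<open>G_Q\<close> gives rationality over every field at
    once, both over \<open>Q_zeta8\<close> and over the rationals.\<close>
  have J: "div_class divisor_E \<in> Jac K" for K
    using gal_div_class[OF inv E gal_UNIV_Rats] E Ediv_degree[OF zeta8_3_pow4, folded divisor_E_eq]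
    unfolding Jac_def by blast
  show "div_class divisor_E \<in> Jac Q_zeta8" "div_class divisor_E \<in> Jac \<rat>" by (rule J)+
  show "div_class (gal_div Q_zeta8 \<sigma> divisor_E) = div_class divisor_E" if "\<sigma> \<in> gal Q_zeta8 \<rat>"
    unfolding divisor_E_eq gal_div_Ediv(1)[OF that Q_zeta8(1) Q zeta8_3_pow4]
    by (rule div_class_eqI[OF lin_equiv_Ediv[OF zeta8_3_pow4 gal_div_Ediv(2)[OF that Q_zeta8(1) Q zeta8_3_pow4]]])
qed

section \<open>Continuous cochains\<close>

abbreviation "G_Q2 \<equiv> G_Q \<times> G_Q"

text \<open>For finite \<open>A\<close> these conditions describe the basic Krull neighbourhoods of
  \<open>\<sigma>\<close>.\<close>

definition agree :: "qbar set \<Rightarrow> (qbar \<Rightarrow> qbar) \<Rightarrow> (qbar \<Rightarrow> qbar) \<Rightarrow> bool" where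
  "agree A \<sigma> \<tau> \<longleftrightarrow> (\<forall>x\<in>A. \<tau> x = \<sigma> x)"

lemma agree_Un: "agree (A \<union> B) \<sigma> \<tau> \<longleftrightarrow> agree A \<sigma> \<tau> \<and> agree B \<sigma> \<tau>"
  by (auto simp: agree_def)

lemma topspace_krull: "topspace krull = G_Q"
  by (auto simp: krull_def)

text \<open>A basic open set of the product topology restricts only finitely many coordinates, here
  finitely many algebraic numbers.\<close>

lemma openin_krull_iff:
  "openin krull U \<longleftrightarrow> U \<subseteq> G_Q \<and> (\<forall>\<sigma>\<in>U. \<exists>A. finite A \<and> (\<forall>\<tau>\<in>G_Q. agree A \<sigma> \<tau> \<longrightarrow> \<tau> \<in> U))"
proof (intro iffI conjI ballI)
  assume U: "openin krull U"
  then obtain T where T: "openin (product_topology (\<lambda>_. discrete_topology UNIV) UNIV) T" "U = T \<inter> G_Q"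
    by (auto simp: krull_def openin_subtopology)
  then show "U \<subseteq> G_Q" by blast
  fix \<sigma> assume \<sigma>: "\<sigma> \<in> U"
  then obtain N where N: "\<sigma> \<in> PiE UNIV N" "finite {i. N i \<noteq> topspace (discrete_topology UNIV)}" "PiE UNIV N \<subseteq> T"
    using product_topology_open_contains_basis[OF T(1), of \<sigma>] T(2) by auto
  show "\<exists>A. finite A \<and> (\<forall>\<tau>\<in>G_Q. agree A \<sigma> \<tau> \<longrightarrow> \<tau> \<in> U)"
  proof (intro exI conjI ballI impI)
    show "finite {i. N i \<noteq> UNIV}" using N(2) by simp
    fix \<tau> assume \<tau>: "\<tau> \<in> G_Q" "agree {i. N i \<noteq> UNIV} \<sigma> \<tau>"
    have "\<tau> i \<in> N i" for i
      using \<tau>(2) N(1) by (cases "N i = UNIV") (auto simp: agree_def PiE_iff)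
    then show "\<tau> \<in> U" using N(3) T(2) \<tau>(1) by (auto simp: PiE_iff)
  qed
next
  assume U: "U \<subseteq> G_Q \<and> (\<forall>\<sigma>\<in>U. \<exists>A. finite A \<and> (\<forall>\<tau>\<in>G_Q. agree A \<sigma> \<tau> \<longrightarrow> \<tau> \<in> U))"
  have "\<exists>T. openin krull T \<and> \<sigma> \<in> T \<and> T \<subseteq> U" if \<sigma>: "\<sigma> \<in> U" for \<sigma>
  proof -
    obtain A where A: "finite A" "\<And>\<tau>. \<tau> \<in> G_Q \<Longrightarrow> agree A \<sigma> \<tau> \<Longrightarrow> \<tau> \<in> U" using U \<sigma> by blast
    define N where "N = (\<lambda>i. if i \<in> A then {\<sigma> i} else UNIV)"
    have "finite {i. N i \<noteq> UNIV}" using A(1) by (rule finite_subset[rotated]) (auto simp: N_def)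
    then have "openin (product_topology (\<lambda>_. discrete_topology UNIV) UNIV) (PiE UNIV N)"
      by (intro product_topology_basis) auto
    then have "openin krull (PiE UNIV N \<inter> G_Q)" by (auto simp: krull_def openin_subtopology)
    moreover have "\<sigma> \<in> PiE UNIV N \<inter> G_Q" using \<sigma> U by (auto simp: N_def PiE_iff)
    moreover have "PiE UNIV N \<inter> G_Q \<subseteq> U"
    proof
      fix \<tau> assume "\<tau> \<in> PiE UNIV N \<inter> G_Q"
      then have "agree A \<sigma> \<tau>" "\<tau> \<in> G_Q" by (auto simp: agree_def N_def PiE_iff split: if_splits)
      then show "\<tau> \<in> U" using A(2) by blast
    qed
    ultimately show ?thesis by blast
  qed
  then show "openin krull U" by (subst openin_subopen) blast
qed

lemma openin_krull_agree: "finite A \<Longrightarrow> openin krull {\<tau> \<in> G_Q. agree A \<sigma> \<tau>}"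
  unfolding openin_krull_iff by (auto simp: agree_def intro!: exI[of _ A])

definition locally_const1 :: "((qbar \<Rightarrow> qbar) \<Rightarrow> 'm) \<Rightarrow> bool" where
  "locally_const1 b \<longleftrightarrow> (\<forall>\<sigma>\<in>G_Q. \<exists>A. finite A \<and> (\<forall>\<tau>\<in>G_Q. agree A \<sigma> \<tau> \<longrightarrow> b \<tau> = b \<sigma>))"

definition locally_const2 :: "'m cochain2 \<Rightarrow> bool" where
  "locally_const2 c \<longleftrightarrow> (\<forall>\<sigma>\<in>G_Q. \<forall>\<tau>\<in>G_Q. \<exists>A. finite A \<and>
    (\<forall>\<sigma>'\<in>G_Q. \<forall>\<tau>'\<in>G_Q. agree A \<sigma> \<sigma>' \<longrightarrow> agree A \<tau> \<tau>' \<longrightarrow> c (\<sigma>', \<tau>') = c (\<sigma>, \<tau>)))"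

text \<open>Continuity into a discrete group is local constancy; this replaces topology by finite
  sets of algebraic numbers.\<close>

lemma cochains1_iff: "b \<in> cochains1 M \<longleftrightarrow> b \<in> G_Q \<rightarrow>\<^sub>E carrier M \<and> locally_const1 b"
proof -
  have "continuous_map krull (discrete_topology (carrier M)) b \<longleftrightarrow> locally_const1 b" if b: "b \<in> G_Q \<rightarrow>\<^sub>E carrier M"
  proof
    assume c: "continuous_map krull (discrete_topology (carrier M)) b"
    show "locally_const1 b" unfolding locally_const1_def
    proof
      fix \<sigma> assume \<sigma>: "\<sigma> \<in> G_Q"
      have "openin krull {\<tau> \<in> topspace krull. b \<tau> \<in> {b \<sigma>}}"
        using b \<sigma> by (intro openin_continuous_map_preimage[OF c]) auto
      then have "openin krull {\<tau> \<in> G_Q. b \<tau> = b \<sigma>}" by (simp add: topspace_krull)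
      then show "\<exists>A. finite A \<and> (\<forall>\<tau>\<in>G_Q. agree A \<sigma> \<tau> \<longrightarrow> b \<tau> = b \<sigma>)"
        unfolding openin_krull_iff using \<sigma> by auto
    qed
  next
    assume l: "locally_const1 b"
    show "continuous_map krull (discrete_topology (carrier M)) b"
      unfolding continuous_map_def topspace_krull openin_krull_iff
    proof (intro conjI allI impI ballI)
      show "b \<in> G_Q \<rightarrow> topspace (discrete_topology (carrier M))" using b by auto
      fix U \<sigma> assume \<sigma>: "\<sigma> \<in> {\<sigma> \<in> G_Q. b \<sigma> \<in> U}"
      then obtain A where "finite A" "\<forall>\<tau>\<in>G_Q. agree A \<sigma> \<tau> \<longrightarrow> b \<tau> = b \<sigma>"
        using l unfolding locally_const1_def by blast
      then show "\<exists>A. finite A \<and> (\<forall>\<tau>\<in>G_Q. agree A \<sigma> \<tau> \<longrightarrow> \<tau> \<in> {\<sigma> \<in> G_Q. b \<sigma> \<in> U})"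
        using \<sigma> by (intro exI[of _ A]) auto
    qed auto
  qed
  then show ?thesis by (auto simp: cochains1_def)
qed

lemma cochains2_iff: "c \<in> cochains2 M \<longleftrightarrow> c \<in> G_Q2 \<rightarrow>\<^sub>E carrier M \<and> locally_const2 c"
proof -
  have "continuous_map (prod_topology krull krull) (discrete_topology (carrier M)) c \<longleftrightarrow> locally_const2 c"
    if b: "c \<in> G_Q2 \<rightarrow>\<^sub>E carrier M"
  proof
    assume c: "continuous_map (prod_topology krull krull) (discrete_topology (carrier M)) c"
    show "locally_const2 c" unfolding locally_const2_def
    proof (intro ballI)
      fix \<sigma> \<tau> assume \<sigma>: "\<sigma> \<in> G_Q" "\<tau> \<in> G_Q"
      have "openin (prod_topology krull krull) {p \<in> topspace (prod_topology krull krull). c p \<in> {c (\<sigma>, \<tau>)}}"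
        using b \<sigma> by (intro openin_continuous_map_preimage[OF c]) auto
      then have op: "openin (prod_topology krull krull) {p \<in> G_Q2. c p = c (\<sigma>, \<tau>)}"
        by (simp add: topspace_krull)
      have "(\<sigma>, \<tau>) \<in> {p \<in> G_Q2. c p = c (\<sigma>, \<tau>)}" using \<sigma> by simp
      from op[unfolded openin_prod_topology_alt, rule_format, OF this] obtain U V where UV: "openin krull U" "openin krull V" "\<sigma> \<in> U" "\<tau> \<in> V"
          "U \<times> V \<subseteq> {p \<in> G_Q2. c p = c (\<sigma>, \<tau>)}"
        by (elim exE conjE)
      obtain A where A: "finite A" "\<forall>\<sigma>'\<in>G_Q. agree A \<sigma> \<sigma>' \<longrightarrow> \<sigma>' \<in> U"
        using UV(1,3) unfolding openin_krull_iff by blast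
      obtain B where B: "finite B" "\<forall>\<tau>'\<in>G_Q. agree B \<tau> \<tau>' \<longrightarrow> \<tau>' \<in> V"
        using UV(2,4) unfolding openin_krull_iff by blast
      \<comment> \<open>One finite set has to serve both arguments, hence the union.\<close>
      show "\<exists>A. finite A \<and> (\<forall>\<sigma>'\<in>G_Q. \<forall>\<tau>'\<in>G_Q. agree A \<sigma> \<sigma>' \<longrightarrow> agree A \<tau> \<tau>' \<longrightarrow> c (\<sigma>', \<tau>') = c (\<sigma>, \<tau>))"
        using A B UV(5) by (intro exI[of _ "A \<union> B"]) (auto simp: agree_Un)
    qed
  next
    assume l: "locally_const2 c"
    show "continuous_map (prod_topology krull krull) (discrete_topology (carrier M)) c"
      unfolding continuous_map_def
    proof (intro conjI allI impI)
      show "c \<in> topspace (prod_topology krull krull) \<rightarrow> topspace (discrete_topology (carrier M))"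
        using b by (auto simp: topspace_krull)
      fix U
      show "openin (prod_topology krull krull) {p \<in> topspace (prod_topology krull krull). c p \<in> U}"
        unfolding openin_prod_topology_alt
      proof (intro allI impI)
        fix \<sigma> \<tau> assume "(\<sigma>, \<tau>) \<in> {p \<in> topspace (prod_topology krull krull). c p \<in> U}"
        then have \<sigma>: "\<sigma> \<in> G_Q" "\<tau> \<in> G_Q" "c (\<sigma>, \<tau>) \<in> U" by (auto simp: topspace_krull)
        then obtain A where A: "finite A"
          "\<forall>\<sigma>'\<in>G_Q. \<forall>\<tau>'\<in>G_Q. agree A \<sigma> \<sigma>' \<longrightarrow> agree A \<tau> \<tau>' \<longrightarrow> c (\<sigma>', \<tau>') = c (\<sigma>, \<tau>)"
          using l unfolding locally_const2_def by blast
        show "\<exists>V W. openin krull V \<and> openin krull W \<and> \<sigma> \<in> V \<and> \<tau> \<in> W \<and>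
            V \<times> W \<subseteq> {p \<in> topspace (prod_topology krull krull). c p \<in> U}"
        proof (intro exI conjI)
          show "openin krull {\<sigma>' \<in> G_Q. agree A \<sigma> \<sigma>'}" "openin krull {\<tau>' \<in> G_Q. agree A \<tau> \<tau>'}"
            by (rule openin_krull_agree[OF A(1)])+
          show "\<sigma> \<in> {\<sigma>' \<in> G_Q. agree A \<sigma> \<sigma>'}" "\<tau> \<in> {\<tau>' \<in> G_Q. agree A \<tau> \<tau>'}"
            using \<sigma> by (simp_all add: agree_def)
          show "{\<sigma>' \<in> G_Q. agree A \<sigma> \<sigma>'} \<times> {\<tau>' \<in> G_Q. agree A \<tau> \<tau>'}
              \<subseteq> {p \<in> topspace (prod_topology krull krull). c p \<in> U}"
          proof
            fix p assume "p \<in> {\<sigma>' \<in> G_Q. agree A \<sigma> \<sigma>'} \<times> {\<tau>' \<in> G_Q. agree A \<tau> \<tau>'}"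
            then obtain \<sigma>' \<tau>' where p: "p = (\<sigma>', \<tau>')" "\<sigma>' \<in> G_Q" "\<tau>' \<in> G_Q" "agree A \<sigma> \<sigma>'" "agree A \<tau> \<tau>'"
              by blast
            then have "c p = c (\<sigma>, \<tau>)" using A(2) by blast
            then show "p \<in> {p \<in> topspace (prod_topology krull krull). c p \<in> U}"
              using p \<sigma>(3) by (simp add: topspace_krull)
          qed
        qed
      qed
    qed
  qed
  then show ?thesis by (auto simp: cochains2_def)
qed

lemma locally_const1_combine:
  assumes "locally_const1 a" "locally_const1 b" "\<And>\<sigma>. \<sigma> \<in> G_Q \<Longrightarrow> c \<sigma> = F (a \<sigma>) (b \<sigma>)"
  shows "locally_const1 c"
  unfolding locally_const1_def
proof
  fix \<sigma> assume \<sigma>: "\<sigma> \<in> G_Q"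
  obtain A where A: "finite A" "\<forall>\<tau>\<in>G_Q. agree A \<sigma> \<tau> \<longrightarrow> a \<tau> = a \<sigma>"
    using assms(1) \<sigma> unfolding locally_const1_def by blast
  obtain B where B: "finite B" "\<forall>\<tau>\<in>G_Q. agree B \<sigma> \<tau> \<longrightarrow> b \<tau> = b \<sigma>"
    using assms(2) \<sigma> unfolding locally_const1_def by blast
  show "\<exists>A. finite A \<and> (\<forall>\<tau>\<in>G_Q. agree A \<sigma> \<tau> \<longrightarrow> c \<tau> = c \<sigma>)"
  proof (intro exI[of _ "A \<union> B"] conjI ballI impI)
    show "finite (A \<union> B)" using A B by blast
    fix \<tau> assume \<tau>: "\<tau> \<in> G_Q" "agree (A \<union> B) \<sigma> \<tau>"
    then have "a \<tau> = a \<sigma>" "b \<tau> = b \<sigma>" using A B unfolding agree_Un by blast+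
    then show "c \<tau> = c \<sigma>" using assms(3) \<sigma> \<tau>(1) by simp
  qed
qed

lemma locally_const1_map:
  assumes "locally_const1 a" "\<And>\<sigma>. \<sigma> \<in> G_Q \<Longrightarrow> c \<sigma> = F (a \<sigma>)" shows "locally_const1 c"
  using locally_const1_combine[OF assms(1,1), of c "\<lambda>x _. F x"] assms(2) by blast

lemma locally_const2_combine:
  assumes "locally_const2 a" "locally_const2 b" "\<And>p. p \<in> G_Q2 \<Longrightarrow> c p = F (a p) (b p)"
  shows "locally_const2 c"
  unfolding locally_const2_def
proof (intro ballI)
  fix \<sigma> \<tau> assume \<sigma>: "\<sigma> \<in> G_Q" "\<tau> \<in> G_Q"
  obtain A where A: "finite A"
    "\<forall>\<sigma>'\<in>G_Q. \<forall>\<tau>'\<in>G_Q. agree A \<sigma> \<sigma>' \<longrightarrow> agree A \<tau> \<tau>' \<longrightarrow> a (\<sigma>', \<tau>') = a (\<sigma>, \<tau>)"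
    using assms(1) \<sigma> unfolding locally_const2_def by blast
  obtain B where B: "finite B"
    "\<forall>\<sigma>'\<in>G_Q. \<forall>\<tau>'\<in>G_Q. agree B \<sigma> \<sigma>' \<longrightarrow> agree B \<tau> \<tau>' \<longrightarrow> b (\<sigma>', \<tau>') = b (\<sigma>, \<tau>)"
    using assms(2) \<sigma> unfolding locally_const2_def by blast
  show "\<exists>A. finite A \<and> (\<forall>\<sigma>'\<in>G_Q. \<forall>\<tau>'\<in>G_Q. agree A \<sigma> \<sigma>' \<longrightarrow> agree A \<tau> \<tau>' \<longrightarrow> c (\<sigma>', \<tau>') = c (\<sigma>, \<tau>))"
  proof (intro exI[of _ "A \<union> B"] conjI ballI impI)
    show "finite (A \<union> B)" using A B by blast
    fix \<sigma>' \<tau>' assume s: "\<sigma>' \<in> G_Q" "\<tau>' \<in> G_Q" "agree (A \<union> B) \<sigma> \<sigma>'" "agree (A \<union> B) \<tau> \<tau>'"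
    then have "a (\<sigma>', \<tau>') = a (\<sigma>, \<tau>)" "b (\<sigma>', \<tau>') = b (\<sigma>, \<tau>)"
      using A B unfolding agree_Un by blast+
    then show "c (\<sigma>', \<tau>') = c (\<sigma>, \<tau>)" using assms(3) \<sigma> s(1,2) by simp
  qed
qed

section \<open>Multiplicative groups of fields as Galois modules\<close>

text \<open>Shared by the two modules of the argument, the constants \<open>qbar\<close> and the
  function field with \<open>gal_fun\<close>.\<close>

locale galois_field =
  fixes act :: "(qbar \<Rightarrow> qbar) \<Rightarrow> 'a::Fields.field \<Rightarrow> 'a"
  assumes act_mult: "\<sigma> \<in> G_Q \<Longrightarrow> act \<sigma> (x * y) = act \<sigma> x * act \<sigma> y"
    and act_eq_0_iff: "\<sigma> \<in> G_Q \<Longrightarrow> act \<sigma> x = 0 \<longleftrightarrow> x = 0"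
    and act_1: "\<sigma> \<in> G_Q \<Longrightarrow> act \<sigma> 1 = 1"
    and act_comp: "\<sigma> \<in> G_Q \<Longrightarrow> \<tau> \<in> G_Q \<Longrightarrow> act (\<sigma> \<circ> \<tau>) x = act \<sigma> (act \<tau> x)"
    and act_cont: "\<exists>A. finite A \<and> (\<forall>\<sigma>\<in>G_Q. \<forall>\<tau>\<in>G_Q. agree A \<sigma> \<tau> \<longrightarrow> act \<tau> x = act \<sigma> x)"
begin

abbreviation "M \<equiv> (mult_group :: 'a monoid)"
abbreviation "cobd \<equiv> coboundary M act"
abbreviation "Z2 \<equiv> cocycles2 M act"
abbreviation "B \<equiv> coboundaries2 M act"

lemma M_sel: "carrier M = UNIV - {0}" "x \<otimes>\<^bsub>M\<^esub> y = x * y" "\<one>\<^bsub>M\<^esub> = 1"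
  by (simp_all add: mult_group_def)

lemma group_M: "group M"
proof (rule groupI)
  fix x assume "x \<in> carrier M"
  then show "\<exists>y\<in>carrier M. y \<otimes>\<^bsub>M\<^esub> x = \<one>\<^bsub>M\<^esub>"
    by (intro bexI[of _ "inverse x"]) (auto simp: M_sel)
qed (auto simp: M_sel)

lemma M_inv: "x \<noteq> 0 \<Longrightarrow> inv\<^bsub>M\<^esub> x = inverse x"
  by (rule group.inv_equality[OF group_M]) (auto simp: M_sel)

lemma act_inverse:
  assumes s: "\<sigma> \<in> G_Q" shows "act \<sigma> (inverse x) = inverse (act \<sigma> x)"
proof (cases "x = 0")
  case False
  have "act \<sigma> x * act \<sigma> (inverse x) = 1"
    using False by (simp add: act_1[OF s] flip: act_mult[OF s])
  then show ?thesis by (rule inverse_unique[symmetric])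
next
  case True
  then show ?thesis using act_eq_0_iff[OF s, of 0] by simp
qed

lemma cochains_locally_const:
  "b \<in> cochains1 M \<Longrightarrow> locally_const1 b" "c \<in> cochains2 M \<Longrightarrow> locally_const2 c"
  by (simp_all add: cochains1_iff cochains2_iff)

lemma cochains1_nz: "b \<in> cochains1 M \<Longrightarrow> \<sigma> \<in> G_Q \<Longrightarrow> b \<sigma> \<noteq> 0"
  by (auto simp: cochains1_iff M_sel PiE_iff)

lemma cochains2_nz: "c \<in> cochains2 M \<Longrightarrow> \<sigma> \<in> G_Q \<Longrightarrow> \<tau> \<in> G_Q \<Longrightarrow> c (\<sigma>, \<tau>) \<noteq> 0"
  by (auto simp: cochains2_iff M_sel PiE_iff)

lemma coboundary_eq:
  assumes "b \<in> cochains1 M" "\<sigma> \<in> G_Q" "\<tau> \<in> G_Q"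
  shows "cobd b (\<sigma>, \<tau>) = act \<sigma> (b \<tau>) * inverse (b (\<sigma> \<circ> \<tau>)) * b \<sigma>"
  using assms cochains1_nz[OF assms(1) gal_comp[OF assms(2,3)]]
  by (simp add: coboundary_def M_sel M_inv)

lemma coboundary_ext: "cobd b \<in> extensional (G_Q2)"
  by (simp add: coboundary_def)

lemma coboundary_cochain:
  assumes "b \<in> cochains1 M" shows "cobd b \<in> cochains2 M"
  unfolding cochains2_iff
proof
  have "cobd b (\<sigma>, \<tau>) \<noteq> 0" if "\<sigma> \<in> G_Q" "\<tau> \<in> G_Q" for \<sigma> \<tau>
    using that cochains1_nz[OF assms] gal_comp[OF that] by (simp add: coboundary_eq[OF assms] act_eq_0_iff)
  then show "cobd b \<in> G_Q2 \<rightarrow>\<^sub>E carrier M"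
    using coboundary_ext by (auto simp: PiE_iff M_sel)
  show "locally_const2 (cobd b)" unfolding locally_const2_def
  proof (intro ballI)
    fix \<sigma> \<tau> assume s: "\<sigma> \<in> G_Q" "\<tau> \<in> G_Q"
    have l: "locally_const1 b" using assms by (simp add: cochains1_iff)
    obtain A1 where A1: "finite A1" "\<forall>\<sigma>'\<in>G_Q. agree A1 \<sigma> \<sigma>' \<longrightarrow> b \<sigma>' = b \<sigma>"
      using l s(1) unfolding locally_const1_def by blast
    obtain A2 where A2: "finite A2" "\<forall>\<tau>'\<in>G_Q. agree A2 \<tau> \<tau>' \<longrightarrow> b \<tau>' = b \<tau>"
      using l s(2) unfolding locally_const1_def by blast
    obtain A3 where A3: "finite A3" "\<forall>\<rho>\<in>G_Q. agree A3 (\<sigma> \<circ> \<tau>) \<rho> \<longrightarrow> b \<rho> = b (\<sigma> \<circ> \<tau>)"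
      using l gal_comp[OF s] unfolding locally_const1_def by blast
    obtain A4 where A4: "finite A4" "\<forall>\<sigma>\<in>G_Q. \<forall>\<sigma>'\<in>G_Q. agree A4 \<sigma> \<sigma>' \<longrightarrow> act \<sigma>' (b \<tau>) = act \<sigma> (b \<tau>)"
      using act_cont by blast
    \<comment> \<open>The image of \<open>A3\<close> under \<open>\<tau>\<close> is there for
      composition: if \<open>\<tau>'\<close> agrees with \<open>\<tau>\<close> on \<open>A3\<close>
      and \<open>\<sigma>'\<close> agrees with \<open>\<sigma>\<close> on that image, then the
      composites agree on \<open>A3\<close>.\<close>
    let ?A = "A1 \<union> A2 \<union> A3 \<union> \<tau> ` A3 \<union> A4"
    show "\<exists>A. finite A \<and> (\<forall>\<sigma>'\<in>G_Q. \<forall>\<tau>'\<in>G_Q. agree A \<sigma> \<sigma>' \<longrightarrow> agree A \<tau> \<tau>' \<longrightarrow>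
        cobd b (\<sigma>', \<tau>') = cobd b (\<sigma>, \<tau>))"
    proof (intro exI[of _ ?A] conjI ballI impI)
      show "finite ?A" using A1 A2 A3 A4 by simp
      fix \<sigma>' \<tau>' assume s': "\<sigma>' \<in> G_Q" "\<tau>' \<in> G_Q" and ag: "agree ?A \<sigma> \<sigma>'" "agree ?A \<tau> \<tau>'"
      have "agree A3 (\<sigma> \<circ> \<tau>) (\<sigma>' \<circ> \<tau>')" using ag by (auto simp: agree_def)
      then have "b (\<sigma>' \<circ> \<tau>') = b (\<sigma> \<circ> \<tau>)" using A3 gal_comp[OF s'] by blast
      moreover have "b \<sigma>' = b \<sigma>" "b \<tau>' = b \<tau>" "act \<sigma>' (b \<tau>) = act \<sigma> (b \<tau>)"
        using ag A1 A2 A4 s s' unfolding agree_Un by blast+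
      ultimately show "cobd b (\<sigma>', \<tau>') = cobd b (\<sigma>, \<tau>)"
        by (simp add: coboundary_eq[OF assms] s s')
    qed
  qed
qed

lemma coboundary_cocycle:
  assumes "b \<in> cochains1 M" shows "cobd b \<in> Z2"
  unfolding cocycles2_def
proof (intro CollectI conjI ballI coboundary_cochain[OF assms])
  fix \<sigma> \<tau> \<rho> assume s: "\<sigma> \<in> G_Q" "\<tau> \<in> G_Q" "\<rho> \<in> G_Q"
  have nz: "b (\<sigma> \<circ> \<tau>) \<noteq> 0" "b (\<tau> \<circ> \<rho>) \<noteq> 0" "act \<sigma> (b (\<tau> \<circ> \<rho>)) \<noteq> 0" "b (\<sigma> \<circ> \<tau> \<circ> \<rho>) \<noteq> 0"
    using cochains1_nz[OF assms] s gal_comp by (auto simp: act_eq_0_iff)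
  show "act \<sigma> (cobd b (\<tau>, \<rho>)) \<otimes>\<^bsub>M\<^esub> cobd b (\<sigma>, \<tau> \<circ> \<rho>) =
      cobd b (\<sigma> \<circ> \<tau>, \<rho>) \<otimes>\<^bsub>M\<^esub> cobd b (\<sigma>, \<tau>)"
    using s nz by (simp add: coboundary_eq[OF assms] gal_comp M_sel act_mult act_inverse act_comp comp_assoc)
qed

definition cmult :: "'a cochain2 \<Rightarrow> 'a cochain2 \<Rightarrow> 'a cochain2" where
  "cmult c d = (\<lambda>p\<in>G_Q2. c p * d p)"

lemma cocycles2_mult:
  assumes "c \<in> Z2" "d \<in> Z2" shows "cmult c d \<in> Z2"
proof -
  have c: "c \<in> cochains2 M" "d \<in> cochains2 M" using assms by (auto simp: cocycles2_def)
  have "cmult c d \<in> cochains2 M" unfolding cochains2_iff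
  proof
    show "cmult c d \<in> G_Q2 \<rightarrow>\<^sub>E carrier M"
      using cochains2_nz[OF c(1)] cochains2_nz[OF c(2)] by (auto simp: cmult_def M_sel)
    show "locally_const2 (cmult c d)"
      by (rule locally_const2_combine[OF cochains_locally_const(2)[OF c(1)] cochains_locally_const(2)[OF c(2)], of _ "(*)"])
        (simp add: cmult_def)
  qed
  moreover have "act \<sigma> (cmult c d (\<tau>, \<rho>)) \<otimes>\<^bsub>M\<^esub> cmult c d (\<sigma>, \<tau> \<circ> \<rho>) =
      cmult c d (\<sigma> \<circ> \<tau>, \<rho>) \<otimes>\<^bsub>M\<^esub> cmult c d (\<sigma>, \<tau>)" if s: "\<sigma> \<in> G_Q" "\<tau> \<in> G_Q" "\<rho> \<in> G_Q" for \<sigma> \<tau> \<rho>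
  proof -
    have "act \<sigma> (c (\<tau>, \<rho>)) * c (\<sigma>, \<tau> \<circ> \<rho>) = c (\<sigma> \<circ> \<tau>, \<rho>) * c (\<sigma>, \<tau>)"
      "act \<sigma> (d (\<tau>, \<rho>)) * d (\<sigma>, \<tau> \<circ> \<rho>) = d (\<sigma> \<circ> \<tau>, \<rho>) * d (\<sigma>, \<tau>)"
      using assms s by (auto simp: cocycles2_def M_sel)
    then have "(act \<sigma> (c (\<tau>, \<rho>)) * c (\<sigma>, \<tau> \<circ> \<rho>)) * (act \<sigma> (d (\<tau>, \<rho>)) * d (\<sigma>, \<tau> \<circ> \<rho>)) =
        (c (\<sigma> \<circ> \<tau>, \<rho>) * c (\<sigma>, \<tau>)) * (d (\<sigma> \<circ> \<tau>, \<rho>) * d (\<sigma>, \<tau>))" by simp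
    then show ?thesis using s by (simp add: cmult_def M_sel gal_comp act_mult mult_ac)
  qed
  ultimately show ?thesis by (simp add: cocycles2_def)
qed

lemma cochains1_mult:
  assumes "b \<in> cochains1 M" "d \<in> cochains1 M"
  shows "(\<lambda>\<sigma>\<in>G_Q. b \<sigma> * d \<sigma>) \<in> cochains1 M"
    "cobd (\<lambda>\<sigma>\<in>G_Q. b \<sigma> * d \<sigma>) = cmult (cobd b) (cobd d)"
proof -
  have "locally_const1 (\<lambda>\<sigma>\<in>G_Q. b \<sigma> * d \<sigma>)"
    by (rule locally_const1_combine[OF cochains_locally_const(1)[OF assms(1)] cochains_locally_const(1)[OF assms(2)], of _ "(*)"])
      simp
  then show bd: "(\<lambda>\<sigma>\<in>G_Q. b \<sigma> * d \<sigma>) \<in> cochains1 M"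
    using cochains1_nz[OF assms(1)] cochains1_nz[OF assms(2)] by (auto simp: cochains1_iff M_sel)
  show "cobd (\<lambda>\<sigma>\<in>G_Q. b \<sigma> * d \<sigma>) = cmult (cobd b) (cobd d)"
  proof (rule extensionalityI[OF coboundary_ext])
    show "cmult (cobd b) (cobd d) \<in> extensional (G_Q2)" by (simp add: cmult_def)
    fix p assume "p \<in> G_Q2"
    then obtain \<sigma> \<tau> where p: "p = (\<sigma>, \<tau>)" "\<sigma> \<in> G_Q" "\<tau> \<in> G_Q" by auto
    show "cobd (\<lambda>\<sigma>\<in>G_Q. b \<sigma> * d \<sigma>) p = cmult (cobd b) (cobd d) p"
      using p by (simp add: coboundary_eq[OF bd] coboundary_eq[OF assms(1)] coboundary_eq[OF assms(2)]
          cmult_def gal_comp act_mult mult_ac)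
  qed
qed

lemma cochains1_inverse:
  assumes "b \<in> cochains1 M"
  shows "(\<lambda>\<sigma>\<in>G_Q. inverse (b \<sigma>)) \<in> cochains1 M"
    "p \<in> G_Q2 \<Longrightarrow> cobd (\<lambda>\<sigma>\<in>G_Q. inverse (b \<sigma>)) p = inverse (cobd b p)"
proof -
  have "locally_const1 (\<lambda>\<sigma>\<in>G_Q. inverse (b \<sigma>))"
    by (rule locally_const1_map[OF cochains_locally_const(1)[OF assms], of _ inverse]) simp
  then show bd: "(\<lambda>\<sigma>\<in>G_Q. inverse (b \<sigma>)) \<in> cochains1 M"
    using cochains1_nz[OF assms(1)] by (auto simp: cochains1_iff M_sel)
  show "cobd (\<lambda>\<sigma>\<in>G_Q. inverse (b \<sigma>)) p = inverse (cobd b p)" if "p \<in> G_Q2"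
    using that by (auto simp: coboundary_eq[OF bd] coboundary_eq[OF assms] gal_comp act_inverse)
qed

lemma cochains1_one: "(\<lambda>\<sigma>\<in>G_Q. 1) \<in> cochains1 M"
  "cobd (\<lambda>\<sigma>\<in>G_Q. 1) = (\<lambda>p\<in>G_Q2. 1)"
proof -
  show 1: "(\<lambda>\<sigma>\<in>G_Q. 1) \<in> cochains1 M"
    by (auto simp: cochains1_iff M_sel locally_const1_def)
  show "cobd (\<lambda>\<sigma>\<in>G_Q. 1) = (\<lambda>p\<in>G_Q2. 1)"
    by (rule extensionalityI[OF coboundary_ext]) (auto simp: coboundary_eq[OF 1] gal_comp act_1)
qed

lemma coset_eq: "B #>\<^bsub>cochain_group M\<^esub> c = (\<lambda>b. cmult (cobd b) c) ` cochains1 M"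
  by (auto simp: r_coset_def coboundaries2_def product_group_def cmult_def M_sel)

lemma coset_of_coboundary:
  assumes "c \<in> B" shows "B #>\<^bsub>cochain_group M\<^esub> c = B"
proof -
  obtain d where d: "d \<in> cochains1 M" "c = cobd d" using assms by (auto simp: coboundaries2_def)
  show ?thesis
  proof
    show "B #>\<^bsub>cochain_group M\<^esub> c \<subseteq> B"
    proof
      fix x assume "x \<in> B #>\<^bsub>cochain_group M\<^esub> c"
      then obtain b where b: "b \<in> cochains1 M" "x = cmult (cobd b) c"
        unfolding coset_eq by blast
      show "x \<in> B"
        unfolding b(2) d(2) cochains1_mult(2)[OF b(1) d(1), symmetric] coboundaries2_def
        using cochains1_mult(1)[OF b(1) d(1)] by (rule imageI)
    qed
    show "B \<subseteq> B #>\<^bsub>cochain_group M\<^esub> c"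
    proof
      fix x assume "x \<in> B"
      then obtain b where b: "b \<in> cochains1 M" "x = cobd b" by (auto simp: coboundaries2_def)
      note i = cochains1_inverse(1)[OF d(1)]
      note m = cochains1_mult[OF b(1) i]
      have nz: "cobd d p \<noteq> 0" if "p \<in> G_Q2" for p
        using cochains2_nz[OF coboundary_cochain[OF d(1)]] that by auto
      \<comment> \<open>With \<open>c = cobd d\<close>, the coboundary of \<open>b\<close> is that
        of \<open>b / d\<close> times \<open>c\<close>.\<close>
      have "x = cmult (cobd (\<lambda>\<sigma>\<in>G_Q. b \<sigma> * (\<lambda>\<sigma>\<in>G_Q. inverse (d \<sigma>)) \<sigma>)) c"
        unfolding m(2) b(2) d(2)
        by (rule extensionalityI[OF coboundary_ext])
          (auto simp: cmult_def cochains1_inverse(2)[OF d(1)] nz simp del: split_paired_All)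
      then show "x \<in> B #>\<^bsub>cochain_group M\<^esub> c" unfolding coset_eq using m(1) by blast
    qed
  qed
qed

end

interpretation GQ: galois_field "\<lambda>\<sigma>. \<sigma>"
proof
  fix x :: qbar
  show "\<exists>A. finite A \<and> (\<forall>\<sigma>\<in>G_Q. \<forall>\<tau>\<in>G_Q. agree A \<sigma> \<tau> \<longrightarrow> \<tau> x = \<sigma> x)"
    by (intro exI[of _ "{x}"]) (auto simp: agree_def)
qed (simp_all add: gal_hom gal_eq_0_iff)

interpretation GK: galois_field gal_fun
proof
  fix f :: ratfun
  show "\<exists>A. finite A \<and> (\<forall>\<sigma>\<in>G_Q. \<forall>\<tau>\<in>G_Q. agree A \<sigma> \<tau> \<longrightarrow> gal_fun \<tau> f = gal_fun \<sigma> f)"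
    using gal_fun_locally_constant[of f] by (simp add: agree_def)
qed (simp_all add: gal_fun_hom gal_fun_eq_0_iff gal_fun_simps gal_fun_comp)

section \<open>The Brauer class of \<open>E\<close>\<close>

definition const_chain :: "((qbar \<Rightarrow> qbar) \<Rightarrow> qbar) \<Rightarrow> (qbar \<Rightarrow> qbar) \<Rightarrow> ratfun" where
  "const_chain b = (\<lambda>\<sigma>\<in>G_Q. const_fun (b \<sigma>))"

lemma const_chain:
  assumes "b \<in> cochains1 mult_group"
  shows "const_chain b \<in> cochains1 mult_group"
    "p \<in> G_Q2 \<Longrightarrow> GK.cobd (const_chain b) p = const_fun (GQ.cobd b p)"
proof -
  have "locally_const1 (const_chain b)"
    by (rule locally_const1_map[OF GQ.cochains_locally_const(1)[OF assms], of _ const_fun]) (simp add: const_chain_def)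
  then show c: "const_chain b \<in> cochains1 mult_group"
    using GQ.cochains1_nz[OF assms] by (auto simp: cochains1_iff GK.M_sel const_chain_def const_fun_eq_0_iff)
  assume "p \<in> G_Q2"
  then obtain \<sigma> \<tau> where p: "p = (\<sigma>, \<tau>)" "\<sigma> \<in> G_Q" "\<tau> \<in> G_Q" by auto
  show "GK.cobd (const_chain b) p = const_fun (GQ.cobd b p)"
    unfolding p(1) GK.coboundary_eq[OF c p(2,3)] GQ.coboundary_eq[OF assms p(2,3)]
    using p gal_comp[OF p(2,3)]
    by (simp add: const_chain_def gal_fun_hom const_fun_simps const_fun_inverse)
qed

lemma const_chain_surj:
  assumes "\<And>\<sigma>. \<sigma> \<in> G_Q \<Longrightarrow> \<exists>c. c \<noteq> 0 \<and> f \<sigma> = const_fun c" "f \<in> cochains1 mult_group"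
  obtains b where "b \<in> cochains1 mult_group" "f = const_chain b"
proof -
  obtain g where g: "\<And>\<sigma>. \<sigma> \<in> G_Q \<Longrightarrow> g \<sigma> \<noteq> 0 \<and> f \<sigma> = const_fun (g \<sigma>)"
    using assms(1) by metis
  define b where "b = (\<lambda>\<sigma>\<in>G_Q. g \<sigma>)"
  have "locally_const1 b"
    unfolding locally_const1_def
  proof
    fix \<sigma> assume \<sigma>: "\<sigma> \<in> G_Q"
    obtain A where A: "finite A" "\<forall>\<tau>\<in>G_Q. agree A \<sigma> \<tau> \<longrightarrow> f \<tau> = f \<sigma>"
      using GK.cochains_locally_const(1)[OF assms(2)] \<sigma> unfolding locally_const1_def by blast
    show "\<exists>A. finite A \<and> (\<forall>\<tau>\<in>G_Q. agree A \<sigma> \<tau> \<longrightarrow> b \<tau> = b \<sigma>)"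
    proof (intro exI[of _ A] conjI ballI impI)
      fix \<tau> assume \<tau>: "\<tau> \<in> G_Q" "agree A \<sigma> \<tau>"
      then have "const_fun (g \<tau>) = const_fun (g \<sigma>)" using A(2) g \<sigma> by metis
      then show "b \<tau> = b \<sigma>" using \<tau>(1) \<sigma> by (simp add: b_def const_fun_inject)
    qed (fact A(1))
  qed
  then have "b \<in> cochains1 mult_group" using g by (auto simp: cochains1_iff GQ.M_sel b_def)
  moreover have "f = const_chain b"
    using assms(2) g by (intro extensionalityI[of f G_Q]) (auto simp: const_chain_def b_def cochains1_iff PiE_iff)
  ultimately show ?thesis by (rule that)
qed

text \<open>Local constancy, nonvanishing and the cocycle identity all hold for the coboundary of
  \<open>f\<close> and descend along the injective, equivariant map
  \<open>const_fun\<close>.\<close>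

lemma const_cocycle:
  assumes f: "f \<in> cochains1 mult_group"
    and c: "\<And>p. p \<in> G_Q2 \<Longrightarrow> const_fun (c p) = GK.cobd f p"
    and ext: "c \<in> extensional (G_Q2)"
  shows "c \<in> GQ.Z2"
proof -
  note co = GK.coboundary_cocycle[OF f]
  have cc: "GK.cobd f \<in> cochains2 mult_group" using co by (simp add: cocycles2_def)
  have "locally_const2 c"
    unfolding locally_const2_def
  proof (intro ballI)
    fix \<sigma> \<tau> assume \<sigma>: "\<sigma> \<in> G_Q" "\<tau> \<in> G_Q"
    obtain A where A: "finite A" "\<forall>\<sigma>'\<in>G_Q. \<forall>\<tau>'\<in>G_Q. agree A \<sigma> \<sigma>' \<longrightarrow> agree A \<tau> \<tau>' \<longrightarrow>
        GK.cobd f (\<sigma>', \<tau>') = GK.cobd f (\<sigma>, \<tau>)"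
      using GK.cochains_locally_const(2)[OF cc] \<sigma> unfolding locally_const2_def by blast
    show "\<exists>A. finite A \<and> (\<forall>\<sigma>'\<in>G_Q. \<forall>\<tau>'\<in>G_Q. agree A \<sigma> \<sigma>' \<longrightarrow> agree A \<tau> \<tau>' \<longrightarrow> c (\<sigma>', \<tau>') = c (\<sigma>, \<tau>))"
    proof (intro exI[of _ A] conjI ballI impI)
      fix \<sigma>' \<tau>' assume s: "\<sigma>' \<in> G_Q" "\<tau>' \<in> G_Q" "agree A \<sigma> \<sigma>'" "agree A \<tau> \<tau>'"
      have "const_fun (c (\<sigma>', \<tau>')) = GK.cobd f (\<sigma>', \<tau>')" using c s by simp
      also have "\<dots> = GK.cobd f (\<sigma>, \<tau>)" using A s by blast
      also have "\<dots> = const_fun (c (\<sigma>, \<tau>))" using c \<sigma> by simp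
      finally show "c (\<sigma>', \<tau>') = c (\<sigma>, \<tau>)" by (simp only: const_fun_inject)
    qed (fact A(1))
  qed
  moreover have "c p \<noteq> 0" if "p \<in> G_Q2" for p
    using GK.cochains2_nz[OF cc] c[OF that] that by (metis SigmaE const_fun_simps(1))
  then have "c \<in> G_Q2 \<rightarrow>\<^sub>E carrier mult_group"
    using ext by (simp add: PiE_iff GQ.M_sel)
  moreover have "\<sigma> (c (\<tau>, \<rho>)) * c (\<sigma>, \<tau> \<circ> \<rho>) = c (\<sigma> \<circ> \<tau>, \<rho>) * c (\<sigma>, \<tau>)"
    if s: "\<sigma> \<in> G_Q" "\<tau> \<in> G_Q" "\<rho> \<in> G_Q" for \<sigma> \<tau> \<rho>
  proof -
    let ?d = "GK.cobd f"
    have "gal_fun \<sigma> (?d (\<tau>, \<rho>)) * ?d (\<sigma>, \<tau> \<circ> \<rho>) = ?d (\<sigma> \<circ> \<tau>, \<rho>) * ?d (\<sigma>, \<tau>)"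
      using co s unfolding cocycles2_def GK.M_sel by blast
    then have "const_fun (\<sigma> (c (\<tau>, \<rho>)) * c (\<sigma>, \<tau> \<circ> \<rho>)) = const_fun (c (\<sigma> \<circ> \<tau>, \<rho>) * c (\<sigma>, \<tau>))"
      using s gal_comp by (simp add: c[symmetric] gal_fun_hom const_fun_simps)
    then show ?thesis by (simp only: const_fun_inject)
  qed
  ultimately show ?thesis by (simp add: cocycles2_def cochains2_iff GQ.M_sel)
qed

section \<open>The cochain of \<open>E\<close> and its constant coboundary\<close>

abbreviation "\<theta> \<equiv> zeta8 ^ 3"

definition E_cochain :: "(qbar \<Rightarrow> qbar) \<Rightarrow> ratfun" where
  "E_cochain = (\<lambda>\<sigma>\<in>G_Q. conj_fun \<theta> (\<sigma> \<theta>))"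

lemma gal_theta: "\<sigma> \<in> G_Q \<Longrightarrow> (\<sigma> \<theta>) ^ 4 = -1"
  "\<sigma> \<in> G_Q \<Longrightarrow> gal_div UNIV \<sigma> divisor_E = Ediv (\<sigma> \<theta>)"
  using gal_div_Ediv[OF _ is_subfield_UNIV UNIV_I zeta8_3_pow4] by (simp_all add: divisor_E_eq)

lemma E_cochain_props:
  assumes "\<sigma> \<in> G_Q"
  shows "E_cochain \<sigma> \<noteq> 0" "div_of (E_cochain \<sigma>) P = gal_div UNIV \<sigma> divisor_E P - divisor_E P"
  using conj_fun[OF zeta8_3_pow4 gal_theta(1)[OF assms]] assms gal_theta(2)[OF assms]
  by (simp_all add: E_cochain_def divisor_E_eq)

text \<open>The value at \<open>\<sigma>\<close> depends only on \<open>\<sigma> \<theta>\<close>,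
  so the neighbourhood given by the single element \<open>\<theta>\<close> is enough.\<close>

lemma E_cochain_C1: "E_cochain \<in> cochains1 mult_group"
proof -
  have "locally_const1 E_cochain" unfolding locally_const1_def
    by (intro ballI exI[of _ "{\<theta>}"]) (simp add: agree_def E_cochain_def)
  then show ?thesis using E_cochain_props(1) by (auto simp: cochains1_iff GK.M_sel) (auto simp: E_cochain_def)
qed

text \<open>The divisor telescopes: \<open>\<sigma>(\<tau>D - D) - (\<sigma>\<tau>D - D) +
  (\<sigma>D - D) = 0\<close>.\<close>

lemma div_of_coboundary:
  assumes f: "f \<in> cochains1 mult_group" and D: "D \<in> Div"
    and div: "\<And>\<sigma> P. \<sigma> \<in> G_Q \<Longrightarrow> div_of (f \<sigma>) P = gal_div UNIV \<sigma> D P - D P"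
    and s: "\<sigma> \<in> G_Q" "\<tau> \<in> G_Q"
  shows "div_of (GK.cobd f (\<sigma>, \<tau>)) P = 0"
proof -
  note st = gal_comp[OF s]
  have nz: "f \<sigma> \<noteq> 0" "f \<tau> \<noteq> 0" "f (\<sigma> \<circ> \<tau>) \<noteq> 0" "gal_fun \<sigma> (f \<tau>) \<noteq> 0"
    using GK.cochains1_nz[OF f] s st gal_fun_eq_0_iff by auto
  have "gal_div UNIV (\<sigma> \<circ> \<tau>) D P = gal_div UNIV \<sigma> (gal_div UNIV \<tau> D) P"
  proof (cases "P \<in> C4")
    case True
    have "inv_into UNIV (\<sigma> \<circ> \<tau>) = inv_into UNIV \<tau> \<circ> inv_into UNIV \<sigma>"
      using gal_hom(6)[OF s(1)] gal_hom(6)[OF s(2)] by (rule o_inv_distrib)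
    then show ?thesis
      using True gal_pt_C4[OF gal_inv[OF s(1)] True] gal_pt_comp[OF gal_inv[OF s(2)] gal_inv[OF s(1)] True]
      by (simp add: gal_div_eq[OF st DivD(1)[OF D]] gal_div_eq[OF s(2) DivD(1)[OF D]]
        gal_div_eq[OF s(1) DivD(1)[OF gal_div_Div[OF s(2) D]]])
  qed (simp add: gal_div_eq[OF st DivD(1)[OF D]] gal_div_eq[OF s(1) DivD(1)[OF gal_div_Div[OF s(2) D]]])
  moreover have "div_of (gal_fun \<sigma> (f \<tau>)) P = gal_div UNIV \<sigma> (gal_div UNIV \<tau> D) P - gal_div UNIV \<sigma> D P"
    by (rule lin_equiv_gal[OF s(1) gal_div_Div[OF s(2) D] D nz(2) div[OF s(2), symmetric], symmetric])
  ultimately show ?thesis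
    using nz by (simp add: GK.coboundary_eq[OF f s] div_of_mult div_of_inverse div s st)
qed

lemma E_cocycle_exists:
  obtains c0 where "c0 \<in> GQ.Z2"
    "\<And>p. p \<in> G_Q2 \<Longrightarrow> const_fun (c0 p) = GK.cobd E_cochain p"
proof -
  have "\<exists>c. const_fun c = GK.cobd E_cochain p" if pG: "p \<in> G_Q2" for p
  proof -
    obtain \<sigma> \<tau> where p: "p = (\<sigma>, \<tau>)" "\<sigma> \<in> G_Q" "\<tau> \<in> G_Q" using pG by auto
    have "GK.cobd E_cochain p \<noteq> 0"
      unfolding p(1) using GK.cochains2_nz[OF GK.coboundary_cochain[OF E_cochain_C1]] p by blast
    moreover have "div_of (GK.cobd E_cochain p) P = 0" for P
      unfolding p(1) using E_cochain_props(2) p Ediv_Div[OF zeta8_3_pow4]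
      by (intro div_of_coboundary[OF E_cochain_C1, of divisor_E]) (auto simp: divisor_E_eq)
    ultimately show ?thesis by (metis div_of_eq_0_imp_const)
  qed
  then obtain c where c: "\<And>p. p \<in> G_Q2 \<Longrightarrow> const_fun (c p) = GK.cobd E_cochain p"
    by metis
  show ?thesis
  proof (rule that)
    show 1: "const_fun (restrict c (G_Q2) p) = GK.cobd E_cochain p" if "p \<in> G_Q2" for p
      using c[OF that] that by simp
    show "restrict c (G_Q2) \<in> GQ.Z2"
      using 1 by (intro const_cocycle[OF E_cochain_C1]) auto
  qed
qed

text \<open>\<open>Br_map\<close> allows every divisor of the class and every choice of functions.
  Changing the functions by constants multiplies the cocycle by a coboundary, and changing the
  divisor does not affect it once the functions are adjusted accordingly.\<close>

lemma Br_map_eq: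
  assumes c0: "c0 \<in> GQ.Z2"
    "\<And>p. p \<in> G_Q2 \<Longrightarrow> const_fun (c0 p) = GK.cobd E_cochain p"
  shows "Br_map (div_class divisor_E) = GQ.B #>\<^bsub>cochain_group mult_group\<^esub> c0"
proof (intro equalityI subsetI)
  have E: "divisor_E \<in> Div" using Ediv_Div[OF zeta8_3_pow4] by (simp add: divisor_E_eq)
  fix c assume "c \<in> GQ.B #>\<^bsub>cochain_group mult_group\<^esub> c0"
  then obtain b where b: "b \<in> cochains1 mult_group" "c = GQ.cmult (GQ.cobd b) c0"
    unfolding GQ.coset_eq by blast
  note cb = const_chain[OF b(1)]
  note m = GK.cochains1_mult[OF cb(1) E_cochain_C1]
  show "c \<in> Br_map (div_class divisor_E)"
    unfolding Br_map_def
  proof (intro CollectI conjI bexI ballI allI)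
    show "c \<in> GQ.Z2"
      unfolding b(2) by (intro GQ.cocycles2_mult GQ.coboundary_cocycle b c0)
    show "divisor_E \<in> div_class divisor_E" using E lin_equiv_refl by (simp add: div_class_def)
    show "(\<lambda>\<sigma>\<in>G_Q. const_chain b \<sigma> * E_cochain \<sigma>) \<in> cochains1 mult_group" by (rule m)
    show "div_of ((\<lambda>\<sigma>\<in>G_Q. const_chain b \<sigma> * E_cochain \<sigma>) \<sigma>) P = gal_div UNIV \<sigma> divisor_E P - divisor_E P"
      if s: "\<sigma> \<in> G_Q" for \<sigma> P
      using s GQ.cochains1_nz[OF b(1) s] E_cochain_props[OF s]
      by (simp add: div_of_mult const_chain_def const_fun_eq_0_iff div_of_const)
    show "const_fun (c p) = GK.cobd (\<lambda>\<sigma>\<in>G_Q. const_chain b \<sigma> * E_cochain \<sigma>) p"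
      if "p \<in> G_Q2" for p
      unfolding m(2) b(2) GQ.cmult_def GK.cmult_def restrict_apply if_P[OF that] const_fun_simps(4) cb(2)[OF that] c0(2)[OF that] ..
  qed
next
  fix c assume "c \<in> Br_map (div_class divisor_E)"
  then obtain D f where c: "c \<in> GQ.Z2" and D: "D \<in> div_class divisor_E"
    and f: "f \<in> cochains1 mult_group" "\<And>\<sigma> P. \<sigma> \<in> G_Q \<Longrightarrow> div_of (f \<sigma>) P = gal_div UNIV \<sigma> D P - D P"
    and cf: "\<And>p. p \<in> G_Q2 \<Longrightarrow> const_fun (c p) = GK.cobd f p"
    unfolding Br_map_def by blast
  have E: "divisor_E \<in> Div" using Ediv_Div[OF zeta8_3_pow4] by (simp add: divisor_E_eq)
  obtain k where k: "D \<in> Div" "k \<noteq> 0" "\<And>P. D P - divisor_E P = div_of k P"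
    using D by (auto simp: div_class_def lin_equiv_def)
  \<comment> \<open>\<open>u\<close> compensates for the passage from \<open>E\<close> to
    \<open>D = E + div k\<close>: the divisor of \<open>f \<sigma> * u \<sigma>\<close> is
    \<open>\<sigma> E - E\<close> again.\<close>
  define u where "u = (\<lambda>\<sigma>\<in>G_Q. k / gal_fun \<sigma> k)"
  have u: "u \<in> cochains1 mult_group"
  proof -
    have "locally_const1 (\<lambda>\<sigma>. gal_fun \<sigma> k)" unfolding locally_const1_def
    proof
      fix \<sigma> assume "\<sigma> \<in> G_Q"
      then show "\<exists>A. finite A \<and> (\<forall>\<tau>\<in>G_Q. agree A \<sigma> \<tau> \<longrightarrow> gal_fun \<tau> k = gal_fun \<sigma> k)"
        using GK.act_cont[of k] by blast
    qed
    then have "locally_const1 u" by (rule locally_const1_map[of _ _ "\<lambda>x. k / x"]) (simp add: u_def)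
    then show ?thesis using k(2) gal_fun_eq_0_iff by (auto simp: cochains1_iff GK.M_sel u_def)
  qed
  \<comment> \<open>\<open>u \<sigma>\<close> is the quotient of \<open>\<sigma> (1/k)\<close> by
    \<open>1/k\<close>, the coboundary of a 0-cochain, so its own coboundary is trivial.\<close>
  have du: "GK.cobd u p = 1" if pG: "p \<in> G_Q2" for p
  proof -
    obtain \<sigma> \<tau> where p: "p = (\<sigma>, \<tau>)" "\<sigma> \<in> G_Q" "\<tau> \<in> G_Q" using pG by auto
    have "gal_fun \<sigma> k \<noteq> 0" "gal_fun \<sigma> (gal_fun \<tau> k) \<noteq> 0" using p k(2) by (simp_all add: gal_fun_eq_0_iff)
    then show ?thesis
      unfolding p(1) GK.coboundary_eq[OF u p(2,3)]
      using p k(2) gal_comp[OF p(2,3)] gal_fun_comp[OF p(2,3)] by (simp add: u_def gal_fun_divide)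
  qed
  note i = GK.cochains1_inverse[OF E_cochain_C1]
  define fu where "fu = (\<lambda>\<sigma>\<in>G_Q. f \<sigma> * u \<sigma>)"
  \<comment> \<open>The quotient of the adjusted cochain by \<open>E_cochain\<close>. Its values
    have divisor 0, hence are constants, and they provide the coboundary relating \<open>c\<close>
    to \<open>c0\<close>.\<close>
  define l where "l = (\<lambda>\<sigma>\<in>G_Q. fu \<sigma> * (\<lambda>\<sigma>\<in>G_Q. inverse (E_cochain \<sigma>)) \<sigma>)"
  note fu = GK.cochains1_mult[OF f(1) u, folded fu_def]
  note l = GK.cochains1_mult[OF fu(1) i(1), folded l_def]
  have "\<exists>a. a \<noteq> 0 \<and> l \<sigma> = const_fun a" if s: "\<sigma> \<in> G_Q" for \<sigma>
  proof -
    have nz: "f \<sigma> \<noteq> 0" "E_cochain \<sigma> \<noteq> 0" "gal_fun \<sigma> k \<noteq> 0"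
      using GK.cochains1_nz[OF f(1) s] E_cochain_props(1)[OF s] k(2) s by (simp_all add: gal_fun_eq_0_iff)
    have l\<sigma>: "l \<sigma> = f \<sigma> * (k / gal_fun \<sigma> k) * inverse (E_cochain \<sigma>)" using s by (simp add: l_def fu_def u_def)
    have "div_of (l \<sigma>) P = 0" for P
    proof -
      have "div_of (gal_fun \<sigma> k) P = gal_div UNIV \<sigma> D P - gal_div UNIV \<sigma> divisor_E P"
        using lin_equiv_gal[OF s k(1) E k(2,3)] by simp
      then show ?thesis
        unfolding l\<sigma> using nz k(2) k(3)[of P] f(2)[OF s, of P] E_cochain_props(2)[OF s, of P]
        by (simp add: div_of_mult div_of_divide div_of_inverse)
    qed
    moreover have "l \<sigma> \<noteq> 0" unfolding l\<sigma> using nz k(2) by simp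
    ultimately show ?thesis by (metis div_of_eq_0_imp_const)
  qed
  then obtain b where b: "b \<in> cochains1 mult_group" "l = const_chain b"
    using const_chain_surj l(1) by blast
  have "c = GQ.cmult (GQ.cobd b) c0"
  proof (rule extensionalityI)
    show "c \<in> extensional (G_Q2)" using c by (auto simp: cocycles2_def cochains2_iff PiE_iff)
    show "GQ.cmult (GQ.cobd b) c0 \<in> extensional (G_Q2)"
      by (simp add: GQ.cmult_def)
    fix p assume p: "p \<in> G_Q2"
    have nz: "GK.cobd E_cochain p \<noteq> 0"
      using GK.cochains2_nz[OF GK.coboundary_cochain[OF E_cochain_C1]] p by blast
    have "GK.cobd l p = const_fun (c p) * inverse (const_fun (c0 p))"
      unfolding l(2) fu(2) GK.cmult_def restrict_apply if_P[OF p] du[OF p] i(2)[OF p] cf[OF p] c0(2)[OF p] by simp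
    then have "const_fun (c p) = const_fun (GQ.cobd b p) * const_fun (c0 p)"
      using nz by (simp add: b(2) const_chain(2)[OF b(1) p] c0(2)[OF p])
    then have "const_fun (c p) = const_fun (GQ.cobd b p * c0 p)"
      by (simp add: const_fun_simps)
    then show "c p = GQ.cmult (GQ.cobd b) c0 p"
      using p by (simp only: const_fun_inject GQ.cmult_def restrict_apply if_P)
  qed
  then show "c \<in> GQ.B #>\<^bsub>cochain_group mult_group\<^esub> c0" unfolding GQ.coset_eq using b(1) by blast
qed

text \<open>Evaluated at complex conjugation, a coboundary that is trivial at the identity is positive,
  whereas the cocycle of \<open>E\<close> is \<open>-1\<close> there.\<close>

lemma E_cocycle_not_coboundary:
  assumes c0: "\<And>p. p \<in> G_Q2 \<Longrightarrow> const_fun (c0 p) = GK.cobd E_cochain p"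
  shows "c0 \<notin> GQ.B"
proof
  let ?k = cnj_qbar
  note k = cnj_qbar_in_G_Q
  have kk: "?k \<circ> ?k = id"
  proof
    show "(?k \<circ> ?k) x = id x" for x unfolding comp_apply id_apply by transfer simp
  qed
  have p: "zeta8 ^ (4 + n) = - (zeta8 ^ n)" for n by (simp add: power_add zeta8_pow4)
  have k\<theta>: "?k \<theta> = - zeta8"
  proof -
    \<comment> \<open>The exponent is \<open>7 * 3 = 21\<close>; each of the five summands 4
      contributes a sign.\<close>
    have "?k \<theta> = zeta8 ^ (4 + (4 + (4 + (4 + (4 + 1)))))"
      using gal_power[OF k, of zeta8 3] by (simp add: zeta8_cnj flip: power_mult)
    then show ?thesis by (simp only: p) simp
  qed
  \<comment> \<open>Places \<open>- zeta8\<close> in the third case of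
    \<open>conj_fun\<close>.\<close>
  have ne: "- zeta8 \<noteq> \<theta>" "- zeta8 \<noteq> - \<theta>"
  proof -
    have "(zeta8 ^ 2) ^ 2 = -1" by (simp add: zeta8_pow4 flip: power_mult)
    then have z: "zeta8 ^ 2 \<noteq> c" if "c ^ 2 \<noteq> -1" for c using that by metis
    have 0: "zeta8 \<noteq> 0" using zeta8_pow4 by auto
    have \<theta>: "\<theta> = zeta8 ^ 2 * zeta8" by (simp add: power3_eq_cube power2_eq_square)
    show "- zeta8 \<noteq> \<theta>"
    proof
      assume "- zeta8 = \<theta>"
      then have "zeta8 ^ 2 * zeta8 = -1 * zeta8" unfolding \<theta> by simp
      then have "zeta8 ^ 2 = -1" using 0 by (simp only: mult_cancel_right) simp
      with z[of "-1"] show False by simp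
    qed
    show "- zeta8 \<noteq> - \<theta>"
    proof
      assume "- zeta8 = - \<theta>"
      then have "zeta8 ^ 2 * zeta8 = 1 * zeta8" unfolding \<theta> by simp
      then have "zeta8 ^ 2 = 1" using 0 by (simp only: mult_cancel_right) simp
      with z[of 1] show False by simp
    qed
  qed
  have fk: "E_cochain ?k = inverse (tangent_fun \<theta> * tangent_fun zeta8)"
    using k ne by (simp add: E_cochain_def k\<theta> conj_fun_def)
  have k\<zeta>: "?k zeta8 = - \<theta>" using p[of 3] by (simp add: zeta8_cnj)
  have fid: "E_cochain id = 1" using id_in_gal by (simp add: E_cochain_def conj_fun_def)
  \<comment> \<open>The middle factor is the value at the identity, which is 1. Conjugation sends
    \<open>\<theta>\<close> to \<open>- zeta8\<close> and \<open>zeta8\<close> to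
    \<open>- \<theta>\<close>, so the four tangent functions occur once each.\<close>
  have "const_fun (c0 (?k, ?k)) = inverse (tangent_fun (- zeta8) * tangent_fun (- \<theta>)) * inverse (tangent_fun \<theta> * tangent_fun zeta8)"
    using k by (simp add: c0 GK.coboundary_eq[OF E_cochain_C1 k k] kk fid fk gal_fun_inverse gal_fun_hom gal_fun_tangent_fun k\<theta> k\<zeta>)
  also have "\<dots> = inverse (tangent_fun zeta8 * tangent_fun (- zeta8) * (tangent_fun (zeta8 ^ 2 * zeta8) * tangent_fun (- (zeta8 ^ 2 * zeta8))))"
    by (simp add: power3_eq_cube power2_eq_square mult_ac)
  also have "\<dots> = const_fun (-1)"
    using tangent_fun_prod[of "zeta8 ^ 2" zeta8] by (simp add: zeta8_pow4 const_fun_uminus const_fun_simps flip: power_mult)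
  finally have ck: "c0 (?k, ?k) = -1" by (simp only: const_fun_inject)
  have "const_fun (c0 (id, id)) = const_fun 1"
    using id_in_gal by (simp add: c0 GK.coboundary_eq[OF E_cochain_C1 id_in_gal id_in_gal] fid gal_fun_simps const_fun_simps)
  then have ci: "c0 (id, id) = 1" by (simp only: const_fun_inject)
  assume "c0 \<in> GQ.B"
  then obtain b where b: "b \<in> cochains1 mult_group" "c0 = GQ.cobd b"
    by (auto simp: coboundaries2_def)
  \<comment> \<open>At the pair of identities the coboundary of \<open>b\<close> reduces to
    \<open>b id\<close>.\<close>
  have "b id = 1"
    using ci GQ.cochains1_nz[OF b(1) id_in_gal]
    by (simp add: b(2) GQ.coboundary_eq[OF b(1) id_in_gal id_in_gal])
  then have "?k (b ?k) * b ?k = -1"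
    using ck by (simp add: b(2) GQ.coboundary_eq[OF b(1) k k] kk)
  then show False using cnj_qbar_mult_self_neq by blast
qed

text \<open>For an invariant divisor in the class the constant cochain 1 is an admissible choice of
  functions. The trivial cocycle would then lie in the coset of \<open>c0\<close>, making
  \<open>c0\<close> a coboundary.\<close>

lemma no_rational_divisor:
  assumes c0: "c0 \<in> GQ.Z2"
    "\<And>p. p \<in> G_Q2 \<Longrightarrow> const_fun (c0 p) = GK.cobd E_cochain p"
  shows "\<not> (\<exists>D\<in>Div_over \<rat>. lin_equiv divisor_E D)"
proof
  assume "\<exists>D\<in>Div_over \<rat>. lin_equiv divisor_E D"
  then obtain D where D: "D \<in> Div" "\<And>\<sigma>. \<sigma> \<in> G_Q \<Longrightarrow> gal_div UNIV \<sigma> D = D" "lin_equiv divisor_E D"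
    by (auto simp: Div_over_def)
  let ?one = "\<lambda>p\<in>G_Q2. 1 :: qbar"
  have "?one \<in> Br_map (div_class divisor_E)"
    unfolding Br_map_def
  proof (intro CollectI conjI bexI ballI allI)
    show "?one \<in> GQ.Z2"
      using GQ.coboundary_cocycle[OF GQ.cochains1_one(1)] by (simp only: GQ.cochains1_one(2))
    show "D \<in> div_class divisor_E" using D(1,3) lin_equiv_sym by (simp add: div_class_def)
    show "(\<lambda>\<sigma>\<in>G_Q. 1 :: ratfun) \<in> cochains1 mult_group" by (rule GK.cochains1_one)
    show "div_of ((\<lambda>\<sigma>\<in>G_Q. 1 :: ratfun) \<sigma>) P = gal_div UNIV \<sigma> D P - D P" if "\<sigma> \<in> G_Q" for \<sigma> P
      using that D(2) div_of_const[of 1 P] by (simp add: const_fun_simps)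
    show "const_fun (?one p) = GK.cobd (\<lambda>\<sigma>\<in>G_Q. 1 :: ratfun) p" if "p \<in> G_Q2" for p
      using that by (simp add: GK.cochains1_one const_fun_simps)
  qed
  then have "\<exists>b\<in>cochains1 mult_group. ?one = GQ.cmult (GQ.cobd b) c0"
    by (simp only: Br_map_eq[OF c0] GQ.coset_eq image_iff)
  then obtain b where b: "b \<in> cochains1 mult_group" "?one = GQ.cmult (GQ.cobd b) c0"
    by (elim bexE)
  \<comment> \<open>The membership says that \<open>cobd b\<close> times \<open>c0\<close> is 1, so
    \<open>c0\<close> is the coboundary of the inverse cochain.\<close>
  have "c0 = GQ.cobd (\<lambda>\<sigma>\<in>G_Q. inverse (b \<sigma>))"
  proof (rule extensionalityI)
    show "c0 \<in> extensional (G_Q2)" using c0(1) by (auto simp: cocycles2_def cochains2_iff PiE_iff)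
    fix p assume p: "p \<in> G_Q2"
    have "1 = GQ.cobd b p * c0 p"
      using fun_cong[OF b(2), of p] p by (simp only: GQ.cmult_def restrict_apply if_P)
    then show "c0 p = GQ.cobd (\<lambda>\<sigma>\<in>G_Q. inverse (b \<sigma>)) p"
      unfolding GQ.cochains1_inverse(2)[OF b(1) p] by (simp add: inverse_unique)
  qed (rule GQ.coboundary_ext)
  then have "c0 \<in> GQ.B" unfolding coboundaries2_def using GQ.cochains1_inverse(1)[OF b(1)] by blast
  then show False using E_cocycle_not_coboundary[OF c0(2)] by blast
qed

section \<open>The class in the relative Brauer group\<close>

lemma H2_sel:
  "\<one>\<^bsub>H2 N act\<^esub> = coboundaries2 N act"
  "carrier (H2 N act) = (\<lambda>c. coboundaries2 N act #>\<^bsub>cochain_group N\<^esub> c) ` cocycles2 N act"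
  by (auto simp: H2_def FactGroup_def RCOSETS_def r_coset_def)

text \<open>Over the function field every cocycle of the class becomes the coboundary of the cochain
  it came from, so the class dies there. Over the constants it contains \<open>c0\<close>, which the
  trivial class does not.\<close>

lemma Br_map_in_Br_rel:
  assumes c0: "c0 \<in> GQ.Z2"
    "\<And>p. p \<in> G_Q2 \<Longrightarrow> const_fun (c0 p) = GK.cobd E_cochain p"
  shows "Br_map (div_class divisor_E) \<in> carrier Br_rel"
    "Br_map (div_class divisor_E) \<noteq> \<one>\<^bsub>Br_rel\<^esub>"
proof -
  have "c0 = GQ.cmult (GQ.cobd (\<lambda>\<sigma>\<in>G_Q. 1)) c0"
    using c0(1) by (intro extensionalityI[of _ "G_Q2"])
      (auto simp: GQ.cochains1_one GQ.cmult_def cocycles2_def cochains2_iff PiE_iff)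
  then have "\<exists>b\<in>cochains1 mult_group. c0 = GQ.cmult (GQ.cobd b) c0"
    using GQ.cochains1_one(1) by (intro bexI)
  then have c0_mem: "c0 \<in> Br_map (div_class divisor_E)"
    by (simp only: Br_map_eq[OF c0] GQ.coset_eq image_iff)
  then show "Br_map (div_class divisor_E) \<noteq> \<one>\<^bsub>Br_rel\<^esub>"
    using E_cocycle_not_coboundary[OF c0(2)] by (auto simp: Br_rel_def Br_Q_def H2_sel)
  have "GK.B #>\<^bsub>cochain_group mult_group\<^esub> (\<lambda>p\<in>G_Q2. const_fun (c p)) = GK.B"
    if c: "c \<in> Br_map (div_class divisor_E)" for c
  proof (rule GK.coset_of_coboundary)
    obtain f where f: "f \<in> cochains1 mult_group"
      "\<And>p. p \<in> G_Q2 \<Longrightarrow> const_fun (c p) = GK.cobd f p"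
      using c unfolding Br_map_def by blast
    have "(\<lambda>p\<in>G_Q2. const_fun (c p)) = GK.cobd f"
      using f(2) by (intro extensionalityI[OF _ GK.coboundary_ext]) auto
    then show "(\<lambda>p\<in>G_Q2. const_fun (c p)) \<in> GK.B" using f(1) by (simp add: coboundaries2_def)
  qed
  \<comment> \<open>\<open>H2_map\<close> is a union over representatives: each contributes the
    trivial coset, and \<open>c0\<close> shows that there is at least one.\<close>
  then have "H2_map const_fun mult_group gal_fun (Br_map (div_class divisor_E)) = GK.B"
    using c0_mem unfolding H2_map_def by blast
  moreover have "Br_map (div_class divisor_E) \<in> carrier Br_Q"
    using c0 by (simp add: Br_Q_def H2_sel Br_map_eq)
  ultimately show "Br_map (div_class divisor_E) \<in> carrier Br_rel"
    by (simp add: Br_rel_def kernel_def Br_C4_def Let_def H2_sel)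
qed

theorem proposition4p4:
  shows "(divisor_E \<in> Div_over Q_zeta8 \<and>
      div_class divisor_E \<in> Jac Q_zeta8 \<and>
      (\<forall>\<sigma>\<in>gal Q_zeta8 \<rat>. div_class (gal_div Q_zeta8 \<sigma> divisor_E) = div_class divisor_E) \<and>
      div_class divisor_E \<in> Jac \<rat>) \<and>
    (\<not> (\<exists>D\<in>Div_over \<rat>. lin_equiv divisor_E D) \<and>
      Br_map (div_class divisor_E) \<in> carrier Br_rel \<and>
      Br_map (div_class divisor_E) \<noteq> \<one>\<^bsub>Br_rel\<^esub>)"
proof -
  obtain c0 where c0: "c0 \<in> GQ.Z2"
    "\<And>p. p \<in> G_Q2 \<Longrightarrow> const_fun (c0 p) = GK.cobd E_cochain p"
    using E_cocycle_exists by blast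
  show ?thesis
    using divisor_E_Jac no_rational_divisor[OF c0] Br_map_in_Br_rel[OF c0] by blast
qed

end
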